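(* Let $\ell\ge3$ be an integer. There is a constant $c=c(\ell)>0$ such that, whenever $p=p(n)\ge n^{-c}$ (with $p\le1$), $$\lim_{n\to\infty}\Pr\left[\text{every maximum } \mathcal K_\ell\text{-free subgraph of } G_{n,p}\text{ is }(\ell-1)\text{-partite}\right]=1.$$
   Context: $G_{n,p}$ is the binomial random graph on vertex set $[n]=\{1,\dots,n\}$, in which each possible edge is present independently with probability $p$. $\mathcal K_\ell$ is the complete graph on $\ell$ vertices. Subgraphs are not necessarily induced. A maximum $\mathcal K_\ell$-free subgraph of $G$ is a subgraph of $G$ containing no copy of $\mathcal K_\ell$ and having the largest possible number of edges. *)

theory Defs
  imports "HOL-Probability.Probability" "HOL-Library.Ramsey"
begin

text \<open>A simple graph is a pair of a vertex set and a set of 2-element subsets of it;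
  \<^term>\<open>nsets V 2\<close> is the set of all 2-element subsets of \<^term>\<open>V\<close>.\<close>

type_synonym 'a graph = "'a set \<times> 'a set set"

definition vertices :: "'a graph \<Rightarrow> 'a set" where
  "vertices G = fst G"

definition edges :: "'a graph \<Rightarrow> 'a set set" where
  "edges G = snd G"

definition simple_graph :: "'a graph \<Rightarrow> bool" where
  "simple_graph G \<longleftrightarrow> edges G \<subseteq> nsets (vertices G) 2"

definition subgraph :: "'a graph \<Rightarrow> 'a graph \<Rightarrow> bool" where
  "subgraph H G \<longleftrightarrow>
     simple_graph H \<and> vertices H \<subseteq> vertices G \<and> edges H \<subseteq> edges G"

definition graph_iso :: "'a graph \<Rightarrow> 'b graph \<Rightarrow> bool" where
  "graph_iso G H \<longleftrightarrow>
     (\<exists>f. bij_betw f (vertices G) (vertices H) \<and> edges H = (\<lambda>e. f ` e) ` edges G)"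

definition complete_graph :: "nat \<Rightarrow> nat graph" where
  "complete_graph l = ({1..l}, nsets {1..l} 2)"

definition contains_copy :: "'b graph \<Rightarrow> 'a graph \<Rightarrow> bool" where
  "contains_copy F G \<longleftrightarrow> (\<exists>H. subgraph H G \<and> graph_iso F H)"

definition clique_free :: "nat \<Rightarrow> 'a graph \<Rightarrow> bool" where
  "clique_free l G \<longleftrightarrow> \<not> contains_copy (complete_graph l) G"

definition max_clique_free_subgraph :: "nat \<Rightarrow> 'a graph \<Rightarrow> 'a graph \<Rightarrow> bool" where
  "max_clique_free_subgraph l G H \<longleftrightarrow>
     subgraph H G \<and> clique_free l H \<and>
     (\<forall>H'. subgraph H' G \<and> clique_free l H' \<longrightarrow> card (edges H') \<le> card (edges H))"

text \<open>The parts are allowed to be empty.\<close>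

definition partite :: "nat \<Rightarrow> 'a graph \<Rightarrow> bool" where
  "partite r G \<longleftrightarrow>
     (\<exists>P. disjoint_family_on P {..<r} \<and> (\<Union>i<r. P i) = vertices G \<and>
          (\<forall>e\<in>edges G. \<forall>i<r. \<not> e \<subseteq> P i))"

text \<open>The edge indicators are independent Bernoulli variables (\<^const>\<open>Pi_pmf\<close> is the product
  distribution). \<^const>\<open>bernoulli_pmf\<close> has its usual meaning only for parameters in the unit
  interval.\<close>

definition Gnp :: "nat \<Rightarrow> real \<Rightarrow> nat graph pmf" where
  "Gnp n p =
     map_pmf (\<lambda>X. ({1..n}, {e \<in> nsets {1..n} 2. X e}))
       (Pi_pmf (nsets {1..n} 2) False (\<lambda>_. bernoulli_pmf p))"

end

theory Submission
  imports Defs "HOL-Real_Asymp.Real_Asymp"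
begin

text \<open>
  Put \<open>r = l - 1\<close>. All error terms are measured in powers of \<open>\<theta> = n\<^sup>-\<^sup>c\<close>. Edge counts of \<open>G\<close> between any two
  vertex sets are correct up to \<open>\<delta> n\<^sup>2\<close>, where \<open>\<delta>\<close> is a large power of \<open>\<theta>\<close>; a Moon--Moser argument
  relative to \<open>G\<close> then shows that a \<open>K\<^sub>l\<close>-free subgraph \<open>H\<close> with at least as many edges as a maximum
  \<open>r\<close>-cut has few \<open>G\<close>-triangles with exactly one edge in \<open>H\<close>. Hence being joined in \<open>G \<setminus> H\<close> is almost
  transitive, and \<open>H\<close> is \<open>r\<close>-partite up to \<open>\<theta>\<^sup>k n\<^sup>2\<close> edges.

  Take the colouring \<open>\<pi>\<close> maximising the \<open>r\<close>-cut of \<open>H\<close>. Every monochromatic edge \<open>xy\<close> of \<open>H\<close> has few common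
  \<open>H\<close>-neighbours in some other part, so an end of \<open>xy\<close> misses many cut edges of \<open>G\<close>, or \<open>xy\<close> is
  atypical: \<open>x\<close> and \<open>y\<close> have few common \<open>G\<close>-neighbours in that part. Edges of the first kind are too few
  to pay for the missing cut edges, so atypical edges must exist and \<open>\<pi>\<close> is nearly a maximum
  cut of \<open>G\<close>.

  This is ruled out with the Gibbs measure \<open>\<mu>(\<pi>) \<propto> 2^cut(\<pi>)\<close>. As \<open>\<mu>(\<pi>)\<close> increases with the edges cut by
  \<open>\<pi>\<close>, Harris' inequality bounds the expected measure of the colourings with atypical pairs by the
  probability that a fixed colouring has them, with no union bound over colourings. Comparing edge
  marginals with and without the edge shows that two independent samples of \<open>\<mu>\<close> almost agree, so
  the partition function exceeds its largest term only by a factor \<open>exp(o(n))\<close>, and a nearly maximum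
  cut with atypical pairs would have too large a measure.
\<close>

section \<open>Edges and triangles in quasi-random graphs\<close>

text \<open>A union bound over the r^n colourings is hopeless: for one colouring, m disjoint
  atypical pairs have probability about exp(-C p^2 m n), and p^2 m may tend to 0. The Gibbs weights
  of all colourings sum to 1, so only the choice of the pairs, at most (r n^2)^m, has to be paid
  for, together with the ratio of the partition function to its largest term, which must stay below
  exp(\<theta>^5 n). That ratio is small for the following reason. Adding an edge e turns its
  marginal a into 2a/(1+a); therefore E[(1_e - p) m_e] is at least p(1-p)/2 times E[m_e (1 - m_e)],
  where m_e is the marginal of e. Summed over e, (1_e - p) m_e becomes the Gibbs average of the
  deviation of a cut from its expected number of edges, and this deviation is uniformly small. The
  factor 1 - p degenerates for p near 1; there all degrees are so large that atypical pairs cannot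
  occur. All errors are powers of \<theta>, so a constant factor is absorbed by spending one more
  power. Exponents double when an error is squared and triple when a part of the partition is
  extracted, which is where the exponents 2^(r+1) and 3^r come from.\<close>

locale quasi_random =
  fixes V :: "'a set" and g :: "'a \<Rightarrow> 'a \<Rightarrow> real" and p \<delta> \<theta> :: real
  assumes finite_V: "finite V" and V_nonempty: "V \<noteq> {}"
    and g01: "\<And>x y. g x y \<in> {0, 1}" and g_sym: "\<And>x y. g x y = g y x"
    and g_irrefl: "\<And>x. g x x = 0" and g_outside: "\<And>x y. x \<notin> V \<Longrightarrow> g x y = 0"
    and theta_pos: "0 < \<theta>" and theta_le: "\<theta> \<le> 1 / 10"
    and theta_le_p: "\<theta> \<le> p" and p_le: "p \<le> 1" and delta_nonneg: "0 \<le> \<delta>"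
    and discrepancy: "\<And>f1 f2 :: 'a \<Rightarrow> real. (\<And>x. f1 x \<in> {0, 1}) \<Longrightarrow> (\<And>x. f2 x \<in> {0, 1}) \<Longrightarrow>
      \<bar>\<Sum>u\<in>V. \<Sum>v\<in>V. f1 u * f2 v * (g u v - p)\<bar> \<le> \<delta> * real (card V) ^ 2"
begin

abbreviation n :: real where "n \<equiv> real (card V)"

definition sub :: "('a \<Rightarrow> 'a \<Rightarrow> real) \<Rightarrow> bool" where
  "sub h \<longleftrightarrow> (\<forall>x y. h x y \<in> {0, 1} \<and> h x y = h y x \<and> h x y \<le> g x y)"

definition kfree :: "nat \<Rightarrow> ('a \<Rightarrow> 'a \<Rightarrow> real) \<Rightarrow> bool" where
  "kfree s h \<longleftrightarrow> \<not> (\<exists>S\<subseteq>V. card S = s \<and> (\<forall>u\<in>S. \<forall>v\<in>S. u \<noteq> v \<longrightarrow> h u v = 1))"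

lemma n_ge_1: "1 \<le> n"
  using finite_V V_nonempty by (simp add: Suc_leI card_gt_0_iff)

lemma p_pos: "0 < p"
  using theta_pos theta_le_p by linarith

lemma theta_le_1: "\<theta> \<le> 1"
  using theta_le by linarith

lemma theta_mono: "a \<le> b \<Longrightarrow> \<theta> ^ b \<le> \<theta> ^ a"
  using theta_pos theta_le_1 by (intro power_decreasing) auto

lemma discrepancyD:
  assumes "\<And>x. f1 x \<in> {0, 1}" "\<And>x. f2 x \<in> {0, 1}"
  shows "(\<Sum>u\<in>V. \<Sum>v\<in>V. f1 u * f2 v * (g u v - p)) \<le> \<delta> * n ^ 2"
    "- (\<delta> * n ^ 2) \<le> (\<Sum>u\<in>V. \<Sum>v\<in>V. f1 u * f2 v * (g u v - p))"
  using discrepancy[of f1 f2] assms by (auto simp: abs_le_iff)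

lemma edge_count:
  assumes "\<And>x. f1 x \<in> {0, 1}" "\<And>x. f2 x \<in> {0, 1}"
  shows "(\<Sum>u\<in>V. \<Sum>v\<in>V. f1 u * f2 v * g u v) \<le> p * (\<Sum>u\<in>V. f1 u) * (\<Sum>v\<in>V. f2 v) + \<delta> * n ^ 2"
    "p * (\<Sum>u\<in>V. f1 u) * (\<Sum>v\<in>V. f2 v) - \<delta> * n ^ 2 \<le> (\<Sum>u\<in>V. \<Sum>v\<in>V. f1 u * f2 v * g u v)"
proof -
  have "(\<Sum>u\<in>V. \<Sum>v\<in>V. f1 u * f2 v * (g u v - p)) =
      (\<Sum>u\<in>V. \<Sum>v\<in>V. f1 u * f2 v * g u v) - (\<Sum>u\<in>V. \<Sum>v\<in>V. p * (f1 u * f2 v))"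
    by (simp add: algebra_simps sum_subtractf)
  also have "(\<Sum>u\<in>V. \<Sum>v\<in>V. p * (f1 u * f2 v)) = p * (\<Sum>u\<in>V. f1 u) * (\<Sum>v\<in>V. f2 v)"
    by (simp only: mult.assoc sum_product) (simp add: sum_distrib_left)
  finally show "(\<Sum>u\<in>V. \<Sum>v\<in>V. f1 u * f2 v * g u v) \<le> p * (\<Sum>u\<in>V. f1 u) * (\<Sum>v\<in>V. f2 v) + \<delta> * n ^ 2"
    "p * (\<Sum>u\<in>V. f1 u) * (\<Sum>v\<in>V. f2 v) - \<delta> * n ^ 2 \<le> (\<Sum>u\<in>V. \<Sum>v\<in>V. f1 u * f2 v * g u v)"
    using discrepancyD[of f1 f2] assms by auto
qed

lemma mult01: "x \<in> {0, 1} \<Longrightarrow> y \<in> {0, 1} \<Longrightarrow> x * y \<in> {0, 1 :: real}"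
  by auto

text \<open>Telescoping g a v * g a w - p^2 = g a w (g a v - p) + p (g a w - p) and fixing w in the
  first term, v in the second, leaves a weight that is a function of one vertex times a function of
  the other, although \<open>R\<close> is an arbitrary relation. The discrepancy condition applies
  to each slice.\<close>

lemma cherry_count:
  assumes R: "\<And>v w. R v w \<in> {0, 1 :: real}" and al: "\<And>a. al a \<in> {0, 1 :: real}"
  shows "\<bar>\<Sum>v\<in>V. \<Sum>w\<in>V. \<Sum>a\<in>V. R v w * al a * (g a v * g a w - p ^ 2)\<bar> \<le> 2 * \<delta> * n ^ 3"
proof -
  let ?A = "\<Sum>w\<in>V. \<Sum>v\<in>V. \<Sum>a\<in>V. R v w * (al a * g a w) * (g v a - p)"
  let ?B = "\<Sum>v\<in>V. \<Sum>w\<in>V. \<Sum>a\<in>V. R v w * al a * (g w a - p)"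
  have "(\<Sum>v\<in>V. \<Sum>w\<in>V. \<Sum>a\<in>V. R v w * al a * (g a v * g a w - p ^ 2)) =
      (\<Sum>v\<in>V. \<Sum>w\<in>V. \<Sum>a\<in>V. R v w * (al a * g a w) * (g v a - p) + p * (R v w * al a * (g w a - p)))"
    by (intro sum.cong refl) (simp add: algebra_simps power2_eq_square g_sym)
  also have "\<dots> = (\<Sum>v\<in>V. \<Sum>w\<in>V. \<Sum>a\<in>V. R v w * (al a * g a w) * (g v a - p)) + p * ?B"
    by (simp add: sum.distrib sum_distrib_left)
  also have "(\<Sum>v\<in>V. \<Sum>w\<in>V. \<Sum>a\<in>V. R v w * (al a * g a w) * (g v a - p)) = ?A"
    by (rule sum.swap)
  finally have eq: "(\<Sum>v\<in>V. \<Sum>w\<in>V. \<Sum>a\<in>V. R v w * al a * (g a v * g a w - p ^ 2)) = ?A + p * ?B" .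
  have "\<bar>?A\<bar> \<le> (\<Sum>w\<in>V. \<bar>\<Sum>v\<in>V. \<Sum>a\<in>V. R v w * (al a * g a w) * (g v a - p)\<bar>)"
    by (rule sum_abs)
  also have "\<dots> \<le> (\<Sum>w\<in>V. \<delta> * n ^ 2)"
    by (intro sum_mono discrepancy mult01 R al g01)
  finally have A: "\<bar>?A\<bar> \<le> \<delta> * n ^ 3" by (simp add: power3_eq_cube power2_eq_square mult_ac)
  have "\<bar>?B\<bar> \<le> (\<Sum>v\<in>V. \<bar>\<Sum>w\<in>V. \<Sum>a\<in>V. R v w * al a * (g w a - p)\<bar>)"
    by (rule sum_abs)
  also have "\<dots> \<le> (\<Sum>v\<in>V. \<delta> * n ^ 2)"
    by (intro sum_mono discrepancy mult01 R al g01)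
  finally have B: "\<bar>?B\<bar> \<le> \<delta> * n ^ 3" by (simp add: power3_eq_cube power2_eq_square mult_ac)
  have "\<bar>p * ?B\<bar> \<le> 1 * (\<delta> * n ^ 3)"
    unfolding abs_mult using B p_pos p_le by (intro mult_mono) auto
  with A eq show ?thesis by linarith
qed

lemma cherry_count_bounds:
  assumes R: "\<And>v w. R v w \<in> {0, 1 :: real}" and al: "\<And>a. al a \<in> {0, 1 :: real}"
  defines "T \<equiv> \<Sum>v\<in>V. \<Sum>w\<in>V. \<Sum>a\<in>V. R v w * al a * g a v * g a w"
  defines "M \<equiv> p ^ 2 * (\<Sum>a\<in>V. al a) * (\<Sum>v\<in>V. \<Sum>w\<in>V. R v w)"
  shows "T \<le> M + 2 * \<delta> * n ^ 3" "M - 2 * \<delta> * n ^ 3 \<le> T"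
proof -
  have "(\<Sum>v\<in>V. \<Sum>w\<in>V. \<Sum>a\<in>V. R v w * al a * (g a v * g a w - p ^ 2)) =
     T - (\<Sum>v\<in>V. \<Sum>w\<in>V. \<Sum>a\<in>V. p ^ 2 * R v w * al a)"
    unfolding T_def by (simp add: algebra_simps sum_subtractf)
  also have "(\<Sum>v\<in>V. \<Sum>w\<in>V. \<Sum>a\<in>V. p ^ 2 * R v w * al a) = M"
    unfolding M_def sum_distrib_left[symmetric] sum_distrib_right[symmetric] by (simp add: mult_ac)
  finally show "T \<le> M + 2 * \<delta> * n ^ 3" "M - 2 * \<delta> * n ^ 3 \<le> T"
    using cherry_count[of R al] R al by (auto simp: abs_le_iff)
qed

section \<open>Moon--Moser and Turan bounds relative to \<open>g\<close>\<close>

definition deg :: "('a \<Rightarrow> 'a \<Rightarrow> real) \<Rightarrow> 'a \<Rightarrow> real" where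
  "deg h x = (\<Sum>v\<in>V. h x v)"

definition viol :: "('a \<Rightarrow> 'a \<Rightarrow> real) \<Rightarrow> real" where
  "viol h = (\<Sum>x\<in>V. \<Sum>y\<in>V. \<Sum>z\<in>V. h x y * (g x z - h x z) * (g y z - h y z))"

lemma subD:
  assumes "sub h"
  shows "h x y \<in> {0, 1}" "h x y = h y x" "h x y \<le> g x y" "h x y * g x y = h x y" "h x x = 0"
    "0 \<le> h x y" "h x y \<le> 1" "g x y - h x y \<in> {0, 1}" "h x y = 1 \<Longrightarrow> x \<in> V"
proof -
  have *: "\<And>x y. h x y \<in> {0, 1}" "\<And>x y. h x y = h y x" "\<And>x y. h x y \<le> g x y"
    using assms unfolding sub_def by blast+
  show "h x y \<in> {0, 1}" "h x y = h y x" "h x y \<le> g x y" by (fact *)+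
  show "h x y * g x y = h x y" "0 \<le> h x y" "h x y \<le> 1" "g x y - h x y \<in> {0, 1}"
    using *(1)[of x y] *(3)[of x y] g01[of x y] by auto
  show "x \<in> V" if "h x y = 1" using *(3)[of x y] that g_outside[of x y] by fastforce
  show "h x x = 0" using *(1)[of x x] *(3)[of x x] g_irrefl[of x] by auto
qed

text \<open>The Moon--Moser argument for edges and triangles, relative to \<^term>\<open>g\<close>: for an edge \<open>xy\<close> of
  \<^term>\<open>h\<close> and a common \<^term>\<open>g\<close>-neighbour \<open>z\<close> one has
  \<open>[xz] + [yz] = 1 + [xz][yz] - (1 - [xz])(1 - [yz])\<close>.\<close>

lemma moon_moser:
  assumes h: "sub h" and A: "A \<subseteq> V" and supp: "\<And>x y. h x y = 1 \<Longrightarrow> x \<in> A"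
  shows "2 * p * (\<Sum>x\<in>V. deg h x ^ 2) + (if A = V then viol h else 0) \<le>
     p ^ 2 * real (card A) * (\<Sum>x\<in>V. deg h x) +
     (\<Sum>x\<in>V. \<Sum>y\<in>V. \<Sum>z\<in>V. h x y * h x z * h y z) + 4 * \<delta> * n ^ 3"
proof -
  \<comment> \<open>Both ends of an edge of \<open>h\<close> lie in \<open>A\<close>, so restricting
    z to \<open>A\<close> does not change the two terms with two edges of \<open>h\<close>. It turns
    n into card \<open>A\<close> in the main term, as an induction over neighbourhoods needs; the
    last term becomes the part of \<open>viol\<close> with z in \<open>A\<close>.\<close>
  define al where "al z = (if z \<in> A then 1 else 0 :: real)" for z
  have al01: "al z \<in> {0, 1}" for z by (simp add: al_def)
  have hal: "h x z * al z = h x z" for x z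
    using supp[of z x] subD(1,2)[OF h, of x z] by (auto simp: al_def)
  let ?S = "\<lambda>f. \<Sum>x\<in>V. \<Sum>y\<in>V. \<Sum>z\<in>V. (f x y z :: real)"
  let ?L = "?S (\<lambda>x y z. h x y * h x z * g y z)"
  let ?v = "?S (\<lambda>x y z. al z * (h x y * (g x z - h x z) * (g y z - h y z)))"
  have "h x y * h x z * g y z + h x y * h y z * g x z + al z * (h x y * (g x z - h x z) * (g y z - h y z))
     = h x y * al z * g z x * g z y + h x y * h x z * h y z" for x y z
  proof (cases "al z = 0")
    case True
    then show ?thesis using hal[of x z] hal[of y z] by auto
  next
    case False
    then have "al z = 1" using al01[of z] by auto
    then show ?thesis using g_sym[of z x] g_sym[of z y] by (simp add: algebra_simps)
  qed
  then have "?S (\<lambda>x y z. h x y * h x z * g y z + h x y * h y z * g x z + al z * (h x y * (g x z - h x z) * (g y z - h y z)))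
     = ?S (\<lambda>x y z. h x y * al z * g z x * g z y + h x y * h x z * h y z)"
    by presburger
  then have "?L + ?S (\<lambda>x y z. h x y * h y z * g x z) + ?v =
      ?S (\<lambda>x y z. h x y * al z * g z x * g z y) + ?S (\<lambda>x y z. h x y * h x z * h y z)"
    by (simp add: sum.distrib)
  moreover have "?S (\<lambda>x y z. h x y * h y z * g x z) = ?L"
    by (subst sum.swap) (simp add: subD(2)[OF h] mult_ac)
  moreover have "?S (\<lambda>x y z. h x y * al z * g z x * g z y) \<le>
      p ^ 2 * (\<Sum>a\<in>V. al a) * (\<Sum>v\<in>V. \<Sum>w\<in>V. h v w) + 2 * \<delta> * n ^ 3"
    by (rule cherry_count_bounds(1)) (use subD(1)[OF h] al01 in auto)
  moreover have "(\<Sum>a\<in>V. al a) = real (card A)"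
  proof -
    have "(\<Sum>a\<in>V. al a) = (\<Sum>a\<in>A. 1)"
      using A finite_V by (intro sum.mono_neutral_cong_right) (auto simp: al_def)
    then show ?thesis by simp
  qed
  \<comment> \<open>For fixed x the sum counts the edges of \<open>g\<close> inside the
    \<open>h\<close>-neighbourhood of x.\<close>
  moreover have "p * (\<Sum>x\<in>V. deg h x ^ 2) - \<delta> * n ^ 3 \<le> ?L"
  proof -
    have "p * (\<Sum>x\<in>V. deg h x ^ 2) - \<delta> * n ^ 3 = (\<Sum>x\<in>V. p * (\<Sum>y\<in>V. h x y) * (\<Sum>y\<in>V. h x y) - \<delta> * n ^ 2)"
      by (simp only: deg_def[symmetric]) (simp add: sum_subtractf sum_distrib_left power2_eq_square power3_eq_cube mult_ac)
    also have "\<dots> \<le> ?L"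
      by (intro sum_mono edge_count(2)) (use subD(1)[OF h] in auto)
    finally show ?thesis .
  qed
  moreover have "(if A = V then viol h else 0) \<le> ?v"
  proof (cases "A = V")
    case True
    then show ?thesis by (simp add: viol_def al_def)
  next
    case False
    have "0 \<le> ?v"
      using subD[OF h] al01 g01 by (intro sum_nonneg mult_nonneg_nonneg) (auto simp: al_def)
    then show ?thesis using False by simp
  qed
  ultimately show ?thesis by (simp add: deg_def)
qed

lemma square_of_sum_le:
  assumes "A \<subseteq> V" "\<And>x. x \<in> V \<Longrightarrow> x \<notin> A \<Longrightarrow> f x = 0"
  shows "(\<Sum>x\<in>V. f x) ^ 2 \<le> real (card A) * (\<Sum>x\<in>V. (f x :: real) ^ 2)"
proof -
  have "(\<Sum>x\<in>V. f x) = (\<Sum>x\<in>A. f x * 1)" "(\<Sum>x\<in>V. f x ^ 2) = (\<Sum>x\<in>A. f x ^ 2)"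
    using assms finite_V by (auto intro!: sum.mono_neutral_right)
  then show ?thesis
    using Cauchy_Schwarz_ineq_sum[of f "\<lambda>_. 1" A] by (simp add: mult.commute)
qed

lemma deg_bounds: "sub h \<Longrightarrow> 0 \<le> deg h x" "sub h \<Longrightarrow> deg h x \<le> n"
proof -
  assume h: "sub h"
  show "0 \<le> deg h x" unfolding deg_def using subD(6)[OF h] by (intro sum_nonneg)
  have "deg h x \<le> (\<Sum>v\<in>V. 1)" unfolding deg_def using subD(7)[OF h] by (intro sum_mono)
  then show "deg h x \<le> n" by simp
qed

text \<open>The triangles at x are the edges of \<open>h\<close> inside its neighbourhood, and a
  clique on Suc r vertices formed by them would extend by x. So the bound \<open>U\<close> is used
  once for each x, with \<open>A\<close> the neighbourhood; card \<open>A\<close> squared becomes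
  the squared degree.\<close>

lemma triangle_count:
  assumes U: "\<And>h A. sub h \<Longrightarrow> A \<subseteq> V \<Longrightarrow> (\<And>x y. h x y = 1 \<Longrightarrow> x \<in> A) \<Longrightarrow> kfree (Suc r) h \<Longrightarrow>
      (\<Sum>x\<in>V. deg h x) \<le> (1 - 1 / real r) * p * real (card A) ^ 2 + e * n ^ 2"
    and h: "sub h" and free: "kfree (Suc (Suc r)) h" and r: "r \<ge> 1"
  shows "(\<Sum>x\<in>V. \<Sum>y\<in>V. \<Sum>z\<in>V. h x y * h x z * h y z) \<le>
     (1 - 1 / real r) * p * (\<Sum>x\<in>V. deg h x ^ 2) + e * n ^ 3"
proof -
  have "(\<Sum>y\<in>V. \<Sum>z\<in>V. h x y * h x z * h y z) \<le> (1 - 1 / real r) * p * deg h x ^ 2 + e * n ^ 2"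
    if x: "x \<in> V" for x
  proof -
    define h' where "h' y z = (if y \<in> V \<and> z \<in> V then h x y * h x z * h y z else 0)" for y z
    define A where "A = {y \<in> V. h x y = 1}"
    have h': "sub h'"
      unfolding sub_def
    proof (intro allI conjI)
      fix y z
      have *: "h x y \<in> {0, 1}" "h x z \<in> {0, 1}" "h y z \<in> {0, 1}" by (rule subD(1)[OF h])+
      show "h' y z \<in> {0, 1}" using * unfolding h'_def by auto
      show "h' y z = h' z y" using subD(2)[OF h, of y z] unfolding h'_def by (simp add: mult_ac)
      show "h' y z \<le> g y z" using * subD(3)[OF h, of y z] g01[of y z] unfolding h'_def by auto
    qed
    have "deg h x = (\<Sum>v\<in>A. 1)"
      unfolding deg_def A_def using finite_V subD(1)[OF h]
      by (intro sum.mono_neutral_cong_right) auto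
    then have dA: "deg h x = real (card A)" by simp
    have supp: "y \<in> A" if "h' y z = 1" for y z
      using that subD(1)[OF h, of x y] by (auto simp: h'_def A_def split: if_splits)
    have "kfree (Suc r) h'"
      unfolding kfree_def
    proof safe
      fix S assume S: "S \<subseteq> V" "card S = Suc r" "\<forall>u\<in>S. \<forall>v\<in>S. u \<noteq> v \<longrightarrow> h' u v = 1"
      have fin: "finite S" using S(2) by (metis card.infinite nat.distinct(1))
      \<comment> \<open>The values of \<open>h'\<close> reveal h x u = 1 only through a second
        vertex of S, which exists because r \<ge> 1.\<close>
      have hx: "h x u = 1" if u: "u \<in> S" for u
      proof -
        have "card (S - {u}) = r" using S(2) fin u by simp
        then obtain v where "v \<in> S" "v \<noteq> u" using r by (metis Diff_iff One_nat_def card.empty ex_in_conv insertCI not_one_le_zero)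
        then have "h' u v = 1" using S(3) u by auto
        then show ?thesis using supp by (auto simp: A_def)
      qed
      have "x \<notin> S" using hx subD(5)[OF h, of x] by force
      moreover have "h u v = 1" if "u \<in> S" "v \<in> S" "u \<noteq> v" for u v
      proof -
        have "h' u v = 1" using S(3) that by blast
        then show ?thesis using subD(1)[OF h, of u v] by (auto simp: h'_def split: if_splits)
      qed
      ultimately have "card (insert x S) = Suc (Suc r)"
        "\<forall>u\<in>insert x S. \<forall>v\<in>insert x S. u \<noteq> v \<longrightarrow> h u v = 1"
        using S(2) fin hx subD(2)[OF h] by auto
      then show False using free x S(1) unfolding kfree_def by (metis insert_subset)
    qed
    then have "(\<Sum>y\<in>V. deg h' y) \<le> (1 - 1 / real r) * p * real (card A) ^ 2 + e * n ^ 2"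
      using h' supp by (intro U) (auto simp: A_def)
    then have "(\<Sum>y\<in>V. \<Sum>z\<in>V. h x y * h x z * h y z) \<le> (1 - 1 / real r) * p * real (card A) ^ 2 + e * n ^ 2"
      unfolding deg_def h'_def by simp
    then show ?thesis unfolding dA .
  qed
  then have "(\<Sum>x\<in>V. \<Sum>y\<in>V. \<Sum>z\<in>V. h x y * h x z * h y z) \<le>
     (\<Sum>x\<in>V. (1 - 1 / real r) * p * deg h x ^ 2 + e * n ^ 2)"
    by (rule sum_mono)
  also have "\<dots> = (1 - 1 / real r) * p * (\<Sum>x\<in>V. deg h x ^ 2) + e * n ^ 3"
    by (simp add: sum.distrib sum_distrib_left power2_eq_square power3_eq_cube)
  finally show ?thesis .
qed

text \<open>With D the sum of the squared degrees and c that of the degrees, Moon--Moser and the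
  bound for smaller cliques give p D / q \<le> p^2 a c + error, Cauchy--Schwarz gives c^2 \<le> a D,
  and together p c (c - q p a^2) is at most an error term. An excess over the bound enters this
  inequality squared, so the error exponent doubles in each induction step; k + 3 is the quantity
  that doubles exactly.\<close>

lemma turan_relative:
  assumes "r \<ge> 1" "\<delta> \<le> \<theta> ^ (2 ^ r * (k + 3))"
    and "sub h" "A \<subseteq> V" "\<And>x y. h x y = 1 \<Longrightarrow> x \<in> A" "kfree (Suc r) h"
  shows "(\<Sum>x\<in>V. deg h x) \<le> (1 - 1 / real r) * p * real (card A) ^ 2 + \<theta> ^ k * n ^ 2"
  using assms
proof (induction r arbitrary: k h A rule: nat_induct_at_least)
  case base
  have "h x y = 0" if "x \<in> V" "y \<in> V" for x y
  proof (rule ccontr)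
    assume "h x y \<noteq> 0"
    then have "h x y = 1" "x \<noteq> y" using subD[OF base(2)] by blast+
    then have "{x, y} \<subseteq> V \<and> card {x, y} = Suc 1 \<and> (\<forall>u\<in>{x, y}. \<forall>v\<in>{x, y}. u \<noteq> v \<longrightarrow> h u v = 1)"
      using that subD(2)[OF base(2), of x y] by auto
    then show False using base(5) unfolding kfree_def by blast
  qed
  then show ?case using theta_pos n_ge_1 by (simp add: deg_def)
next
  case (Suc r)
  note h = \<open>sub h\<close> and A = \<open>A \<subseteq> V\<close>
  \<comment> \<open>2 k for the squared excess, 1 for the factor p \<ge> \<theta>, and 2 to absorb
    the factor 5.\<close>
  define k' where "k' = 2 * k + 3"
  have exp: "2 ^ Suc r * (k + 3) = 2 ^ r * (k' + 3)" by (simp add: k'_def)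
  have "k' \<le> 2 ^ r * (k' + 3)" by (metis le_add1 le_trans mult_le_mono1 nat_mult_1 one_le_numeral one_le_power)
  then have del: "\<delta> \<le> \<theta> ^ k'" using Suc.prems(1) theta_mono[of k' "2 ^ r * (k' + 3)"] unfolding exp by linarith
  define c D where "c = (\<Sum>x\<in>V. deg h x)" and "D = (\<Sum>x\<in>V. deg h x ^ 2)"
  define a where "a = real (card A)"
  define q where "q = 1 - 1 / real (Suc r)"
  have r1: "real r \<ge> 1" using Suc.hyps by simp
  have q: "q > 0" "q < 1" "1 / q = 1 + 1 / real r" using r1 by (auto simp: q_def field_simps)
  have supp: "x \<in> A" if "h x y = 1" for x y using Suc.prems(4) that .
  have tri: "(\<Sum>x\<in>V. \<Sum>y\<in>V. \<Sum>z\<in>V. h x y * h x z * h y z) \<le> (1 - 1 / real r) * p * D + \<theta> ^ k' * n ^ 3"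
    unfolding D_def
  proof (rule triangle_count[OF _ h Suc.prems(5) Suc.hyps])
    fix h A assume "sub h" "A \<subseteq> V" "\<And>x y. h x y = 1 \<Longrightarrow> x \<in> A" "kfree (Suc r) h"
    then show "(\<Sum>x\<in>V. deg h x) \<le> (1 - 1 / real r) * p * real (card A) ^ 2 + \<theta> ^ k' * n ^ 2"
      by (intro Suc.IH Suc.prems(1)[unfolded exp])
  qed
  have v: "0 \<le> (if A = V then viol h else 0)"
  proof -
    have "0 \<le> viol h" unfolding viol_def using subD[OF h]
      by (intro sum_nonneg mult_nonneg_nonneg) (auto simp: algebra_simps)
    then show ?thesis by simp
  qed
  have "2 * p * D + (if A = V then viol h else 0) \<le> p ^ 2 * a * c +
      (\<Sum>x\<in>V. \<Sum>y\<in>V. \<Sum>z\<in>V. h x y * h x z * h y z) + 4 * \<delta> * n ^ 3"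
    unfolding a_def c_def D_def by (rule moon_moser[OF h A]) (rule supp)
  then have "2 * p * D \<le> p ^ 2 * a * c + (1 - 1 / real r) * p * D + \<theta> ^ k' * n ^ 3 + 4 * \<delta> * n ^ 3"
    using tri v by linarith
  moreover have "4 * \<delta> * n ^ 3 \<le> 4 * \<theta> ^ k' * n ^ 3" using del by (intro mult_right_mono) auto
  ultimately have "(1 + 1 / real r) * p * D \<le> p ^ 2 * a * c + 5 * \<theta> ^ k' * n ^ 3"
    by (simp add: algebra_simps)
  then have main: "p * D / q \<le> p ^ 2 * a * c + 5 * \<theta> ^ k' * n ^ 3"
    unfolding q(3)[symmetric] by simp
  have a: "0 \<le> a" "a \<le> n" unfolding a_def using A finite_V by (auto intro: card_mono)
  have c: "0 \<le> c" unfolding c_def by (intro sum_nonneg deg_bounds h)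
  have "deg h x = 0" if "x \<notin> A" for x
    unfolding deg_def using supp[of x] that subD(1)[OF h] by (intro sum.neutral) blast
  then have cs: "c ^ 2 \<le> a * D" unfolding c_def a_def D_def using A by (intro square_of_sum_le) auto
  show ?case
  proof (rule ccontr)
    assume "\<not> ?thesis"
    then have big: "c > q * p * a ^ 2 + \<theta> ^ k * n ^ 2" by (simp add: c_def q_def a_def)
    have qpa: "0 \<le> q * p * a ^ 2" using q p_pos by simp
    have th: "0 < \<theta> ^ k * n ^ 2" using theta_pos n_ge_1 by simp
    have *: "(\<theta> ^ k * n ^ 2) * (\<theta> ^ k * n ^ 2) < c * (c - q * p * a ^ 2)"
      using big qpa th by (intro mult_strict_mono') auto
    have 1: "\<theta> ^ (2 * k) * n ^ 4 < c ^ 2 - q * p * a ^ 2 * c"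
    proof -
      have "(\<theta> ^ k * n ^ 2) * (\<theta> ^ k * n ^ 2) = \<theta> ^ (2 * k) * n ^ 4"
        by (simp add: mult_2 power_add eval_nat_numeral mult_ac)
      moreover have "c * (c - q * p * a ^ 2) = c ^ 2 - q * p * a ^ 2 * c"
        by (simp add: right_diff_distrib power2_eq_square mult_ac)
      ultimately show ?thesis using * by simp
    qed
    have "p * c ^ 2 / q \<le> p * (a * D) / q" using cs p_pos q by (intro divide_right_mono mult_left_mono) auto
    also have "\<dots> = a * (p * D / q)" by simp
    also have "\<dots> \<le> a * (p ^ 2 * a * c + 5 * \<theta> ^ k' * n ^ 3)" using main a by (intro mult_left_mono)
    also have "\<dots> \<le> p ^ 2 * a ^ 2 * c + 5 * \<theta> ^ k' * n ^ 4"
    proof -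
      have "a * (5 * \<theta> ^ k' * n ^ 3) \<le> n * (5 * \<theta> ^ k' * n ^ 3)" using a theta_pos by (intro mult_right_mono) auto
      then show ?thesis by (simp add: algebra_simps power2_eq_square eval_nat_numeral)
    qed
    finally have "p * c ^ 2 \<le> q * (p ^ 2 * a ^ 2 * c + 5 * \<theta> ^ k' * n ^ 4)" using q by (simp add: field_simps)
    then have "p * (c ^ 2 - q * p * a ^ 2 * c) \<le> q * (5 * \<theta> ^ k' * n ^ 4)"
      by (simp add: algebra_simps power2_eq_square)
    also have "\<dots> \<le> 1 * (5 * \<theta> ^ k' * n ^ 4)" using q theta_pos by (intro mult_right_mono) auto
    finally have 2: "p * (c ^ 2 - q * p * a ^ 2 * c) \<le> 5 * \<theta> ^ k' * n ^ 4" by simp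
    have "\<theta> * (\<theta> ^ (2 * k) * n ^ 4) \<le> p * (c ^ 2 - q * p * a ^ 2 * c)"
      using 1 theta_le_p theta_pos p_pos n_ge_1 by (intro mult_mono) auto
    also note 2
    also have "5 * \<theta> ^ k' * n ^ 4 = (5 * \<theta> ^ 2) * (\<theta> * (\<theta> ^ (2 * k) * n ^ 4))"
      by (simp add: k'_def power_add eval_nat_numeral)
    also have "\<dots> \<le> (1 / 2) * (\<theta> * (\<theta> ^ (2 * k) * n ^ 4))"
    proof (rule mult_right_mono)
      have "\<theta> * \<theta> \<le> 1 / 10 * (1 / 10)" using theta_pos theta_le by (intro mult_mono) auto
      then show "5 * \<theta> ^ 2 \<le> 1 / 2" by (simp add: power2_eq_square)
    qed (use theta_pos in auto)
    finally have "\<theta> * (\<theta> ^ (2 * k) * n ^ 4) \<le> 0" by simp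
    moreover have "0 < \<theta> * (\<theta> ^ (2 * k) * n ^ 4)" using theta_pos n_ge_1 by simp
    ultimately show False by linarith
  qed
qed

subsection \<open>Stability\<close>

definition co :: "('a \<Rightarrow> 'a \<Rightarrow> real) \<Rightarrow> 'a \<Rightarrow> 'a \<Rightarrow> real" where
  "co h x y = g x y - h x y"

lemma coD:
  assumes "sub h"
  shows "co h x y \<in> {0, 1}" "co h x y = co h y x" "0 \<le> co h x y" "co h x y \<le> 1"
    "g x y = co h x y + h x y" "co h x y * h x y = 0"
proof -
  show *: "co h x y \<in> {0, 1}" unfolding co_def by (rule subD[OF assms])
  show "co h x y = co h y x" unfolding co_def using subD(2)[OF assms, of x y] g_sym[of x y] by simp
  show "0 \<le> co h x y" "co h x y \<le> 1" using * by auto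
  show "g x y = co h x y + h x y" by (simp add: co_def)
  show "co h x y * h x y = 0"
    using subD(4)[OF assms, of x y] subD(1)[OF assms, of x y] by (auto simp: co_def)
qed

lemma viol_co: "viol h = (\<Sum>x\<in>V. \<Sum>y\<in>V. \<Sum>z\<in>V. h x y * co h x z * co h y z)"
  by (simp add: viol_def co_def)

lemma viol_nonneg: "sub h \<Longrightarrow> 0 \<le> viol h"
  unfolding viol_co using subD(6) coD(3) by (intro sum_nonneg mult_nonneg_nonneg) auto

text \<open>The discrepancy condition is applied to the set of vertices of degree at least p n and
  to its complement, each against all of V.\<close>

lemma degree_deviation: "(\<Sum>x\<in>V. \<bar>deg g x - p * n\<bar>) \<le> 2 * \<delta> * n ^ 2"
proof -
  define s :: "'a \<Rightarrow> real" where "s x = (if deg g x \<ge> p * n then 1 else 0)" for x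
  have s01: "s x \<in> {0, 1}" "1 - s x \<in> {0, 1}" for x by (auto simp: s_def)
  have e: "(\<Sum>u\<in>V. \<Sum>v\<in>V. f u * 1 * (g u v - p)) = (\<Sum>u\<in>V. f u * (deg g u - p * n))" for f :: "'a \<Rightarrow> real"
    by (simp add: deg_def sum_subtractf right_diff_distrib mult_ac flip: sum_distrib_left)
  have "(\<Sum>x\<in>V. \<bar>deg g x - p * n\<bar>) =
      (\<Sum>x\<in>V. s x * (deg g x - p * n)) - (\<Sum>x\<in>V. (1 - s x) * (deg g x - p * n))"
    unfolding sum_subtractf[symmetric] by (intro sum.cong refl) (auto simp: s_def)
  then show ?thesis
    using discrepancyD(1)[of s "\<lambda>_. 1"] discrepancyD(2)[of "\<lambda>x. 1 - s x" "\<lambda>_. 1"] s01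
    unfolding e by force
qed

text \<open>Near equality in the Turan bound makes its two sources tight: Moon--Moser leaves
  \<open>viol h\<close>, Cauchy--Schwarz leaves the degree variance W, and p W / q +
  \<open>viol h\<close> is at most the slack. The L1 distance of the degrees from their mean is a
  square root of this, whence the exponent 2 j + 3 in the hypothesis. Degrees are near p n in
  \<open>g\<close> and near (1 - 1/r) p n in \<open>h\<close>, so near p n / r in
  \<open>co h\<close>.\<close>

lemma near_extremal:
  assumes r: "r \<ge> 2" and del: "\<delta> \<le> \<theta> ^ (2 ^ (r + 1) * (j + 3))"
    and h: "sub h" and free: "kfree (Suc r) h"
    and big: "(1 - 1 / real r) * p * n ^ 2 - \<theta> ^ (2 * j + 3) * n ^ 2 \<le> (\<Sum>x\<in>V. deg h x)"
  shows "viol h \<le> \<theta> ^ j * n ^ 3" "(\<Sum>x\<in>V. \<bar>deg (co h) x - p * n / real r\<bar>) \<le> 2 * \<theta> ^ j * n ^ 2"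
proof -
  obtain r' where r': "r = Suc r'" "r' \<ge> 1" using r by (cases r) auto
  define m where "m = 2 * j + 3"
  define c D where "c = (\<Sum>x\<in>V. deg h x)" and "D = (\<Sum>x\<in>V. deg h x ^ 2)"
  define q where "q = 1 - 1 / real r"
  define W where "W = (\<Sum>x\<in>V. (deg h x - c / n) ^ 2)"
  have n0: "n > 0" using n_ge_1 by simp
  have q: "1 / 2 \<le> q" "q < 1" "1 / q = 1 + 1 / real r'" using r' by (auto simp: q_def field_simps)
  have exp: "2 ^ (r + 1) * (j + 3) = 2 ^ r * (m + 3)" by (simp add: m_def)
  have "2 ^ r' * (m + 3) \<le> 2 ^ r * (m + 3)" using r' by simp
  then have del': "\<delta> \<le> \<theta> ^ (2 ^ r' * (m + 3))" using del theta_mono unfolding exp by (meson order_trans)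
  have "1 * m \<le> 2 ^ r' * (m + 3)" by (intro mult_mono) auto
  then have del_m: "\<delta> \<le> \<theta> ^ m" using del' theta_mono by (metis mult_1 order_trans)
  have tri: "(\<Sum>x\<in>V. \<Sum>y\<in>V. \<Sum>z\<in>V. h x y * h x z * h y z) \<le> (1 - 1 / real r') * p * D + \<theta> ^ m * n ^ 3"
    unfolding D_def using free r'
    by (intro triangle_count[OF turan_relative[OF r'(2) del'] h]) auto
  have "2 * p * D + viol h \<le> p ^ 2 * n * c +
      (\<Sum>x\<in>V. \<Sum>y\<in>V. \<Sum>z\<in>V. h x y * h x z * h y z) + 4 * \<delta> * n ^ 3"
    using moon_moser[OF h subset_refl subD(9)[OF h]] unfolding c_def D_def by simp
  then have "2 * p * D + viol h \<le> p ^ 2 * n * c + (1 - 1 / real r') * p * D + \<theta> ^ m * n ^ 3 + 4 * \<delta> * n ^ 3"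
    using tri by linarith
  moreover have "4 * \<delta> * n ^ 3 \<le> 4 * \<theta> ^ m * n ^ 3" using del_m by (intro mult_right_mono) auto
  ultimately have "(1 + 1 / real r') * p * D + viol h \<le> p ^ 2 * n * c + 5 * \<theta> ^ m * n ^ 3"
    by (simp add: algebra_simps)
  then have main: "p * D / q + viol h \<le> p ^ 2 * n * c + 5 * \<theta> ^ m * n ^ 3"
    unfolding q(3)[symmetric] by simp
  have c0: "0 \<le> c" unfolding c_def by (intro sum_nonneg deg_bounds h)
  have "c \<le> (\<Sum>x\<in>V. n)" unfolding c_def by (intro sum_mono deg_bounds h)
  then have c_le: "c \<le> n ^ 2" by (simp add: power2_eq_square)
  have "W = (\<Sum>x\<in>V. deg h x ^ 2 - 2 * (c / n) * deg h x + (c / n) ^ 2)"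
    unfolding W_def by (intro sum.cong refl) (simp add: power2_diff)
  also have "\<dots> = D - 2 * (c / n) * c + n * (c / n) ^ 2"
  proof -
    have "(\<Sum>x\<in>V. 2 * (c / n) * deg h x) = 2 * (c / n) * c"
      unfolding c_def by (rule sum_distrib_left[symmetric])
    then show ?thesis unfolding sum.distrib sum_subtractf by (simp add: D_def)
  qed
  also have "\<dots> = D - c ^ 2 / n" using n0 by (simp add: field_simps power2_eq_square)
  finally have D: "D = W + c ^ 2 / n" by simp
  have W0: "0 \<le> W" unfolding W_def by (intro sum_nonneg) simp
  \<comment> \<open>The shortfall q p n^2 - c is at most \<theta>^m n^2 by \<open>big\<close>, and
    the factor in front of it is at most 2 n.\<close>
  have "p ^ 2 * n * c - p * (c ^ 2 / n) / q = (p * c / (n * q)) * (q * p * n ^ 2 - c)"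
    using q n0 by (simp add: field_simps power2_eq_square)
  also have "\<dots> \<le> (p * c / (n * q)) * (\<theta> ^ m * n ^ 2)"
    using big p_pos c0 q n0 by (intro mult_left_mono) (auto simp: c_def q_def m_def)
  also have "\<dots> \<le> (2 * n) * (\<theta> ^ m * n ^ 2)"
  proof (rule mult_right_mono)
    have "p * c \<le> 1 * n ^ 2" using p_pos p_le c0 c_le by (intro mult_mono) auto
    also have "\<dots> \<le> (2 * q) * n ^ 2" using q by (intro mult_right_mono) auto
    finally show "p * c / (n * q) \<le> 2 * n" using q n0 by (simp add: field_simps power2_eq_square)
  qed (use theta_pos in simp)
  finally have "p ^ 2 * n * c - p * (c ^ 2 / n) / q \<le> 2 * \<theta> ^ m * n ^ 3"
    by (simp add: power2_eq_square power3_eq_cube mult_ac)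
  with main D have sum: "p * W / q + viol h \<le> 7 * \<theta> ^ m * n ^ 3"
    by (simp add: algebra_simps add_divide_distrib)
  have "0 \<le> p * W / q" using W0 p_pos q by simp
  with sum have "viol h \<le> 7 * \<theta> ^ m * n ^ 3" by linarith
  also have "\<dots> \<le> \<theta> ^ j * n ^ 3"
  proof (rule mult_right_mono)
    have "7 * \<theta> ^ m \<le> 7 * \<theta> ^ (j + 1)" using theta_mono[of "j + 1" m] by (simp add: m_def)
    also have "\<dots> = (7 * \<theta>) * \<theta> ^ j" by simp
    also have "\<dots> \<le> 1 * \<theta> ^ j" using theta_le theta_pos by (intro mult_right_mono) auto
    finally show "7 * \<theta> ^ m \<le> \<theta> ^ j" by simp
  qed simp
  finally show "viol h \<le> \<theta> ^ j * n ^ 3" .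
  have "\<theta> * W \<le> p * W" using theta_le_p W0 by (rule mult_right_mono)
  also have "\<dots> \<le> p * W / q"
  proof -
    have "p * W * q \<le> p * W * 1" using q(2) W0 p_pos by (intro mult_left_mono) auto
    moreover have "0 < q" using q(1) by linarith
    ultimately show ?thesis by (simp only: pos_le_divide_eq mult_1_right)
  qed
  also have "\<dots> \<le> 7 * \<theta> ^ m * n ^ 3" using sum viol_nonneg[OF h] by linarith
  finally have "\<theta> * W \<le> 7 * \<theta> ^ m * n ^ 3" .
  moreover have "m = Suc (2 * j + 2)" by (simp add: m_def)
  ultimately have "\<theta> * W \<le> \<theta> * (7 * \<theta> ^ (2 * j + 2) * n ^ 3)" by (simp only: power_Suc mult_ac)
  then have W: "W \<le> 7 * \<theta> ^ (2 * j + 2) * n ^ 3" using theta_pos by (simp only: mult_le_cancel_left_pos)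
  have "(\<Sum>x\<in>V. \<bar>deg h x - c / n\<bar>) ^ 2 \<le> n * W"
    using square_of_sum_le[of V "\<lambda>x. \<bar>deg h x - c / n\<bar>"] by (simp add: W_def)
  also have "\<dots> \<le> n * (7 * \<theta> ^ (2 * j + 2) * n ^ 3)" using W by (intro mult_left_mono) auto
  also have "\<dots> = (7 * \<theta> ^ 2) * (\<theta> ^ j * n ^ 2) ^ 2"
  proof -
    have "\<theta> ^ (2 * j + 2) = (\<theta> ^ j) ^ 2 * \<theta> ^ 2" by (simp only: power_add power_even_eq)
    moreover have "n * (7 * (t * s) * n ^ 3) = (7 * s) * (t * (n ^ 2) ^ 2)" for t s
      by (simp add: power2_eq_square power3_eq_cube)
    ultimately show ?thesis by (simp only: power_mult_distrib)
  qed
  also have "\<dots> \<le> (1 / 2) ^ 2 * (\<theta> ^ j * n ^ 2) ^ 2"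
  proof (rule mult_right_mono)
    have "\<theta> * \<theta> \<le> 1 / 10 * (1 / 10)" using theta_pos theta_le by (intro mult_mono) auto
    then show "7 * \<theta> ^ 2 \<le> (1 / 2) ^ 2" by (simp add: power2_eq_square)
  qed simp
  also have "\<dots> = ((1 / 2) * (\<theta> ^ j * n ^ 2)) ^ 2" by (simp only: power_mult_distrib)
  finally have L1: "(\<Sum>x\<in>V. \<bar>deg h x - c / n\<bar>) \<le> (1 / 2) * (\<theta> ^ j * n ^ 2)"
    by (rule power2_le_imp_le) (use theta_pos in simp)
  have "c \<le> q * p * n ^ 2 + \<theta> ^ m * n ^ 2"
    unfolding c_def q_def using turan_relative[OF _ del[unfolded exp] h subset_refl subD(9)[OF h] free] r
    by simp
  with big have "\<bar>c - q * p * n ^ 2\<bar> \<le> \<theta> ^ m * n ^ 2"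
    unfolding c_def q_def m_def by linarith
  moreover have "c / n - q * p * n = (c - q * p * n ^ 2) / n" using n0 by (simp add: diff_divide_distrib power2_eq_square)
  ultimately have "\<bar>c / n - q * p * n\<bar> \<le> \<theta> ^ m * n ^ 2 / n"
    using n0 by (simp add: abs_divide divide_right_mono)
  then have cn: "\<bar>c / n - q * p * n\<bar> \<le> \<theta> ^ m * n" using n0 by (simp add: power2_eq_square)
  have qr: "q * p * n = p * n - p * n / real r" unfolding q_def by (simp add: algebra_simps)
  have "(\<Sum>x\<in>V. \<bar>deg (co h) x - p * n / real r\<bar>) \<le>
     (\<Sum>x\<in>V. \<bar>deg g x - p * n\<bar> + \<bar>deg h x - c / n\<bar> + \<theta> ^ m * n)"
  proof (rule sum_mono)
    fix x
    have "deg (co h) x = deg g x - deg h x" by (simp add: deg_def co_def sum_subtractf)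
    then show "\<bar>deg (co h) x - p * n / real r\<bar> \<le> \<bar>deg g x - p * n\<bar> + \<bar>deg h x - c / n\<bar> + \<theta> ^ m * n"
      using cn qr by linarith
  qed
  also have "\<dots> = (\<Sum>x\<in>V. \<bar>deg g x - p * n\<bar>) + (\<Sum>x\<in>V. \<bar>deg h x - c / n\<bar>) + \<theta> ^ m * n ^ 2"
    by (simp add: sum.distrib power2_eq_square)
  also have "\<dots> \<le> 2 * \<theta> ^ m * n ^ 2 + (1 / 2) * (\<theta> ^ j * n ^ 2) + \<theta> ^ m * n ^ 2"
  proof -
    have "2 * \<delta> * n ^ 2 \<le> 2 * \<theta> ^ m * n ^ 2" using del_m by (intro mult_right_mono) auto
    then show ?thesis using degree_deviation L1 by linarith
  qed
  also have "\<dots> \<le> 2 * \<theta> ^ j * n ^ 2"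
  proof -
    have "\<theta> ^ m \<le> \<theta> ^ (j + 1)" using theta_mono[of "j + 1" m] by (simp add: m_def)
    also have "\<dots> = \<theta> * \<theta> ^ j" by simp
    also have "\<dots> \<le> 1 / 10 * \<theta> ^ j" using theta_le theta_pos by (intro mult_right_mono) auto
    finally have "\<theta> ^ m * n ^ 2 \<le> 1 / 10 * \<theta> ^ j * n ^ 2" by (intro mult_right_mono) auto
    moreover have "0 \<le> \<theta> ^ j * n ^ 2" using theta_pos by simp
    ultimately show ?thesis by linarith
  qed
  finally show "(\<Sum>x\<in>V. \<bar>deg (co h) x - p * n / real r\<bar>) \<le> 2 * \<theta> ^ j * n ^ 2" .
qed

text \<open>If \<open>h\<close> consists of all edges of \<open>g\<close> between the parts of a
  partition, then each vertex v meets the \<open>co h\<close>-neighbourhood of x only through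
  \<open>co h\<close> or only through \<open>h\<close>, and every product vanishes. The sum measures
  how badly x serves as the centre of a part.\<close>

definition pivot_defect :: "('a \<Rightarrow> 'a \<Rightarrow> real) \<Rightarrow> 'a \<Rightarrow> real" where
  "pivot_defect h x = (\<Sum>v\<in>V. (\<Sum>a\<in>V. co h x a * co h v a) * (\<Sum>b\<in>V. co h x b * h v b))"

text \<open>If \<open>xv\<close> is an edge of \<^term>\<open>g\<close>, then \<open>(v, b, x)\<close> or \<open>(x, v, a)\<close> is counted by \<^const>\<open>viol\<close>; the
  discrepancy condition removes the assumption that \<open>xv\<close> is an edge.\<close>

lemma sum_pivot_defect:
  assumes h: "sub h"
  shows "p * (\<Sum>x\<in>V. pivot_defect h x) \<le> 2 * n * viol h + \<delta> * n ^ 4"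
proof -
  let ?k = "co h"
  let ?F = "\<lambda>a b x v. (?k x a * ?k x b) * (?k v a * h v b)"
  have "p * (\<Sum>x\<in>V. pivot_defect h x) = p * (\<Sum>x\<in>V. \<Sum>v\<in>V. \<Sum>a\<in>V. \<Sum>b\<in>V. ?F a b x v)"
    unfolding pivot_defect_def sum_product by (simp add: mult_ac)
  also have "(\<Sum>x\<in>V. \<Sum>v\<in>V. \<Sum>a\<in>V. \<Sum>b\<in>V. ?F a b x v) = (\<Sum>x\<in>V. \<Sum>a\<in>V. \<Sum>v\<in>V. \<Sum>b\<in>V. ?F a b x v)"
    by (intro sum.cong refl sum.swap)
  also have "\<dots> = (\<Sum>a\<in>V. \<Sum>x\<in>V. \<Sum>v\<in>V. \<Sum>b\<in>V. ?F a b x v)" by (rule sum.swap)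
  also have "\<dots> = (\<Sum>a\<in>V. \<Sum>x\<in>V. \<Sum>b\<in>V. \<Sum>v\<in>V. ?F a b x v)" by (intro sum.cong refl sum.swap)
  also have "\<dots> = (\<Sum>a\<in>V. \<Sum>b\<in>V. \<Sum>x\<in>V. \<Sum>v\<in>V. ?F a b x v)" by (intro sum.cong refl sum.swap)
  also have "p * \<dots> = (\<Sum>a\<in>V. \<Sum>b\<in>V. p * (\<Sum>x\<in>V. ?k x a * ?k x b) * (\<Sum>v\<in>V. ?k v a * h v b))"
    by (simp only: mult.assoc sum_product) (simp add: sum_distrib_left)
  also have "\<dots> \<le> (\<Sum>a\<in>V. \<Sum>b\<in>V. (\<Sum>x\<in>V. \<Sum>v\<in>V. ?F a b x v * g x v) + \<delta> * n ^ 2)"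
  proof (intro sum_mono)
    fix a b
    show "p * (\<Sum>x\<in>V. ?k x a * ?k x b) * (\<Sum>v\<in>V. ?k v a * h v b) \<le> (\<Sum>x\<in>V. \<Sum>v\<in>V. ?F a b x v * g x v) + \<delta> * n ^ 2"
      using edge_count(2)[of "\<lambda>x. ?k x a * ?k x b" "\<lambda>v. ?k v a * h v b"]
        mult01[OF coD(1)[OF h] coD(1)[OF h]] mult01[OF coD(1)[OF h] subD(1)[OF h]] by simp
  qed
  also have "\<dots> = (\<Sum>a\<in>V. \<Sum>b\<in>V. \<Sum>x\<in>V. \<Sum>v\<in>V. ?F a b x v * g x v) + \<delta> * n ^ 4"
    by (simp add: sum.distrib eval_nat_numeral)
  also have "(\<Sum>a\<in>V. \<Sum>b\<in>V. \<Sum>x\<in>V. \<Sum>v\<in>V. ?F a b x v * g x v) \<le>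
     (\<Sum>a\<in>V. \<Sum>b\<in>V. \<Sum>x\<in>V. \<Sum>v\<in>V. h v b * ?k v x * ?k b x + h x v * ?k x a * ?k v a)"
  proof (intro sum_mono)
    fix a b x v
    have "?F a b x v * g x v \<in> {0, 1}"
      using coD(1)[OF h] subD(1)[OF h] g01 by (intro mult01)
    moreover have "0 \<le> h v b * ?k v x * ?k b x" "0 \<le> h x v * ?k x a * ?k v a"
      using coD(3)[OF h] subD(6)[OF h] by (intro mult_nonneg_nonneg; simp)+
    moreover have "1 \<le> h v b * ?k v x * ?k b x + h x v * ?k x a * ?k v a" if "?F a b x v * g x v = 1"
    proof -
      have 1: "?k x a = 1" "?k x b = 1" "?k v a = 1" "h v b = 1" "g x v = 1"
        using that coD(1)[OF h, of x a] coD(1)[OF h, of x b] coD(1)[OF h, of v a] subD(1)[OF h, of v b] g01[of x v] by auto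
      then show ?thesis using coD(5)[OF h, of x v] coD(2)[OF h, of v x] coD(2)[OF h, of b x] by simp
    qed
    ultimately show "?F a b x v * g x v \<le> h v b * ?k v x * ?k b x + h x v * ?k x a * ?k v a" by auto
  qed
  also have "\<dots> = 2 * n * viol h"
  proof -
    have "(\<Sum>b\<in>V. \<Sum>x\<in>V. \<Sum>v\<in>V. h v b * ?k v x * ?k b x) = viol h"
    proof -
      have "(\<Sum>b\<in>V. \<Sum>x\<in>V. \<Sum>v\<in>V. h v b * ?k v x * ?k b x) = (\<Sum>b\<in>V. \<Sum>v\<in>V. \<Sum>x\<in>V. h v b * ?k v x * ?k b x)"
        by (intro sum.cong refl sum.swap)
      then show ?thesis unfolding viol_co by (subst sum.swap)
    qed
    moreover have "(\<Sum>a\<in>V. \<Sum>x\<in>V. \<Sum>v\<in>V. h x v * ?k x a * ?k v a) = viol h"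
    proof -
      have "(\<Sum>a\<in>V. \<Sum>x\<in>V. \<Sum>v\<in>V. h x v * ?k x a * ?k v a) = (\<Sum>x\<in>V. \<Sum>a\<in>V. \<Sum>v\<in>V. h x v * ?k x a * ?k v a)"
        by (rule sum.swap)
      also have "\<dots> = viol h" unfolding viol_co by (intro sum.cong refl sum.swap)
      finally show ?thesis .
    qed
    ultimately show ?thesis by (simp add: sum.distrib flip: sum_distrib_left)
  qed
  finally show ?thesis by simp
qed

lemma cauchy_schwarz_bound:
  assumes "\<And>v. 0 \<le> f v" "\<And>v. v \<in> V \<Longrightarrow> f v ^ 2 \<le> F v" "(\<Sum>v\<in>V. F v) \<le> \<theta> ^ (2 * i) * n ^ 3"
  shows "(\<Sum>v\<in>V. f v) \<le> \<theta> ^ i * n ^ 2"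
proof (rule power2_le_imp_le)
  have "(\<Sum>v\<in>V. f v) ^ 2 \<le> n * (\<Sum>v\<in>V. f v ^ 2)" by (rule square_of_sum_le) auto
  also have "\<dots> \<le> n * (\<Sum>v\<in>V. F v)" using assms by (intro mult_left_mono sum_mono) auto
  also have "\<dots> \<le> n * (\<theta> ^ (2 * i) * n ^ 3)" using assms by (intro mult_left_mono) auto
  also have "\<dots> = (\<theta> ^ i * n ^ 2) ^ 2"
    by (simp add: power_mult_distrib power_mult power2_eq_square power3_eq_cube power4_eq_xxxx mult_ac)
  finally show "(\<Sum>v\<in>V. f v) ^ 2 \<le> (\<theta> ^ i * n ^ 2) ^ 2" .
qed (use theta_pos in simp)

text \<open>A sparsity test for \<open>R\<close>. On average a pair in \<open>R\<close> has about
  p^2 * sum \<open>al\<close> common \<open>g\<close>-neighbours in \<open>al\<close>, and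
  \<open>sup\<close> sorts the resulting cherries into three exceptional kinds, of which there are
  few. As p \<ge> \<theta> and \<open>al\<close> has at least 2 \<theta>^2 n elements, the division
  costs four powers of \<theta>; the fifth in i = j + 5 absorbs the constants.\<close>

lemma sparse_relation:
  assumes R: "\<And>v w. R v w \<in> {0, 1 :: real}" and al: "\<And>a. al a \<in> {0, 1 :: real}"
    and sup: "\<And>v w a. R v w * al a * g a v * g a w \<le> X v w a + al a * Y1 v a * y1 v + al a * Y2 w a * y2 w"
    and X: "(\<Sum>v\<in>V. \<Sum>w\<in>V. \<Sum>a\<in>V. X v w a) \<le> \<theta> ^ i * n ^ 3"
    and Y1: "(\<Sum>v\<in>V. y1 v * (\<Sum>a\<in>V. al a * Y1 v a)) \<le> \<theta> ^ i * n ^ 2"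
    and Y2: "(\<Sum>v\<in>V. y2 v * (\<Sum>a\<in>V. al a * Y2 v a)) \<le> \<theta> ^ i * n ^ 2"
    and A: "2 * \<theta> ^ 2 * n \<le> (\<Sum>a\<in>V. al a)" and del: "\<delta> \<le> \<theta> ^ i" and i: "i = j + 5"
  shows "(\<Sum>v\<in>V. \<Sum>w\<in>V. R v w) \<le> \<theta> ^ j * n ^ 2"
proof -
  let ?E = "\<Sum>v\<in>V. \<Sum>w\<in>V. R v w"
  have E0: "0 \<le> ?E" using R by (intro sum_nonneg) (metis R empty_iff insert_iff order_refl zero_le_one)
  have "p ^ 2 * (\<Sum>a\<in>V. al a) * ?E - 2 * \<delta> * n ^ 3 \<le> (\<Sum>v\<in>V. \<Sum>w\<in>V. \<Sum>a\<in>V. R v w * al a * g a v * g a w)"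
    by (rule cherry_count_bounds(2)) (use R al in auto)
  also have "\<dots> \<le> (\<Sum>v\<in>V. \<Sum>w\<in>V. \<Sum>a\<in>V. X v w a + al a * Y1 v a * y1 v + al a * Y2 w a * y2 w)"
    by (intro sum_mono sup)
  also have "\<dots> = (\<Sum>v\<in>V. \<Sum>w\<in>V. \<Sum>a\<in>V. X v w a) + (\<Sum>v\<in>V. \<Sum>w\<in>V. \<Sum>a\<in>V. al a * Y1 v a * y1 v)
      + (\<Sum>v\<in>V. \<Sum>w\<in>V. \<Sum>a\<in>V. al a * Y2 w a * y2 w)"
    by (simp only: sum.distrib)
  also have "(\<Sum>v\<in>V. \<Sum>w\<in>V. \<Sum>a\<in>V. al a * Y1 v a * y1 v) = n * (\<Sum>v\<in>V. y1 v * (\<Sum>a\<in>V. al a * Y1 v a))"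
    by (simp add: sum_distrib_left mult_ac)
  also have "(\<Sum>v\<in>V. \<Sum>w\<in>V. \<Sum>a\<in>V. al a * Y2 w a * y2 w) = n * (\<Sum>v\<in>V. y2 v * (\<Sum>a\<in>V. al a * Y2 v a))"
    by (simp add: sum_distrib_left mult_ac)
  finally have "p ^ 2 * (\<Sum>a\<in>V. al a) * ?E - 2 * \<delta> * n ^ 3 \<le> \<theta> ^ i * n ^ 3 + n * (\<theta> ^ i * n ^ 2) + n * (\<theta> ^ i * n ^ 2)"
    using X Y1 Y2 mult_left_mono[OF Y1, of n] mult_left_mono[OF Y2, of n] by linarith
  moreover have "2 * \<delta> * n ^ 3 \<le> 2 * \<theta> ^ i * n ^ 3" using del by (intro mult_right_mono) auto
  ultimately have "p ^ 2 * (\<Sum>a\<in>V. al a) * ?E \<le> 5 * \<theta> ^ i * n ^ 3"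
    by (simp add: power2_eq_square power3_eq_cube mult_ac)
  moreover have "\<theta> ^ 2 * (2 * \<theta> ^ 2 * n) * ?E \<le> p ^ 2 * (\<Sum>a\<in>V. al a) * ?E"
    using theta_le_p theta_pos A E0 by (intro mult_right_mono mult_mono power_mono) auto
  ultimately have "\<theta> ^ 4 * n * (2 * ?E) \<le> \<theta> ^ 4 * n * (5 * \<theta> * \<theta> ^ j * n ^ 2)"
    by (simp add: i power_add eval_nat_numeral mult_ac)
  then have "2 * ?E \<le> 5 * \<theta> * \<theta> ^ j * n ^ 2"
    using theta_pos n_ge_1 by (simp only: mult_le_cancel_left_pos zero_less_power mult_pos_pos)
  also have "\<dots> \<le> 1 * \<theta> ^ j * n ^ 2"
    using theta_le theta_pos by (intro mult_right_mono) auto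
  finally show ?thesis using E0 by simp
qed

text \<open>Extracts one part from the set \<open>w\<close>, which almost no edge of
  \<open>co h\<close> leaves. By averaging, some pivot x in \<open>w\<close> has small pivot defect,
  small degree deviation and few \<open>co h\<close>-edges leaving \<open>w\<close>. Its
  \<open>co h\<close>-neighbourhood in \<open>w\<close> is \<open>al\<close>, and the part consists
  of the vertices of \<open>w\<close> joined to \<open>al\<close> by \<open>co h\<close> at least as
  often as by \<open>h\<close>. The exponent 3 j + 20 pays for averaging over a set of only
  \<theta>^j n vertices, for a square root and for \<open>sparse_relation\<close>.\<close>

lemma cluster:
  assumes h: "sub h" and w01: "\<And>v. w v \<in> {0, 1}" and r: "r \<ge> 1" "4 * real r * \<theta> \<le> 1"
    and viol: "viol h \<le> \<theta> ^ (3 * j + 20) * n ^ 3"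
    and dev: "(\<Sum>x\<in>V. \<bar>deg (co h) x - p * n / real r\<bar>) \<le> \<theta> ^ (3 * j + 20) * n ^ 2"
    and del: "\<delta> \<le> \<theta> ^ (3 * j + 20)"
    and closed: "(\<Sum>u\<in>V. \<Sum>v\<in>V. w u * (1 - w v) * co h u v) \<le> \<theta> ^ (3 * j + 20) * n ^ 2"
    and large: "\<theta> ^ j * n \<le> (\<Sum>v\<in>V. w v)"
  shows "\<exists>c. (\<forall>v. c v \<in> {0, 1 :: real} \<and> c v \<le> w v) \<and>
    (\<Sum>u\<in>V. \<Sum>v\<in>V. c u * c v * h u v) \<le> \<theta> ^ j * n ^ 2 \<and>
    (\<Sum>u\<in>V. \<Sum>v\<in>V. c u * (1 - c v) * co h u v) \<le> \<theta> ^ j * n ^ 2 \<and>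
    n / real r - \<theta> ^ j * n \<le> (\<Sum>v\<in>V. c v)"
proof -
  let ?k = "co h"
  define e where "e = \<theta> ^ (3 * j + 20)"
  define i where "i = j + 8"
  have n0: "n > 0" using n_ge_1 by simp
  have e0: "e > 0" using theta_pos by (simp add: e_def)
  note h01 = subD(1)[OF h] and k01 = coD(1)[OF h]
  have w0: "0 \<le> w v" "w v \<le> 1" for v using w01[of v] by auto
  define out where "out x = (\<Sum>v\<in>V. (1 - w v) * ?k x v)" for x
  have out0: "0 \<le> out x" for x unfolding out_def using w0 coD(3)[OF h] by (intro sum_nonneg) auto
  have pd0: "0 \<le> pivot_defect h x" for x
    unfolding pivot_defect_def using coD(3)[OF h] subD(6)[OF h] by (intro sum_nonneg mult_nonneg_nonneg) auto
  \<comment> \<open>One average has to serve three quantities; the factors n^2 bring all of them to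
    the scale n^3.\<close>
  define B where "B x = pivot_defect h x + n ^ 2 * \<bar>deg ?k x - p * n / real r\<bar> + n ^ 2 * out x" for x
  have B0: "0 \<le> B x" for x unfolding B_def using pd0 out0 by simp
  have total: "\<theta> * (\<Sum>x\<in>V. w x * B x) \<le> 5 * e * n ^ 4"
  proof -
    have "(\<Sum>x\<in>V. w x * B x) = (\<Sum>x\<in>V. w x * pivot_defect h x) +
        n ^ 2 * (\<Sum>x\<in>V. w x * \<bar>deg ?k x - p * n / real r\<bar>) + n ^ 2 * (\<Sum>x\<in>V. w x * out x)"
    proof -
      have "w x * B x = w x * pivot_defect h x + n ^ 2 * (w x * \<bar>deg ?k x - p * n / real r\<bar>) + n ^ 2 * (w x * out x)" for x
        by (simp add: B_def algebra_simps)
      then show ?thesis by (simp only: sum.distrib sum_distrib_left)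
    qed
    moreover have "(\<Sum>x\<in>V. w x * pivot_defect h x) \<le> (\<Sum>x\<in>V. pivot_defect h x)"
      using w0 pd0 by (intro sum_mono mult_left_le_one_le) auto
    moreover have "(\<Sum>x\<in>V. w x * \<bar>deg ?k x - p * n / real r\<bar>) \<le> e * n ^ 2"
    proof -
      have "(\<Sum>x\<in>V. w x * \<bar>deg ?k x - p * n / real r\<bar>) \<le> (\<Sum>x\<in>V. \<bar>deg ?k x - p * n / real r\<bar>)"
        using w0 by (intro sum_mono mult_left_le_one_le) auto
      then show ?thesis using dev unfolding e_def by linarith
    qed
    moreover have "(\<Sum>x\<in>V. w x * out x) \<le> e * n ^ 2"
      using closed unfolding e_def out_def sum_distrib_left by (simp add: mult.assoc)
    moreover have "\<theta> * (\<Sum>x\<in>V. pivot_defect h x) \<le> 3 * e * n ^ 4"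
    proof -
      have "\<theta> * (\<Sum>x\<in>V. pivot_defect h x) \<le> p * (\<Sum>x\<in>V. pivot_defect h x)"
        using theta_le_p pd0 by (intro mult_right_mono sum_nonneg) auto
      also have "\<dots> \<le> 2 * n * viol h + \<delta> * n ^ 4" by (rule sum_pivot_defect[OF h])
      also have "\<dots> \<le> 2 * n * (e * n ^ 3) + e * n ^ 4"
        using viol del unfolding e_def by (intro add_mono mult_left_mono mult_right_mono) auto
      finally show ?thesis by (simp add: eval_nat_numeral)
    qed
    ultimately have s: "(\<Sum>x\<in>V. w x * B x) \<le> (\<Sum>x\<in>V. pivot_defect h x) + n ^ 2 * (e * n ^ 2) + n ^ 2 * (e * n ^ 2)"
      "\<theta> * (\<Sum>x\<in>V. pivot_defect h x) \<le> 3 * e * n ^ 4"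
      by (smt (verit) mult_left_mono zero_le_power2)+
    have "\<theta> * (\<Sum>x\<in>V. w x * B x) \<le> \<theta> * ((\<Sum>x\<in>V. pivot_defect h x) + 2 * (e * n ^ 4))"
      using s(1) theta_pos by (intro mult_left_mono) (auto simp: eval_nat_numeral)
    also have "\<dots> = \<theta> * (\<Sum>x\<in>V. pivot_defect h x) + \<theta> * (2 * (e * n ^ 4))" by (simp add: distrib_left)
    also have "\<dots> \<le> 3 * e * n ^ 4 + 1 * (2 * (e * n ^ 4))"
      using s(2) theta_le_1 e0 by (intro add_mono mult_right_mono) auto
    finally show ?thesis by simp
  qed
  have "\<exists>x\<in>V. w x = 1 \<and> \<theta> ^ (j + 1) * B x \<le> 5 * e * n ^ 3"
  proof (rule ccontr)
    assume neg: "\<not> ?thesis"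
    have le: "w x * (5 * e * n ^ 3) \<le> w x * (\<theta> ^ (j + 1) * B x)" if "x \<in> V" for x
      using neg that w01[of x] by fastforce
    have "\<exists>x\<in>V. w x \<noteq> 0"
    proof (rule ccontr)
      assume "\<not> ?thesis"
      then have "(\<Sum>v\<in>V. w v) = 0" by simp
      moreover have "0 < \<theta> ^ j * n" using theta_pos n0 by simp
      ultimately show False using large by simp
    qed
    then obtain x0 where x0: "x0 \<in> V" "w x0 = 1" using w01 by blast
    have "(\<Sum>x\<in>V. w x * (5 * e * n ^ 3)) < (\<Sum>x\<in>V. w x * (\<theta> ^ (j + 1) * B x))"
    proof (rule sum_strict_mono_ex1[OF finite_V])
      show "\<forall>x\<in>V. w x * (5 * e * n ^ 3) \<le> w x * (\<theta> ^ (j + 1) * B x)" using le by blast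
      have "5 * e * n ^ 3 < \<theta> ^ (j + 1) * B x0" using neg x0 by force
      then show "\<exists>x\<in>V. w x * (5 * e * n ^ 3) < w x * (\<theta> ^ (j + 1) * B x)" using x0 by (intro bexI[of _ x0]) auto
    qed
    then have "(\<Sum>x\<in>V. w x) * (5 * e * n ^ 3) < \<theta> ^ j * (\<theta> * (\<Sum>x\<in>V. w x * B x))"
      by (simp add: sum_distrib_left sum_distrib_right mult_ac)
    also have "\<dots> \<le> \<theta> ^ j * (5 * e * n ^ 4)" using total theta_pos by (intro mult_left_mono) auto
    also have "\<dots> = (\<theta> ^ j * n) * (5 * e * n ^ 3)" by (simp add: eval_nat_numeral)
    also have "\<dots> \<le> (\<Sum>x\<in>V. w x) * (5 * e * n ^ 3)" using large e0 by (intro mult_right_mono) auto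
    finally show False by simp
  qed
  then obtain x where x: "x \<in> V" "w x = 1" "\<theta> ^ (j + 1) * B x \<le> 5 * e * n ^ 3" by blast
  \<comment> \<open>Dividing e = \<theta>^(3 j + 20) by \<theta>^(j + 1) leaves \<theta>^(2 j + 19)
    = \<theta> * e1; the spare \<theta> absorbs the factor 5.\<close>
  define e1 where "e1 = \<theta> ^ (2 * i + 2)"
  have e1: "0 < e1" using theta_pos by (simp add: e1_def)
  have "\<theta> ^ (j + 1) * B x \<le> \<theta> ^ (j + 1) * (5 * \<theta> * e1 * n ^ 3)"
    using x(3) by (simp add: e_def e1_def i_def eval_nat_numeral power_add mult_ac power_mult)
  then have "B x \<le> 5 * \<theta> * e1 * n ^ 3" using theta_pos by (simp only: mult_le_cancel_left_pos zero_less_power)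
  also have "\<dots> \<le> 1 * e1 * n ^ 3" using theta_le theta_pos e1 by (intro mult_right_mono) auto
  finally have Bx: "B x \<le> e1 * n ^ 3" by simp
  have e1_le: "e1 \<le> \<theta> ^ (2 * i)" "e1 \<le> \<theta> ^ 2" "e1 \<le> \<theta> ^ i" unfolding e1_def by (intro theta_mono; simp)+
  have nn: "n ^ 3 = n ^ 2 * n" by (simp add: eval_nat_numeral)
  have pd: "pivot_defect h x \<le> e1 * n ^ 3" using Bx out0[of x] unfolding B_def by (smt (verit) zero_le_power2 mult_nonneg_nonneg)
  have "n ^ 2 * \<bar>deg ?k x - p * n / real r\<bar> \<le> n ^ 2 * (e1 * n)" "n ^ 2 * out x \<le> n ^ 2 * (e1 * n)"
    using Bx out0[of x] pd0[of x] zero_le_power2[of n] unfolding B_def nn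
    by (smt (verit) mult_nonneg_nonneg mult.assoc mult.commute)+
  then have devx: "\<bar>deg ?k x - p * n / real r\<bar> \<le> e1 * n" and outx: "out x \<le> e1 * n"
    using n0 by (simp_all only: mult_le_cancel_left_pos zero_less_power)
  define al where "al a = w a * ?k x a" for a
  have al01: "al a \<in> {0, 1}" for a unfolding al_def by (intro mult01 w01 k01)
  have al0: "0 \<le> al a" "al a \<le> 1" for a using al01[of a] by auto
  define kA hA where "kA v = (\<Sum>a\<in>V. al a * ?k v a)" and "hA v = (\<Sum>a\<in>V. al a * h v a)" for v
  \<comment> \<open>The smaller of the two counts is at most their geometric mean, and the sum of
    the products kA v * hA v is bounded by the pivot defect of x. So \<open>hC\<close> and
    \<open>kW\<close> follow by Cauchy--Schwarz.\<close>
  define c where "c v = (if hA v \<le> kA v then w v else 0)" for v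
  have c01: "c v \<in> {0, 1}" "w v - c v \<in> {0, 1}" for v using w01[of v] by (auto simp: c_def)
  have c0: "0 \<le> c v" "c v \<le> w v" "c v \<le> 1" "w v - c v \<le> 1" for v using w01[of v] by (auto simp: c_def)
  have kA0: "0 \<le> kA v" "0 \<le> hA v" for v
    unfolding kA_def hA_def using al0 coD(3)[OF h] subD(6)[OF h] by (intro sum_nonneg mult_nonneg_nonneg; simp)+
  have thr: "\<theta> ^ 2 \<le> \<theta> / (4 * real r)"
    using r theta_pos by (simp add: field_simps power2_eq_square)
  have sz: "p * n / real r - 2 * e1 * n \<le> (\<Sum>a\<in>V. al a)"
  proof -
    have "(\<Sum>a\<in>V. al a) = deg ?k x - out x"
      unfolding al_def deg_def out_def sum_subtractf[symmetric] by (simp add: algebra_simps)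
    then show ?thesis using devx outx by linarith
  qed
  have sz2: "2 * \<theta> ^ 2 * n \<le> (\<Sum>a\<in>V. al a)"
  proof -
    have "4 * \<theta> ^ 2 * n \<le> \<theta> * n / real r"
    proof -
      have "4 * \<theta> ^ 2 * n \<le> 4 * (\<theta> / (4 * real r)) * n" using thr by (intro mult_right_mono) auto
      then show ?thesis by simp
    qed
    also have "\<dots> \<le> p * n / real r" using theta_le_p by (intro divide_right_mono mult_right_mono) auto
    moreover have "2 * e1 * n \<le> 2 * \<theta> ^ 2 * n" using e1_le by (intro mult_right_mono) auto
    ultimately show ?thesis using sz by linarith
  qed
  have prod: "(\<Sum>v\<in>V. kA v * hA v) \<le> \<theta> ^ (2 * i) * n ^ 3"
  proof -
    have "(\<Sum>v\<in>V. kA v * hA v) \<le> pivot_defect h x"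
      unfolding pivot_defect_def
    proof (rule sum_mono)
      fix v
      have le: "al a \<le> ?k x a" for a
        unfolding al_def using w0 coD(3)[OF h] by (intro mult_left_le_one_le)
      have "kA v \<le> (\<Sum>a\<in>V. ?k x a * ?k v a)"
        unfolding kA_def using le coD(3)[OF h] by (intro sum_mono mult_right_mono)
      moreover have "hA v \<le> (\<Sum>a\<in>V. ?k x a * h v a)"
        unfolding hA_def using le subD(6)[OF h] by (intro sum_mono mult_right_mono)
      ultimately show "kA v * hA v \<le> (\<Sum>a\<in>V. ?k x a * ?k v a) * (\<Sum>a\<in>V. ?k x a * h v a)"
        using kA0[of v] by (intro mult_mono) auto
    qed
    also have "\<dots> \<le> e1 * n ^ 3" by (rule pd)
    also have "\<dots> \<le> \<theta> ^ (2 * i) * n ^ 3" using e1_le by (intro mult_right_mono) auto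
    finally show ?thesis .
  qed
  have hC: "(\<Sum>v\<in>V. c v * hA v) \<le> \<theta> ^ i * n ^ 2"
  proof (rule cauchy_schwarz_bound[OF _ _ prod])
    show "(c v * hA v) ^ 2 \<le> kA v * hA v" for v
    proof (cases "hA v \<le> kA v")
      case True
      then have "c v * hA v * (c v * hA v) \<le> (1 * kA v) * (1 * hA v)"
        using c0[of v] kA0[of v] by (intro mult_mono) auto
      then show ?thesis by (simp add: power2_eq_square)
    qed (use kA0 in \<open>simp add: c_def\<close>)
  qed (use c0 kA0 in auto)
  have kW: "(\<Sum>v\<in>V. (w v - c v) * kA v) \<le> \<theta> ^ i * n ^ 2"
  proof (rule cauchy_schwarz_bound[OF _ _ prod])
    show "((w v - c v) * kA v) ^ 2 \<le> kA v * hA v" for v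
    proof (cases "hA v \<le> kA v")
      case False
      then have "(w v - c v) * kA v * ((w v - c v) * kA v) \<le> (1 * kA v) * (1 * hA v)"
        using c0[of v] kA0[of v] by (intro mult_mono) auto
      then show ?thesis by (simp add: power2_eq_square)
    qed (use kA0 in \<open>simp add: c_def\<close>)
  qed (use c0 kA0 in auto)
  have del_i: "\<delta> \<le> \<theta> ^ i" using del theta_mono[of i "3 * j + 20"] by (simp add: i_def)
  have "3 * j + 20 = (2 * i + 2) + (j + 2)" by (simp add: i_def)
  then have "e = e1 * \<theta> ^ (j + 2)" by (simp only: e_def e1_def power_add)
  also have "\<dots> \<le> e1 * 1" using e1 theta_pos theta_le_1 by (intro mult_left_mono power_le_one) auto
  finally have e_le: "e \<le> \<theta> ^ i" using e1_le by linarith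
  have viol': "viol h \<le> \<theta> ^ i * n ^ 3"
    using viol e_le mult_right_mono[OF e_le, of "n ^ 3"] unfolding e_def by simp
  \<comment> \<open>Let u, v in \<open>c\<close> be joined by \<open>h\<close>, with a common
    \<open>g\<close>-neighbour a in \<open>al\<close>. Either both edges to a are in
    \<open>co h\<close>, and the triple is counted by \<open>viol\<close>, or u or v sends an edge
    of \<open>h\<close> to \<open>al\<close>, which is rare by \<open>hC\<close>.\<close>
  have E1: "(\<Sum>u\<in>V. \<Sum>v\<in>V. c u * c v * h u v) \<le> \<theta> ^ (j + 3) * n ^ 2"
  proof (rule sparse_relation[where al = al and ?Y1.0 = h and ?Y2.0 = h and ?y1.0 = c and ?y2.0 = c
        and X = "\<lambda>v w a. h v w * ?k v a * ?k w a" and i = i])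
    fix u v a
    have "c u * c v * h u v * al a * g a u * g a v \<in> {0, 1}"
      using c01 h01 al01 g01 by (intro mult01)
    moreover have "0 \<le> h u v * ?k u a * ?k v a" "0 \<le> al a * h u a * c u" "0 \<le> al a * h v a * c v"
      using subD(6)[OF h] coD(3)[OF h] c0 al0 by (intro mult_nonneg_nonneg; simp)+
    moreover have "1 \<le> h u v * ?k u a * ?k v a + al a * h u a * c u + al a * h v a * c v"
      if "c u * c v * h u v * al a * g a u * g a v = 1"
    proof -
      have "c u = 1" "c v = 1" "h u v = 1" "al a = 1" "g a u = 1" "g a v = 1"
        using that c01[of u] c01[of v] h01[of u v] al01[of a] g01[of a u] g01[of a v] by auto
      then show ?thesis
        using coD(5)[OF h, of a u] coD(5)[OF h, of a v] coD(2)[OF h, of a] subD(2)[OF h, of a]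
          h01[of a u] h01[of a v] k01[of a u] k01[of a v] by auto
    qed
    ultimately show "c u * c v * h u v * al a * g a u * g a v \<le>
       h u v * ?k u a * ?k v a + al a * h u a * c u + al a * h v a * c v" by auto
  next
    show "(\<Sum>v\<in>V. \<Sum>w\<in>V. \<Sum>a\<in>V. h v w * ?k v a * ?k w a) \<le> \<theta> ^ i * n ^ 3"
      using viol' by (simp add: viol_co)
    show "(\<Sum>v\<in>V. c v * (\<Sum>a\<in>V. al a * h v a)) \<le> \<theta> ^ i * n ^ 2"
      "(\<Sum>v\<in>V. c v * (\<Sum>a\<in>V. al a * h v a)) \<le> \<theta> ^ i * n ^ 2" using hC by (simp_all add: hA_def)
    show "c u * c v * h u v \<in> {0, 1}" for u v by (intro mult01 c01 h01)
  qed (use sz2 del_i al01 in \<open>auto simp: i_def\<close>)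
  \<comment> \<open>Let u in \<open>c\<close> and v in \<open>w\<close> outside \<open>c\<close> be
    joined by \<open>co h\<close>. If ua is in \<open>co h\<close> and va is in \<open>h\<close>,
    the triple is counted by \<open>viol\<close>; otherwise \<open>hC\<close> or \<open>kW\<close>
    applies.\<close>
  have E2: "(\<Sum>u\<in>V. \<Sum>v\<in>V. c u * (w v - c v) * ?k u v) \<le> \<theta> ^ (j + 3) * n ^ 2"
  proof (rule sparse_relation[where al = al and ?Y1.0 = h and ?Y2.0 = ?k and ?y1.0 = c and ?y2.0 = "\<lambda>v. w v - c v"
        and X = "\<lambda>v w a. h w a * ?k w v * ?k a v" and i = i])
    fix u v a
    have "c u * (w v - c v) * ?k u v * al a * g a u * g a v \<in> {0, 1}"
      using c01 k01 al01 g01 by (intro mult01)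
    moreover have "0 \<le> h v a * ?k v u * ?k a u" "0 \<le> al a * h u a * c u" "0 \<le> al a * ?k v a * (w v - c v)"
      using subD(6)[OF h] coD(3)[OF h] c0 al0 by (intro mult_nonneg_nonneg; simp)+
    moreover have "1 \<le> h v a * ?k v u * ?k a u + al a * h u a * c u + al a * ?k v a * (w v - c v)"
      if "c u * (w v - c v) * ?k u v * al a * g a u * g a v = 1"
    proof -
      have "c u \<noteq> 0" "w v - c v \<noteq> 0" "?k u v \<noteq> 0" "al a \<noteq> 0" "g a u \<noteq> 0" "g a v \<noteq> 0"
        using that by fastforce+
      then have "c u = 1" "w v - c v = 1" "?k u v = 1" "al a = 1" "g a u = 1" "g a v = 1"
        using c01(1)[of u] c01(2)[of v] k01[of u v] al01[of a] g01[of a u] g01[of a v] by blast+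
      moreover from this have "?k a u = 1 - h u a" "?k v a = 1 - h v a" "?k v u = 1"
        using coD(5)[OF h, of a u] coD(5)[OF h, of a v] coD(2)[OF h, of a v] coD(2)[OF h, of u v]
          subD(2)[OF h, of a u] subD(2)[OF h, of a v] by linarith+
      ultimately show ?thesis using h01[of u a] h01[of v a] by auto
    qed
    ultimately show "c u * (w v - c v) * ?k u v * al a * g a u * g a v \<le>
       h v a * ?k v u * ?k a u + al a * h u a * c u + al a * ?k v a * (w v - c v)" by auto
  next
    have "(\<Sum>v\<in>V. \<Sum>w\<in>V. \<Sum>a\<in>V. h w a * ?k w v * ?k a v) = (\<Sum>w\<in>V. \<Sum>v\<in>V. \<Sum>a\<in>V. h w a * ?k w v * ?k a v)"
      by (rule sum.swap)
    also have "\<dots> = viol h" unfolding viol_co by (intro sum.cong refl sum.swap)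
    finally show "(\<Sum>v\<in>V. \<Sum>w\<in>V. \<Sum>a\<in>V. h w a * ?k w v * ?k a v) \<le> \<theta> ^ i * n ^ 3" using viol' by simp
    show "(\<Sum>v\<in>V. c v * (\<Sum>a\<in>V. al a * h v a)) \<le> \<theta> ^ i * n ^ 2"
      "(\<Sum>v\<in>V. (w v - c v) * (\<Sum>a\<in>V. al a * ?k v a)) \<le> \<theta> ^ i * n ^ 2"
      using hC kW by (simp_all add: hA_def kA_def)
    show "c u * (w v - c v) * ?k u v \<in> {0, 1}" for u v by (intro mult01 c01 k01)
  qed (use sz2 del_i al01 in \<open>auto simp: i_def\<close>)
  have th3: "3 * \<theta> ^ (j + 3) \<le> \<theta> ^ j" 
  proof -
    have "3 * \<theta> ^ (j + 3) \<le> 3 * \<theta> ^ (j + 1)" by (intro mult_left_mono theta_mono) auto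
    also have "\<dots> = (3 * \<theta>) * \<theta> ^ j" by simp
    also have "\<dots> \<le> 1 * \<theta> ^ j" using theta_le theta_pos by (intro mult_right_mono) auto
    finally show ?thesis by simp
  qed
  have "(\<Sum>u\<in>V. \<Sum>v\<in>V. c u * (1 - c v) * ?k u v) \<le> 
     (\<Sum>u\<in>V. \<Sum>v\<in>V. c u * (w v - c v) * ?k u v + w u * (1 - w v) * ?k u v)"
  proof (intro sum_mono)
    fix u v
    have "c u * ((1 - w v) * ?k u v) \<le> w u * ((1 - w v) * ?k u v)"
      using c0[of u] w0[of v] coD(3)[OF h, of u v] by (intro mult_right_mono) auto
    then show "c u * (1 - c v) * ?k u v \<le> c u * (w v - c v) * ?k u v + w u * (1 - w v) * ?k u v"
      by (simp add: algebra_simps)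
  qed
  also have "\<dots> \<le> \<theta> ^ (j + 3) * n ^ 2 + e * n ^ 2"
    using E2 closed unfolding e_def sum.distrib by linarith
  also have "\<dots> \<le> \<theta> ^ (j + 3) * n ^ 2 + \<theta> ^ (j + 3) * n ^ 2"
    using e_le theta_mono[of "j + 3" i] by (intro add_mono mult_right_mono order_refl) (auto simp: i_def)
  also have "\<dots> \<le> (3 * \<theta> ^ (j + 3)) * n ^ 2" using theta_pos by simp
  also have "\<dots> \<le> \<theta> ^ j * n ^ 2" by (intro mult_right_mono th3) auto
  finally have E3: "(\<Sum>u\<in>V. \<Sum>v\<in>V. c u * (1 - c v) * ?k u v) \<le> \<theta> ^ j * n ^ 2" .
  have E1': "(\<Sum>u\<in>V. \<Sum>v\<in>V. c u * c v * h u v) \<le> \<theta> ^ j * n ^ 2"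
  proof -
    have "\<theta> ^ (j + 3) * n ^ 2 \<le> \<theta> ^ j * n ^ 2" by (intro mult_right_mono theta_mono) auto
    then show ?thesis using E1 by linarith
  qed
  let ?a = "\<Sum>a\<in>V. al a"
  \<comment> \<open>The size of \<open>c\<close> by double counting the \<open>co h\<close>-edges at
    \<open>al\<close>: there are about p n / r for each element of \<open>al\<close>, nearly all end
    in \<open>c\<close>, and by discrepancy at most p times the product of the two sizes can do so,
    up to \<delta> n^2.\<close>
  have "?a * (p * n / real r) - e * n ^ 2 \<le> (\<Sum>a\<in>V. al a * deg ?k a)"
  proof -
    have "?a * (p * n / real r) - (\<Sum>a\<in>V. al a * deg ?k a) = (\<Sum>a\<in>V. al a * (p * n / real r - deg ?k a))"
      by (simp only: sum_distrib_right right_diff_distrib sum_subtractf)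
    also have "\<dots> \<le> (\<Sum>a\<in>V. \<bar>deg ?k a - p * n / real r\<bar>)"
    proof (rule sum_mono)
      fix a
      have "al a * (p * n / real r - deg ?k a) \<le> al a * \<bar>deg ?k a - p * n / real r\<bar>"
        using al0 by (intro mult_left_mono) auto
      also have "\<dots> \<le> \<bar>deg ?k a - p * n / real r\<bar>" using al0 by (intro mult_left_le_one_le) auto
      finally show "al a * (p * n / real r - deg ?k a) \<le> \<bar>deg ?k a - p * n / real r\<bar>" .
    qed
    finally show ?thesis using dev unfolding e_def by linarith
  qed
  also have "(\<Sum>a\<in>V. al a * deg ?k a) \<le>
      (\<Sum>a\<in>V. \<Sum>v\<in>V. al a * c v * g a v + (w v - c v) * (al a * ?k v a) + w a * (1 - w v) * ?k a v)"
    unfolding deg_def sum_distrib_left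
  proof (intro sum_mono)
    fix a v
    have k: "?k a v \<le> g a v" "?k a v = ?k v a" using coD(5)[OF h, of a v] subD(6)[OF h, of a v] coD(2)[OF h] by auto
    have "al a * ?k a v = al a * c v * ?k a v + (w v - c v) * (al a * ?k v a) + al a * ((1 - w v) * ?k a v)"
      unfolding k(2) by (simp add: algebra_simps)
    also have "al a * c v * ?k a v \<le> al a * c v * g a v" using k al0 c0 by (intro mult_left_mono) auto
    also have "al a * ((1 - w v) * ?k a v) \<le> w a * ((1 - w v) * ?k a v)"
      unfolding al_def using w0[of a] w0[of v] coD(3,4)[OF h] by (intro mult_right_mono mult_right_le_one_le) auto
    finally show "al a * ?k a v \<le> al a * c v * g a v + (w v - c v) * (al a * ?k v a) + w a * (1 - w v) * ?k a v"
      by simp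
  qed
  also have "\<dots> = (\<Sum>a\<in>V. \<Sum>v\<in>V. al a * c v * g a v) + (\<Sum>a\<in>V. \<Sum>v\<in>V. (w v - c v) * (al a * ?k v a)) +
       (\<Sum>a\<in>V. \<Sum>v\<in>V. w a * (1 - w v) * ?k a v)" by (simp only: sum.distrib)
  also have "(\<Sum>a\<in>V. \<Sum>v\<in>V. al a * c v * g a v) \<le> p * ?a * (\<Sum>v\<in>V. c v) + \<delta> * n ^ 2"
    by (rule edge_count) (use al01 c01 in auto)
  also have "(\<Sum>a\<in>V. \<Sum>v\<in>V. (w v - c v) * (al a * ?k v a)) = (\<Sum>v\<in>V. (w v - c v) * kA v)"
    unfolding kA_def by (subst sum.swap) (simp only: sum_distrib_left)
  also have "(\<Sum>v\<in>V. (w v - c v) * kA v) \<le> \<theta> ^ i * n ^ 2" by (rule kW)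
  also have "(\<Sum>a\<in>V. \<Sum>v\<in>V. w a * (1 - w v) * ?k a v) \<le> e * n ^ 2" using closed unfolding e_def by simp
  finally have "?a * (p * n / real r) - e * n ^ 2 \<le> p * ?a * (\<Sum>v\<in>V. c v) + \<delta> * n ^ 2 + \<theta> ^ i * n ^ 2 + e * n ^ 2"
    by simp
  moreover have "\<delta> * n ^ 2 \<le> \<theta> ^ i * n ^ 2" "e * n ^ 2 \<le> \<theta> ^ i * n ^ 2"
    using del_i e_le by (intro mult_right_mono; simp)+
  ultimately have fin: "p * ?a * (n / real r - (\<Sum>v\<in>V. c v)) \<le> 4 * \<theta> ^ i * n ^ 2"
    by (simp add: algebra_simps)
  have "n / real r - (\<Sum>v\<in>V. c v) \<le> \<theta> ^ j * n"
  proof (rule ccontr)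
    assume neg: "\<not> ?thesis"
    have "\<theta> * (2 * \<theta> ^ 2 * n) * (\<theta> ^ j * n) \<le> p * ?a * (n / real r - (\<Sum>v\<in>V. c v))"
    proof (rule mult_mono)
      have "0 \<le> ?a" using al0 by (intro sum_nonneg)
      then show "0 \<le> p * ?a" using p_pos by simp
      show "\<theta> * (2 * \<theta> ^ 2 * n) \<le> p * ?a"
        using theta_le_p theta_pos p_pos sz2 by (intro mult_mono) auto
    qed (use neg theta_pos in auto)
    also note fin
    also have "4 * \<theta> ^ i * n ^ 2 \<le> 4 * \<theta> ^ (j + 4) * n ^ 2"
      by (intro mult_right_mono mult_left_mono theta_mono) (auto simp: i_def)
    also have "\<dots> = (2 * \<theta>) * (\<theta> * (2 * \<theta> ^ 2 * n) * (\<theta> ^ j * n))" by (simp add: power_add eval_nat_numeral)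
    also have "\<dots> \<le> (1 / 2) * (\<theta> * (2 * \<theta> ^ 2 * n) * (\<theta> ^ j * n))"
      using theta_le theta_pos by (intro mult_right_mono) auto
    finally have "\<theta> * (2 * \<theta> ^ 2 * n) * (\<theta> ^ j * n) \<le> 0" by simp
    moreover have "0 < \<theta> * (2 * \<theta> ^ 2 * n) * (\<theta> ^ j * n)" using theta_pos n0 by simp
    ultimately show False by linarith
  qed
  then show ?thesis using c01 c0 E1' E3 by (intro exI[of _ c]) auto
qed

text \<open>Parts are split off one at a time: colours below q are finished parts, colour q is the
  remainder. A remainder of at most \<theta>^j n vertices is declared a part itself and the next
  colour stays empty, so the first alternative persists; a larger one is fed to
  \<open>cluster\<close>. A step replaces j by 3 (j + 1) + 20, and 3^q (j + 12) dominates this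
  recursion.\<close>

lemma partial_clusters:
  assumes h: "sub h" and r: "r \<ge> 1" "4 * real r * \<theta> \<le> 1"
    and "viol h \<le> \<theta> ^ (3 ^ q * (j + 12)) * n ^ 3"
    and "(\<Sum>x\<in>V. \<bar>deg (co h) x - p * n / real r\<bar>) \<le> \<theta> ^ (3 ^ q * (j + 12)) * n ^ 2"
    and "\<delta> \<le> \<theta> ^ (3 ^ q * (j + 12))"
  shows "\<exists>col. (\<forall>v. col v \<le> q) \<and>
    (\<forall>i<q. (\<Sum>u\<in>V. \<Sum>v\<in>V. of_bool (col u = i) * of_bool (col v = i) * h u v) \<le> \<theta> ^ j * n ^ 2) \<and>
    ((\<Sum>v\<in>V. of_bool (col v = q)) \<le> \<theta> ^ j * n \<or>
     (\<forall>i<q. n / real r - \<theta> ^ j * n \<le> (\<Sum>v\<in>V. of_bool (col v = i))) \<and>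
     (\<Sum>u\<in>V. \<Sum>v\<in>V. of_bool (col u = q) * (1 - of_bool (col v = q)) * co h u v) \<le> \<theta> ^ j * n ^ 2)"
  using assms(4-)
proof (induction q arbitrary: j)
  case 0
  show ?case using theta_pos by (intro exI[of _ "\<lambda>_. 0"]) auto
next
  case (Suc q)
  define j' where "j' = 3 * j + 23"
  have "3 ^ q * (j' + 12) \<le> 3 ^ q * (3 * (j + 12))" by (intro mult_left_mono) (auto simp: j'_def)
  then have e1: "\<theta> ^ (3 ^ Suc q * (j + 12)) \<le> \<theta> ^ (3 ^ q * (j' + 12))" by (intro theta_mono) simp
  have "j' \<le> 1 * (3 * (j + 12))" by (simp add: j'_def)
  also have "\<dots> \<le> 3 ^ q * (3 * (j + 12))" by (intro mult_right_mono) auto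
  also have "\<dots> = 3 ^ Suc q * (j + 12)" by simp
  finally have "j' \<le> 3 ^ Suc q * (j + 12)" .
  then have e2: "\<theta> ^ (3 ^ Suc q * (j + 12)) \<le> \<theta> ^ j'" by (rule theta_mono)
  have n2: "0 \<le> n ^ 2" "0 \<le> n ^ 3" by simp_all
  have "\<exists>col. (\<forall>v. col v \<le> q) \<and>
    (\<forall>i<q. (\<Sum>u\<in>V. \<Sum>v\<in>V. of_bool (col u = i) * of_bool (col v = i) * h u v) \<le> \<theta> ^ j' * n ^ 2) \<and>
    ((\<Sum>v\<in>V. of_bool (col v = q)) \<le> \<theta> ^ j' * n \<or>
     (\<forall>i<q. n / real r - \<theta> ^ j' * n \<le> (\<Sum>v\<in>V. of_bool (col v = i))) \<and>
     (\<Sum>u\<in>V. \<Sum>v\<in>V. of_bool (col u = q) * (1 - of_bool (col v = q)) * co h u v) \<le> \<theta> ^ j' * n ^ 2)"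
    using Suc.prems e1 mult_right_mono[OF e1 n2(1)] mult_right_mono[OF e1 n2(2)]
    by (intro Suc.IH) linarith+
  then obtain col where col: "\<And>v. col v \<le> q"
    and cls: "\<And>i. i < q \<Longrightarrow> (\<Sum>u\<in>V. \<Sum>v\<in>V. of_bool (col u = i) * of_bool (col v = i) * h u v) \<le> \<theta> ^ j' * n ^ 2"
    and alt: "(\<Sum>v\<in>V. of_bool (col v = q)) \<le> \<theta> ^ j' * n \<or>
     (\<forall>i<q. n / real r - \<theta> ^ j' * n \<le> (\<Sum>v\<in>V. of_bool (col v = i))) \<and>
     (\<Sum>u\<in>V. \<Sum>v\<in>V. of_bool (col u = q) * (1 - of_bool (col v = q)) * co h u v) \<le> \<theta> ^ j' * n ^ 2"
    by blast
  have jj: "\<theta> ^ j' \<le> \<theta> ^ (j + 1)" "\<theta> ^ (j + 1) \<le> \<theta> ^ j" "\<theta> ^ j' \<le> \<theta> ^ j"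
    by (intro theta_mono; simp add: j'_def)+
  have cls': "(\<Sum>u\<in>V. \<Sum>v\<in>V. of_bool (col u = i) * of_bool (col v = i) * h u v) \<le> \<theta> ^ j * n ^ 2" if "i < q" for i
    using cls[OF that] mult_right_mono[OF jj(3) n2(1)] by linarith
  show ?case
  proof (cases "(\<Sum>v\<in>V. of_bool (col v = q)) \<le> \<theta> ^ j * n")
    case True
    have "(\<Sum>u\<in>V. \<Sum>v\<in>V. of_bool (col u = q) * of_bool (col v = q) * h u v) \<le> (\<Sum>u\<in>V. \<Sum>v\<in>V. of_bool (col u = q))"
      using subD(6,7)[OF h] by (intro sum_mono) (auto simp: of_bool_def)
    also have "\<dots> = (\<Sum>v\<in>V. of_bool (col v = q)) * n" by (simp only: sum_distrib_right) (simp add: mult.commute)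
    also have "\<dots> \<le> \<theta> ^ j * n * n" using True by (intro mult_right_mono) auto
    finally have "(\<Sum>u\<in>V. \<Sum>v\<in>V. of_bool (col u = q) * of_bool (col v = q) * h u v) \<le> \<theta> ^ j * n ^ 2"
      by (simp add: power2_eq_square)
    then have "\<forall>i<Suc q. (\<Sum>u\<in>V. \<Sum>v\<in>V. of_bool (col u = i) * of_bool (col v = i) * h u v) \<le> \<theta> ^ j * n ^ 2"
      using cls' less_Suc_eq by auto
    moreover have "col v \<noteq> Suc q" for v using col[of v] by simp
    then have "(\<Sum>v\<in>V. of_bool (col v = Suc q)) \<le> \<theta> ^ j * n" using theta_pos by simp
    moreover have "col v \<le> Suc q" for v using col[of v] by simp
    ultimately show ?thesis by blast
  next
    case False
    define w :: "'a \<Rightarrow> real" where "w v = of_bool (col v = q)" for v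
    have w01: "w v \<in> {0, 1}" for v by (simp add: w_def)
    have "\<theta> ^ j' * n \<le> \<theta> ^ j * n" using jj by (intro mult_right_mono) auto
    then have alt': "\<And>i. i < q \<Longrightarrow> n / real r - \<theta> ^ j' * n \<le> (\<Sum>v\<in>V. of_bool (col v = i))"
      and closed: "(\<Sum>u\<in>V. \<Sum>v\<in>V. w u * (1 - w v) * co h u v) \<le> \<theta> ^ j' * n ^ 2"
      using alt False unfolding w_def by auto
    have j'e: "j' = 3 * (j + 1) + 20" by (simp add: j'_def)
    have "\<exists>c. (\<forall>v. c v \<in> {0, 1 :: real} \<and> c v \<le> w v) \<and>
      (\<Sum>u\<in>V. \<Sum>v\<in>V. c u * c v * h u v) \<le> \<theta> ^ (j + 1) * n ^ 2 \<and>
      (\<Sum>u\<in>V. \<Sum>v\<in>V. c u * (1 - c v) * co h u v) \<le> \<theta> ^ (j + 1) * n ^ 2 \<and>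
      n / real r - \<theta> ^ (j + 1) * n \<le> (\<Sum>v\<in>V. c v)"
    proof (rule cluster[OF h w01 r])
      show "viol h \<le> \<theta> ^ (3 * (j + 1) + 20) * n ^ 3" "\<delta> \<le> \<theta> ^ (3 * (j + 1) + 20)"
        "(\<Sum>x\<in>V. \<bar>deg (co h) x - p * n / real r\<bar>) \<le> \<theta> ^ (3 * (j + 1) + 20) * n ^ 2"
        using Suc.prems e2 mult_right_mono[OF e2 n2(1)] mult_right_mono[OF e2 n2(2)] unfolding j'e by linarith+
      show "(\<Sum>u\<in>V. \<Sum>v\<in>V. w u * (1 - w v) * co h u v) \<le> \<theta> ^ (3 * (j + 1) + 20) * n ^ 2"
        using closed unfolding j'e .
      have "\<theta> ^ (j + 1) * n \<le> \<theta> ^ j * n" using jj by (intro mult_right_mono) auto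
      then show "\<theta> ^ (j + 1) * n \<le> (\<Sum>v\<in>V. w v)" using False unfolding w_def by linarith
    qed
    then obtain c where c: "\<And>v. c v \<in> {0, 1 :: real}" "\<And>v. c v \<le> w v"
      and c1: "(\<Sum>u\<in>V. \<Sum>v\<in>V. c u * c v * h u v) \<le> \<theta> ^ (j + 1) * n ^ 2"
      and c2: "(\<Sum>u\<in>V. \<Sum>v\<in>V. c u * (1 - c v) * co h u v) \<le> \<theta> ^ (j + 1) * n ^ 2"
      and c3: "n / real r - \<theta> ^ (j + 1) * n \<le> (\<Sum>v\<in>V. c v)" by blast
    \<comment> \<open>The new part keeps colour q; the rest of the old remainder moves to Suc
      q.\<close>
    define col' where "col' v = (if col v = q \<and> c v = 0 then Suc q else col v)" for v
    have b1: "of_bool (col' v = q) = c v" for v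
      using c(1)[of v] c(2)[of v] by (auto simp: col'_def w_def)
    have b2: "of_bool (col' v = i) = (of_bool (col v = i) :: real)" if "i < q" for v i
      using that by (auto simp: col'_def)
    have b3: "of_bool (col' v = Suc q) = w v - c v" for v
      using c(1)[of v] c(2)[of v] col[of v] by (auto simp: col'_def w_def)
    have w0: "0 \<le> w v" "w v \<le> 1" "0 \<le> c v" "c v \<le> 1" for v using w01[of v] c(1)[of v] by auto
    have "(\<Sum>u\<in>V. \<Sum>v\<in>V. (w u - c u) * (1 - (w v - c v)) * co h u v) \<le>
      (\<Sum>u\<in>V. \<Sum>v\<in>V. w u * (1 - w v) * co h u v + c v * (1 - c u) * co h v u)"
    proof (intro sum_mono)
      fix u v
      have "(w u - c u) * (1 - w v) \<le> w u * (1 - w v)" "(w u - c u) * c v \<le> (1 - c u) * c v"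
        using w0[of u] w0[of v] by (intro mult_right_mono; simp)+
      then have "(w u - c u) * (1 - (w v - c v)) \<le> w u * (1 - w v) + c v * (1 - c u)"
        by (simp add: algebra_simps)
      then have "(w u - c u) * (1 - (w v - c v)) * co h u v \<le> (w u * (1 - w v) + c v * (1 - c u)) * co h u v"
        using coD(3)[OF h] by (intro mult_right_mono)
      then show "(w u - c u) * (1 - (w v - c v)) * co h u v \<le> w u * (1 - w v) * co h u v + c v * (1 - c u) * co h v u"
        by (simp only: coD(2)[OF h, of v u] distrib_right)
    qed
    also have "\<dots> = (\<Sum>u\<in>V. \<Sum>v\<in>V. w u * (1 - w v) * co h u v) + (\<Sum>u\<in>V. \<Sum>v\<in>V. c u * (1 - c v) * co h u v)"
      unfolding sum.distrib by (subst (2) sum.swap) (rule refl)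
    also have "\<dots> \<le> \<theta> ^ (j + 1) * n ^ 2 + \<theta> ^ (j + 1) * n ^ 2"
      using closed c2 mult_right_mono[OF jj(1) n2(1)] by linarith
    also have "\<dots> = (2 * \<theta>) * (\<theta> ^ j * n ^ 2)" by simp
    also have "\<dots> \<le> 1 * (\<theta> ^ j * n ^ 2)" using theta_le theta_pos by (intro mult_right_mono) auto
    finally have "(\<Sum>u\<in>V. \<Sum>v\<in>V. (w u - c u) * (1 - (w v - c v)) * co h u v) \<le> \<theta> ^ j * n ^ 2" by simp
    moreover have "(\<Sum>u\<in>V. \<Sum>v\<in>V. of_bool (col' u = i) * of_bool (col' v = i) * h u v) \<le> \<theta> ^ j * n ^ 2"
      if "i < Suc q" for i
    proof (cases "i = q")
      case True
      then show ?thesis using c1 b1 mult_right_mono[OF jj(2) n2(1)] by simp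
    next
      case False
      then have "i < q" using that by simp
      then show ?thesis unfolding b2[OF \<open>i < q\<close>] by (rule cls')
    qed
    moreover have "n / real r - \<theta> ^ j * n \<le> (\<Sum>v\<in>V. of_bool (col' v = i))" if "i < Suc q" for i
    proof (cases "i = q")
      case True
      then show ?thesis using c3 b1 mult_right_mono[OF jj(2), of n] by simp
    next
      case False
      then have "i < q" using that by simp
      then show ?thesis using alt'[of i] b2[of i] mult_right_mono[OF jj(3), of n] by simp
    qed
    moreover have "col' v \<le> Suc q" for v using col[of v] by (auto simp: col'_def)
    ultimately show ?thesis using b3 by (intro exI[of _ col']) simp
  qed
qed

text \<open>Unless the remainder is small already, r parts of almost n / r vertices each leave at
  most r \<theta>^(j + 1) n vertices for it. It is merged into colour 0, at a cost of at most n per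
  vertex and direction; the spare power of \<theta> pays for the factor 3 r.\<close>

lemma near_partition:
  assumes h: "sub h" and r: "r \<ge> 1" "4 * real r * \<theta> \<le> 1"
    and "viol h \<le> \<theta> ^ (3 ^ r * (j + 13)) * n ^ 3"
    and "(\<Sum>x\<in>V. \<bar>deg (co h) x - p * n / real r\<bar>) \<le> \<theta> ^ (3 ^ r * (j + 13)) * n ^ 2"
    and "\<delta> \<le> \<theta> ^ (3 ^ r * (j + 13))"
  shows "\<exists>col. (\<forall>v. col v < r) \<and> (\<Sum>u\<in>V. \<Sum>v\<in>V. of_bool (col u = col v) * h u v) \<le> \<theta> ^ j * n ^ 2"
proof -
  have e: "j + 13 = (j + 1) + 12" by simp
  obtain col where col: "\<And>v. col v \<le> r"
    and cls: "\<And>i. i < r \<Longrightarrow> (\<Sum>u\<in>V. \<Sum>v\<in>V. of_bool (col u = i) * of_bool (col v = i) * h u v) \<le> \<theta> ^ (j + 1) * n ^ 2"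
    and alt: "(\<Sum>v\<in>V. of_bool (col v = r)) \<le> \<theta> ^ (j + 1) * n \<or>
     (\<forall>i<r. n / real r - \<theta> ^ (j + 1) * n \<le> (\<Sum>v\<in>V. of_bool (col v = i)))"
    using partial_clusters[OF h r assms(4-)[unfolded e]] by blast
  let ?W = "\<Sum>v\<in>V. of_bool (col v = r) :: real"
  let ?t = "\<theta> ^ (j + 1) * n"
  have t0: "0 \<le> ?t" using theta_pos by simp
  have W: "?W \<le> real r * ?t"
    using alt
  proof
    assume "?W \<le> ?t"
    also have "?t \<le> real r * ?t" using r t0 mult_right_mono[of 1 "real r" ?t] by simp
    finally show ?thesis .
  next
    assume a: "\<forall>i<r. n / real r - ?t \<le> (\<Sum>v\<in>V. of_bool (col v = i))"
    have "(\<Sum>i<Suc r. (\<Sum>v\<in>V. of_bool (col v = i) :: real)) = (\<Sum>v\<in>V. (\<Sum>i<Suc r. of_bool (col v = i)))"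
      by (rule sum.swap)
    also have "\<dots> = (\<Sum>v\<in>V. 1)"
    proof (intro sum.cong refl)
      fix v
      have "(\<Sum>i<Suc r. of_bool (col v = i) :: real) = (\<Sum>i\<in>{col v}. 1)"
        using col[of v] by (intro sum.mono_neutral_cong_right) auto
      then show "(\<Sum>i<Suc r. of_bool (col v = i) :: real) = 1" by simp
    qed
    finally have "(\<Sum>i<r. (\<Sum>v\<in>V. of_bool (col v = i) :: real)) + ?W = n" by simp
    moreover have "(\<Sum>i<r. n / real r - ?t) \<le> (\<Sum>i<r. (\<Sum>v\<in>V. of_bool (col v = i) :: real))"
      using a by (intro sum_mono) auto
    ultimately show ?thesis using r by (simp add: algebra_simps)
  qed
  define col' where "col' v = (if col v < r then col v else 0)" for v
  have "(\<Sum>u\<in>V. \<Sum>v\<in>V. of_bool (col' u = col' v) * h u v) \<le>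
     (\<Sum>u\<in>V. \<Sum>v\<in>V. (\<Sum>i<r. of_bool (col u = i) * of_bool (col v = i) * h u v) + of_bool (col u = r) + of_bool (col v = r))"
  proof (intro sum_mono)
    fix u v
    let ?s = "\<Sum>i<r. of_bool (col u = i) * of_bool (col v = i) * h u v"
    have s0: "0 \<le> ?s" using subD(6)[OF h] by (intro sum_nonneg) simp
    show "of_bool (col' u = col' v) * h u v \<le> ?s + of_bool (col u = r) + of_bool (col v = r)"
    proof (cases "col u < r \<and> col v < r \<and> col u = col v")
      case True
      have "of_bool (col u = col u) * of_bool (col v = col u) * h u v \<le> ?s"
        using subD(6)[OF h] True by (intro member_le_sum) auto
      then show ?thesis using True s0 by simp
    next
      case False
      then show ?thesis using s0 col[of u] col[of v] subD(6,7)[OF h, of u v]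
        by (auto simp: col'_def of_bool_def split: if_splits)
    qed
  qed
  also have "\<dots> = (\<Sum>u\<in>V. \<Sum>v\<in>V. \<Sum>i<r. of_bool (col u = i) * of_bool (col v = i) * h u v) + ?W * n + ?W * n"
    by (simp add: sum.distrib flip: sum_distrib_left)
  also have "(\<Sum>u\<in>V. \<Sum>v\<in>V. \<Sum>i<r. of_bool (col u = i) * of_bool (col v = i) * h u v) =
      (\<Sum>u\<in>V. \<Sum>i<r. \<Sum>v\<in>V. of_bool (col u = i) * of_bool (col v = i) * h u v)"
    by (intro sum.cong refl sum.swap)
  also have "\<dots> = (\<Sum>i<r. \<Sum>u\<in>V. \<Sum>v\<in>V. of_bool (col u = i) * of_bool (col v = i) * h u v)"
    by (rule sum.swap)
  also have "\<dots> \<le> (\<Sum>i<r. \<theta> ^ (j + 1) * n ^ 2)" by (intro sum_mono cls) auto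
  also have "(\<Sum>i<r. \<theta> ^ (j + 1) * n ^ 2) + ?W * n + ?W * n \<le>
      real r * (?t * n) + (real r * ?t) * n + (real r * ?t) * n"
    using mult_right_mono[OF W, of n] by (simp add: power2_eq_square mult_ac)
  also have "\<dots> = (3 * real r * \<theta>) * (\<theta> ^ j * n ^ 2)" by (simp add: power2_eq_square)
  also have "\<dots> \<le> 1 * (\<theta> ^ j * n ^ 2)"
    using r theta_pos by (intro mult_right_mono) auto
  finally have "(\<Sum>u\<in>V. \<Sum>v\<in>V. of_bool (col' u = col' v) * h u v) \<le> \<theta> ^ j * n ^ 2" by simp
  moreover have "col' v < r" for v using r by (auto simp: col'_def)
  ultimately show ?thesis by blast
qed

lemma stability:
  assumes r: "r \<ge> 2" "4 * real r * \<theta> \<le> 1" and J: "J = 3 ^ r * (j + 13) + 1"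
    and del: "\<delta> \<le> \<theta> ^ (2 ^ (r + 1) * (J + 3))"
    and h: "sub h" and free: "kfree (Suc r) h"
    and big: "(1 - 1 / real r) * p * n ^ 2 - \<theta> ^ (2 * J + 3) * n ^ 2 \<le> (\<Sum>x\<in>V. deg h x)"
  shows "\<exists>col. (\<forall>v. col v < r) \<and> (\<Sum>u\<in>V. \<Sum>v\<in>V. of_bool (col u = col v) * h u v) \<le> \<theta> ^ j * n ^ 2"
proof (rule near_partition[OF h _ r(2)])
  let ?E = "3 ^ r * (j + 13)"
  note ne = near_extremal[OF r(1) del h free big]
  have J1: "\<theta> ^ J \<le> \<theta> ^ ?E" by (rule theta_mono) (simp add: J)
  have "\<theta> ^ J * n ^ 3 \<le> \<theta> ^ ?E * n ^ 3" using J1 by (intro mult_right_mono) auto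
  with ne(1) show "viol h \<le> \<theta> ^ ?E * n ^ 3" by linarith
  have "2 * \<theta> ^ J * n ^ 2 = (2 * \<theta>) * (\<theta> ^ ?E * n ^ 2)" by (simp add: J)
  also have "\<dots> \<le> 1 * (\<theta> ^ ?E * n ^ 2)" using theta_le theta_pos by (intro mult_right_mono) auto
  finally show "(\<Sum>x\<in>V. \<bar>deg (co h) x - p * n / real r\<bar>) \<le> \<theta> ^ ?E * n ^ 2" using ne(2) by simp
  have "1 * J \<le> 2 ^ (r + 1) * (J + 3)" by (intro mult_mono) auto
  then have "\<delta> \<le> \<theta> ^ J" using del theta_mono by (metis mult_1 order_trans)
  then show "\<delta> \<le> \<theta> ^ ?E" using J1 by linarith
qed (use r in auto)

subsection \<open>From stability to exact structure\<close>

text \<open>\<open>cross\<close> and \<open>inside\<close> run over ordered pairs and hence count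
  every edge twice; this is the source of the factor 2 in \<open>typical\<close> and in the
  comparisons with cardinalities of edge sets.\<close>

definition cross :: "('a \<Rightarrow> 'a \<Rightarrow> real) \<Rightarrow> ('a \<Rightarrow> nat) \<Rightarrow> real" where
  "cross h \<pi> = (\<Sum>u\<in>V. \<Sum>v\<in>V. of_bool (\<pi> u \<noteq> \<pi> v) * h u v)"

definition inside :: "('a \<Rightarrow> 'a \<Rightarrow> real) \<Rightarrow> ('a \<Rightarrow> nat) \<Rightarrow> real" where
  "inside h \<pi> = (\<Sum>u\<in>V. \<Sum>v\<in>V. of_bool (\<pi> u = \<pi> v) * h u v)"

lemma cross_add_inside: "cross h \<pi> + inside h \<pi> = (\<Sum>x\<in>V. deg h x)"
  unfolding cross_def inside_def deg_def sum.distrib[symmetric] by (intro sum.cong refl) auto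

lemma finite_colourings: "finite (V \<rightarrow>\<^sub>E {..<r :: nat})"
  using finite_V by (intro finite_PiE) auto

lemma max_cut_exists:
  assumes "r \<ge> 1"
  shows "\<exists>\<pi>\<in>V \<rightarrow>\<^sub>E {..<r}. \<forall>\<pi>'\<in>V \<rightarrow>\<^sub>E {..<r}. cross h \<pi>' \<le> cross h \<pi>"
proof -
  have "restrict (\<lambda>_. 0) V \<in> V \<rightarrow>\<^sub>E {..<r}" using assms by auto
  then have "Max (cross h ` (V \<rightarrow>\<^sub>E {..<r})) \<in> cross h ` (V \<rightarrow>\<^sub>E {..<r})"
    by (intro Max_in finite_imageI finite_colourings) blast
  then obtain \<pi> where "\<pi> \<in> V \<rightarrow>\<^sub>E {..<r}" "cross h \<pi> = Max (cross h ` (V \<rightarrow>\<^sub>E {..<r}))" by auto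
  then show ?thesis
    using Max_ge[OF finite_imageI[OF finite_colourings]] by (metis imageI)
qed

text \<open>Recolouring x changes the cut only at x, so in an optimal colouring no class contains
  fewer neighbours of x than its own.\<close>

lemma max_cut_local:
  assumes sym: "\<And>x y. h x y = h y x" and irr: "\<And>x. h x x = 0"
    and \<pi>: "\<pi> \<in> V \<rightarrow>\<^sub>E {..<r}" and opt: "\<And>\<pi>'. \<pi>' \<in> V \<rightarrow>\<^sub>E {..<r} \<Longrightarrow> cross h \<pi>' \<le> cross h \<pi>"
    and x: "x \<in> V" and i: "i < r"
  shows "(\<Sum>v\<in>V. of_bool (\<pi> v = \<pi> x) * h x v) \<le> (\<Sum>v\<in>V. of_bool (\<pi> v = i) * h x v)"
proof -
  define \<pi>' where "\<pi>' = \<pi>(x := i)"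
  have "\<pi>' \<in> V \<rightarrow>\<^sub>E {..<r}" using \<pi> x i by (auto simp: \<pi>'_def PiE_def extensional_def)
  then have le: "cross h \<pi>' \<le> cross h \<pi>" by (rule opt)
  have split: "cross h \<rho> = (\<Sum>u\<in>V-{x}. \<Sum>v\<in>V-{x}. of_bool (\<rho> u \<noteq> \<rho> v) * h u v) +
      2 * (\<Sum>v\<in>V. of_bool (\<rho> v \<noteq> \<rho> x) * h x v)" for \<rho> :: "'a \<Rightarrow> nat"
  proof -
    let ?f = "\<lambda>u v. of_bool (\<rho> u \<noteq> \<rho> v) * h u v"
    have "cross h \<rho> = (\<Sum>v\<in>V. ?f x v) + (\<Sum>u\<in>V-{x}. \<Sum>v\<in>V. ?f u v)"
      unfolding cross_def by (rule sum.remove[OF finite_V x])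
    also have "(\<Sum>u\<in>V-{x}. \<Sum>v\<in>V. ?f u v) = (\<Sum>u\<in>V-{x}. ?f u x + (\<Sum>v\<in>V-{x}. ?f u v))"
      by (intro sum.cong refl sum.remove[OF finite_V x])
    also have "\<dots> = (\<Sum>u\<in>V-{x}. ?f u x) + (\<Sum>u\<in>V-{x}. \<Sum>v\<in>V-{x}. ?f u v)" by (rule sum.distrib)
    also have "(\<Sum>u\<in>V-{x}. ?f u x) = (\<Sum>u\<in>V. ?f u x)"
      unfolding sum.remove[OF finite_V x] using irr by simp
    also have "\<dots> = (\<Sum>v\<in>V. of_bool (\<rho> v \<noteq> \<rho> x) * h x v)"
      by (intro sum.cong refl) (simp add: sym)
    also have "(\<Sum>v\<in>V. ?f x v) = (\<Sum>v\<in>V. of_bool (\<rho> v \<noteq> \<rho> x) * h x v)"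
      by (intro sum.cong refl) (simp add: eq_commute)
    finally show ?thesis by simp
  qed
  have "(\<Sum>u\<in>V-{x}. \<Sum>v\<in>V-{x}. of_bool (\<pi>' u \<noteq> \<pi>' v) * h u v) =
      (\<Sum>u\<in>V-{x}. \<Sum>v\<in>V-{x}. of_bool (\<pi> u \<noteq> \<pi> v) * h u v)"
    by (intro sum.cong refl) (auto simp: \<pi>'_def)
  with le have le': "(\<Sum>v\<in>V. of_bool (\<pi>' v \<noteq> \<pi>' x) * h x v) \<le> (\<Sum>v\<in>V. of_bool (\<pi> v \<noteq> \<pi> x) * h x v)"
    unfolding split[of \<pi>'] split[of \<pi>] by simp
  have "(\<Sum>v\<in>V. of_bool (\<pi>' v \<noteq> \<pi>' x) * h x v) = (\<Sum>v\<in>V. h x v - of_bool (\<pi> v = i) * h x v)"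
    using irr by (intro sum.cong refl) (auto simp: \<pi>'_def)
  moreover have "(\<Sum>v\<in>V. of_bool (\<pi> v \<noteq> \<pi> x) * h x v) = (\<Sum>v\<in>V. h x v - of_bool (\<pi> v = \<pi> x) * h x v)"
    by (intro sum.cong refl) auto
  ultimately show ?thesis using le' by (simp only: sum_subtractf)
qed

lemma sum_colours:
  fixes \<pi> :: "'a \<Rightarrow> nat"
  assumes "\<pi> \<in> V \<rightarrow>\<^sub>E {..<r}" "v \<in> V"
  shows "(\<Sum>i<r. of_bool (\<pi> v = i) :: real) = 1"
proof -
  have "(\<Sum>i<r. of_bool (\<pi> v = i) :: real) = (\<Sum>i\<in>{\<pi> v}. 1)"
    using assms by (intro sum.mono_neutral_cong_right) auto
  then show ?thesis by simp
qed

text \<open>Local optimality summed over the r colours bounds the degree of every vertex into its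
  own class by its degree over r, so an optimal cut keeps the share 1 - 1/r of the edges.\<close>

lemma max_cut_large:
  assumes r: "r \<ge> 1"
  shows "\<exists>\<pi>\<in>V \<rightarrow>\<^sub>E {..<r}. (1 - 1 / real r) * (p - \<delta>) * n ^ 2 \<le> cross g \<pi>"
proof -
  obtain \<pi> where \<pi>: "\<pi> \<in> V \<rightarrow>\<^sub>E {..<r}" and opt: "\<And>\<pi>'. \<pi>' \<in> V \<rightarrow>\<^sub>E {..<r} \<Longrightarrow> cross g \<pi>' \<le> cross g \<pi>"
    using max_cut_exists[OF r] by metis
  have "real r * inside g \<pi> = (\<Sum>x\<in>V. \<Sum>i<r. \<Sum>v\<in>V. of_bool (\<pi> v = \<pi> x) * g x v)"
    unfolding inside_def by (simp add: sum_distrib_left eq_commute)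
  also have "\<dots> \<le> (\<Sum>x\<in>V. \<Sum>i<r. \<Sum>v\<in>V. of_bool (\<pi> v = i) * g x v)"
  proof (rule sum_mono, rule sum_mono)
    fix x i assume "x \<in> V" "i \<in> {..<r}"
    then show "(\<Sum>v\<in>V. of_bool (\<pi> v = \<pi> x) * g x v) \<le> (\<Sum>v\<in>V. of_bool (\<pi> v = i) * g x v)"
      by (intro max_cut_local[OF g_sym g_irrefl \<pi> opt]) auto
  qed
  also have "\<dots> = (\<Sum>x\<in>V. \<Sum>v\<in>V. \<Sum>i<r. of_bool (\<pi> v = i) * g x v)"
    by (intro sum.cong refl sum.swap)
  also have "\<dots> = (\<Sum>x\<in>V. deg g x)"
    unfolding deg_def using sum_colours[OF \<pi>] by (simp flip: sum_distrib_right)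
  finally have "inside g \<pi> \<le> (\<Sum>x\<in>V. deg g x) / real r" using r by (simp add: field_simps)
  then have "(1 - 1 / real r) * (\<Sum>x\<in>V. deg g x) \<le> cross g \<pi>"
    using cross_add_inside[of g \<pi>] by (simp add: algebra_simps)
  moreover have "(p - \<delta>) * n ^ 2 \<le> (\<Sum>x\<in>V. deg g x)"
    using edge_count(2)[of "\<lambda>_. 1" "\<lambda>_. 1"] by (simp add: deg_def algebra_simps power2_eq_square)
  then have "(1 - 1 / real r) * ((p - \<delta>) * n ^ 2) \<le> (1 - 1 / real r) * (\<Sum>x\<in>V. deg g x)"
    using r by (intro mult_left_mono) auto
  ultimately have "(1 - 1 / real r) * (p - \<delta>) * n ^ 2 \<le> cross g \<pi>" by simp
  then show ?thesis using \<pi> by blast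
qed

section \<open>Transversal cliques, matchings and typical graphs\<close>

lemma sum_indicator: "A \<subseteq> V \<Longrightarrow> (\<Sum>v\<in>V. of_bool (v \<in> A) * f v) = (\<Sum>v\<in>A. f v :: real)"
  using finite_V by (intro sum.mono_neutral_cong_right) auto

text \<open>Greedy embedding: by the density hypothesis few vertices of S a have less than half of
  the expected neighbours in some other set, and a good vertex keeps at least the share p / 2 \<ge>
  \<theta>^2 of each of them. So k grows by 2 while card J falls by 1, which leaves 2 k + 4 card J +
  3 unchanged.\<close>

lemma transversal_clique:
  assumes "finite J" and h: "sub h" and "4 * real (card J) * \<theta> \<le> 1"
    and "\<And>i. i \<in> J \<Longrightarrow> S i \<subseteq> V" "\<And>i. i \<in> J \<Longrightarrow> \<theta> ^ k * n \<le> real (card (S i))"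
    and "\<And>i j A B. i \<in> J \<Longrightarrow> j \<in> J \<Longrightarrow> i \<noteq> j \<Longrightarrow> A \<subseteq> S i \<Longrightarrow> B \<subseteq> S j \<Longrightarrow>
      p * real (card A) * real (card B) - e * n ^ 2 \<le> (\<Sum>u\<in>A. \<Sum>v\<in>B. h u v)"
    and "e \<le> \<theta> ^ (2 * k + 4 * card J + 3)"
  shows "\<exists>f. \<forall>i\<in>J. f i \<in> S i \<and> (\<forall>j\<in>J. i \<noteq> j \<longrightarrow> h (f i) (f j) = 1)"
  using assms(1,3-)
proof (induction J arbitrary: S k rule: finite_induct)
  case empty
  then show ?case by simp
next
  case (insert a J)
  have n0: "n > 0" using n_ge_1 by simp
  have cJ: "card (insert a J) = Suc (card J)" using insert.hyps by simp
  have cth: "4 * real (card J) * \<theta> \<le> 1" using insert.prems(1) theta_pos unfolding cJ by (simp add: algebra_simps)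
  have e: "e \<le> \<theta> ^ (2 * k + 3)"
    using insert.prems(5) theta_mono[of "2 * k + 3" "2 * k + 4 * card (insert a J) + 3"] by simp
  define Bad where "Bad j = {v \<in> S a. (\<Sum>w\<in>S j. h v w) < p / 2 * real (card (S j))}" for j
  have finS: "finite (S i)" if "i \<in> insert a J" for i
    using insert.prems(2)[OF that] finite_V by (rule finite_subset)
  have bad: "real (card (Bad j)) \<le> 2 * \<theta> ^ (k + 2) * n" if j: "j \<in> J" for j
  proof -
    have ja: "j \<noteq> a" using j insert.hyps by auto
    have "p * real (card (Bad j)) * real (card (S j)) - e * n ^ 2 \<le> (\<Sum>u\<in>Bad j. \<Sum>v\<in>S j. h u v)"
      using j ja by (intro insert.prems(4)[of a j]) (auto simp: Bad_def)
    also have "\<dots> \<le> (\<Sum>u\<in>Bad j. p / 2 * real (card (S j)))"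
      by (intro sum_mono) (auto simp: Bad_def)
    finally have "p * real (card (Bad j)) * real (card (S j)) \<le> 2 * e * n ^ 2" by (simp add: field_simps)
    moreover have "\<theta> * real (card (Bad j)) * (\<theta> ^ k * n) \<le> p * real (card (Bad j)) * real (card (S j))"
      using theta_le_p theta_pos insert.prems(3)[of j] j by (intro mult_mono) auto
    moreover have "2 * e * n ^ 2 \<le> 2 * \<theta> ^ (2 * k + 3) * n ^ 2" using e by (intro mult_right_mono) auto
    ultimately have "\<theta> * real (card (Bad j)) * (\<theta> ^ k * n) \<le> 2 * \<theta> ^ (2 * k + 3) * n ^ 2" by linarith
    also have "\<theta> ^ (2 * k + 3) = \<theta> ^ (k + 2) * (\<theta> * \<theta> ^ k)"
      by (simp add: mult_2 power_add eval_nat_numeral)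
    finally have "real (card (Bad j)) * (\<theta> * \<theta> ^ k * n) \<le> 2 * \<theta> ^ (k + 2) * n * (\<theta> * \<theta> ^ k * n)"
      by (simp add: power2_eq_square mult_ac)
    then show ?thesis using theta_pos n0 by (simp only: mult_le_cancel_right_pos mult_pos_pos zero_less_power)
  qed
  have "real (card (\<Union>j\<in>J. Bad j)) \<le> (\<Sum>j\<in>J. real (card (Bad j)))"
    using card_UN_le[OF insert.hyps(1), of Bad] by (metis of_nat_le_iff of_nat_sum)
  also have "\<dots> \<le> (\<Sum>j\<in>J. 2 * \<theta> ^ (k + 2) * n)" using bad by (intro sum_mono)
  also have "\<dots> = (4 * real (card J) * \<theta>) * (\<theta> / 2 * (\<theta> ^ k * n))" by (simp add: power_add power2_eq_square)
  also have "\<dots> \<le> 1 * (\<theta> / 2 * (\<theta> ^ k * n))" using cth theta_pos by (intro mult_right_mono) auto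
  also have "\<dots> < 1 * (\<theta> ^ k * n)" using theta_le theta_pos n0 by simp
  also have "\<dots> \<le> real (card (S a))" using insert.prems(3)[of a] by simp
  finally have "card (\<Union>j\<in>J. Bad j) < card (S a)" by simp
  moreover have "(\<Union>j\<in>J. Bad j) \<subseteq> S a" by (auto simp: Bad_def)
  ultimately obtain v where v: "v \<in> S a" "\<And>j. j \<in> J \<Longrightarrow> v \<notin> Bad j"
    by (metis UN_I less_irrefl subset_antisym subsetI)
  define S' where "S' j = {w \<in> S j. h v w = 1}" for j
  have S': "\<theta> ^ (k + 2) * n \<le> real (card (S' j))" if j: "j \<in> J" for j
  proof -
    have "real (card (S' j)) = (\<Sum>w\<in>S' j. 1)" by simp
    also have "\<dots> = (\<Sum>w\<in>S j. h v w)"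
      unfolding S'_def using finS[of j] j subD(1)[OF h]
      by (intro sum.mono_neutral_cong_left) auto
    also have "\<dots> \<ge> p / 2 * real (card (S j))" using v j by (force simp: Bad_def)
    finally have "p / 2 * real (card (S j)) \<le> real (card (S' j))" .
    moreover have "\<theta> / 2 * (\<theta> ^ k * n) \<le> p / 2 * real (card (S j))"
      using theta_le_p theta_pos insert.prems(3)[of j] j by (intro mult_mono) auto
    moreover have "\<theta> ^ (k + 2) * n \<le> \<theta> / 2 * (\<theta> ^ k * n)"
    proof -
      have "\<theta> * (\<theta> * (\<theta> ^ k * n)) \<le> 1 / 2 * (\<theta> * (\<theta> ^ k * n))"
        using theta_le theta_pos by (intro mult_right_mono) auto
      then show ?thesis by (simp add: power_add power2_eq_square mult_ac)
    qed
    ultimately show ?thesis by linarith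
  qed
  have "\<exists>f. \<forall>i\<in>J. f i \<in> S' i \<and> (\<forall>j\<in>J. i \<noteq> j \<longrightarrow> h (f i) (f j) = 1)"
  proof (rule insert.IH[OF cth])
    show "S' i \<subseteq> V" if "i \<in> J" for i using insert.prems(2)[of i] that by (auto simp: S'_def)
    show "p * real (card A) * real (card B) - e * n ^ 2 \<le> (\<Sum>u\<in>A. \<Sum>v\<in>B. h u v)"
      if "i \<in> J" "j \<in> J" "i \<noteq> j" "A \<subseteq> S' i" "B \<subseteq> S' j" for i j A B
      using that by (intro insert.prems(4)[of i j]) (auto simp: S'_def)
    have "2 * k + 4 * card (insert a J) + 3 = 2 * (k + 2) + 4 * card J + 3" unfolding cJ by simp
    then show "e \<le> \<theta> ^ (2 * (k + 2) + 4 * card J + 3)" using insert.prems(5) by metis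
  qed (use S' in auto)
  then obtain f where f: "\<And>i. i \<in> J \<Longrightarrow> f i \<in> S' i" "\<And>i j. i \<in> J \<Longrightarrow> j \<in> J \<Longrightarrow> i \<noteq> j \<Longrightarrow> h (f i) (f j) = 1"
    by blast
  have hv: "h v (f i) = 1" "h (f i) v = 1" if "i \<in> J" for i
    using f(1)[OF that] subD(2)[OF h, of v "f i"] by (auto simp: S'_def)
  show ?case
  proof (intro exI[of _ "f(a := v)"] ballI conjI impI)
    fix i assume i: "i \<in> insert a J"
    show "(f(a := v)) i \<in> S i" using i v(1) f(1) by (auto simp: S'_def)
    fix j assume "j \<in> insert a J" "i \<noteq> j"
    then show "h ((f(a := v)) i) ((f(a := v)) j) = 1" using i f(2) hv by auto
  qed
qed

text \<open>Greedy: the m + 1 pairs chosen so far cover 2 (m + 1) vertices, each of which meets at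
  most 2 d ordered pairs of \<open>R\<close>. Distinctness of the concatenated list expresses that
  the chosen pairs are vertex-disjoint.\<close>

lemma matching_exists:
  assumes R: "\<And>x y. R x y \<in> {0, 1 :: real}" "\<And>x y. R x y = R y x" "\<And>x. R x x = 0"
    and deg: "\<And>x. x \<in> V \<Longrightarrow> (\<Sum>y\<in>V. R x y) \<le> d" and big: "4 * d * real m < (\<Sum>x\<in>V. \<Sum>y\<in>V. R x y)"
  shows "\<exists>L. length L = Suc m \<and> distinct (concat (map (\<lambda>(x, y). [x, y]) L)) \<and>
     (\<forall>(x, y)\<in>set L. x \<in> V \<and> y \<in> V \<and> R x y = 1)"
  using big
proof (induction m)
  case 0
  have "\<exists>x\<in>V. \<exists>y\<in>V. R x y \<noteq> 0"
  proof (rule ccontr)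
    assume "\<not> ?thesis"
    then have "(\<Sum>x\<in>V. \<Sum>y\<in>V. R x y) = 0" by simp
    then show False using 0 by simp
  qed
  then obtain x y where "x \<in> V" "y \<in> V" "R x y = 1" using R(1) by blast
  moreover have "x \<noteq> y" using calculation R(3)[of x] by auto
  ultimately show ?case by (intro exI[of _ "[(x, y)]"]) auto
next
  case (Suc m)
  have d0: "0 \<le> d"
  proof -
    obtain x where "x \<in> V" using V_nonempty by blast
    moreover have "0 \<le> (\<Sum>y\<in>V. R x y)" using R(1) by (intro sum_nonneg) (metis empty_iff insert_iff order_refl zero_le_one)
    ultimately show ?thesis using deg by force
  qed
  then have "4 * d * real m \<le> 4 * d * real (Suc m)" by (intro mult_left_mono) auto
  then have "4 * d * real m < (\<Sum>x\<in>V. \<Sum>y\<in>V. R x y)" using Suc.prems by linarith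
  from Suc.IH[OF this] obtain L where L: "length L = Suc m" "distinct (concat (map (\<lambda>(x, y). [x, y]) L))"
    and L3: "\<forall>(x, y)\<in>set L. x \<in> V \<and> y \<in> V \<and> R x y = 1"
    by (elim exE conjE) rule
  define U where "U = set (concat (map (\<lambda>(x, y). [x, y]) L))"
  have lenc: "length (concat (map (\<lambda>(x, y). [x, y]) L')) = 2 * length L'" for L' :: "('a \<times> 'a) list"
    by (induction L') auto
  have U: "U \<subseteq> V" using L3 by (fastforce simp: U_def)
  have "card U \<le> 2 * Suc m" unfolding U_def using card_length lenc L(1) by metis
  then have "d * real (card U) \<le> d * (2 * real (Suc m))" using d0 by (intro mult_left_mono) auto
  then have cU: "4 * d * real (Suc m) \<ge> 2 * (d * real (card U))" by (simp add: algebra_simps)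
  have "\<exists>x\<in>V - U. \<exists>y\<in>V - U. R x y \<noteq> 0"
  proof (rule ccontr)
    assume neg: "\<not> ?thesis"
    have "(\<Sum>x\<in>V. \<Sum>y\<in>V. R x y) \<le> (\<Sum>x\<in>V. \<Sum>y\<in>V. of_bool (x \<in> U) * R x y + of_bool (y \<in> U) * R y x)"
    proof (intro sum_mono)
      fix x y assume xy: "x \<in> V" "y \<in> V"
      have "0 \<le> R x y" "0 \<le> R y x" using R(1)[of x y] R(1)[of y x] by auto
      moreover have "R x y = 0" if "x \<notin> U" "y \<notin> U" using neg xy that by blast
      ultimately show "R x y \<le> of_bool (x \<in> U) * R x y + of_bool (y \<in> U) * R y x"
        using R(2)[of x y] by (cases "x \<in> U"; cases "y \<in> U") auto
    qed
    also have "\<dots> = 2 * (\<Sum>x\<in>V. of_bool (x \<in> U) * (\<Sum>y\<in>V. R x y))"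
      unfolding sum.distrib by (subst (2) sum.swap) (simp add: sum_distrib_left)
    also have "\<dots> = 2 * (\<Sum>x\<in>U. \<Sum>y\<in>V. R x y)" using sum_indicator[OF U] by simp
    also have "\<dots> \<le> 2 * (\<Sum>x\<in>U. d)" using deg U by (intro mult_left_mono sum_mono) auto
    also have "\<dots> \<le> 4 * d * real (Suc m)" using cU by (simp add: mult_ac)
    finally show False using Suc.prems by simp
  qed
  then obtain x y where xy: "x \<in> V - U" "y \<in> V - U" "R x y = 1" using R(1) by blast
  then have ne: "x \<noteq> y" using R(3)[of x] by auto
  have "x \<notin> U" "y \<notin> U" using xy by auto
  then have "distinct (concat (map (\<lambda>(x, y). [x, y]) ((x, y) # L)))"
    using L(2) ne unfolding U_def by simp
  moreover have "\<forall>(x, y)\<in>set ((x, y) # L). x \<in> V \<and> y \<in> V \<and> R x y = 1" using L3 xy by simp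
  ultimately show ?case using L(1) by (intro exI[of _ "(x, y) # L"]) simp
qed

text \<open>The property of the random graph used besides the discrepancy condition: a balanced
  colouring with m \<ge> 1 disjoint monochromatic atypical pairs has a cut more than m \<theta>^6 n
  edges below the maximum. In an entry (x, y, i), i is a class containing few common neighbours of x
  and y. With at most n / (16 r) pairs, most of every class lies outside the pairs.\<close>

definition typical :: "nat \<Rightarrow> bool" where
  "typical r \<longleftrightarrow> (\<forall>\<pi>\<in>V \<rightarrow>\<^sub>E {..<r}. \<forall>D.
     (\<forall>i<r. n / (2 * real r) \<le> real (card {v \<in> V. \<pi> v = i})) \<and> D \<noteq> [] \<and> 16 * real r * real (length D) \<le> n \<and>
     distinct (concat (map (\<lambda>(x, y, i). [x, y]) D)) \<and>
     (\<forall>(x, y, i)\<in>set D. x \<in> V \<and> y \<in> V \<and> \<pi> x = \<pi> y \<and> i < r \<and> i \<noteq> \<pi> x \<and>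
        (\<Sum>z\<in>V. of_bool (\<pi> z = i) * (g x z * g y z)) < \<theta> ^ 3 * n) \<longrightarrow>
     (\<exists>\<pi>'\<in>V \<rightarrow>\<^sub>E {..<r}. cross g \<pi> + 2 * real (length D) * \<theta> ^ 6 * n < cross g \<pi>'))"

lemma double_indicator:
  assumes "A \<subseteq> V" "B \<subseteq> V"
  shows "(\<Sum>u\<in>V. \<Sum>v\<in>V. of_bool (u \<in> A) * of_bool (v \<in> B) * F u v) = (\<Sum>u\<in>A. \<Sum>v\<in>B. F u v :: real)"
proof -
  have "(\<Sum>u\<in>V. \<Sum>v\<in>V. of_bool (u \<in> A) * of_bool (v \<in> B) * F u v) =
      (\<Sum>u\<in>V. of_bool (u \<in> A) * (\<Sum>v\<in>V. of_bool (v \<in> B) * F u v))"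
    by (simp only: sum_distrib_left mult.assoc)
  then show ?thesis by (simp only: sum_indicator assms)
qed

text \<open>Between two classes of \<pi>, \<open>h\<close> differs from \<open>g\<close> only by
  missing cut edges, so it inherits the lower bound on the number of edges up to their total
  number.\<close>

lemma cross_density:
  assumes h: "sub h" and A: "A \<subseteq> {v \<in> V. \<pi> v = i}" and B: "B \<subseteq> {v \<in> V. \<pi> v = j}" and ij: "i \<noteq> j"
    and e: "\<delta> * n ^ 2 + cross (co h) \<pi> \<le> e * n ^ 2"
  shows "p * real (card A) * real (card B) - e * n ^ 2 \<le> (\<Sum>u\<in>A. \<Sum>v\<in>B. h u v)"
proof -
  have AB: "A \<subseteq> V" "B \<subseteq> V" using A B by auto
  have c: "(\<Sum>u\<in>V. of_bool (u \<in> A)) = real (card A)" "(\<Sum>u\<in>V. of_bool (u \<in> B)) = real (card B)"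
    using sum_indicator[OF AB(1), of "\<lambda>_. 1"] sum_indicator[OF AB(2), of "\<lambda>_. 1"] by (simp_all only: mult_1_right) simp_all
  have "p * real (card A) * real (card B) - \<delta> * n ^ 2 \<le> (\<Sum>u\<in>A. \<Sum>v\<in>B. g u v)"
    using edge_count(2)[of "\<lambda>u. of_bool (u \<in> A)" "\<lambda>u. of_bool (u \<in> B)"]
    unfolding double_indicator[OF AB] c by simp
  also have "(\<Sum>u\<in>A. \<Sum>v\<in>B. g u v) = (\<Sum>u\<in>A. \<Sum>v\<in>B. h u v) + (\<Sum>u\<in>A. \<Sum>v\<in>B. co h u v)"
    by (simp add: co_def sum_subtractf)
  also have "(\<Sum>u\<in>A. \<Sum>v\<in>B. co h u v) \<le> cross (co h) \<pi>"
    unfolding cross_def double_indicator[OF AB, symmetric]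
    using A B ij coD(3)[OF h] by (intro sum_mono mult_right_mono) (auto simp: of_bool_def)
  finally show ?thesis using e by linarith
qed

text \<open>By discrepancy the classes contain at least p times the sum of their squared sizes, up
  to r \<delta> n^2, in ordered pairs of adjacent vertices. A cut close to (1 - 1/r) p n^2 therefore
  forces the class sizes to have small variance.\<close>

lemma balanced_if_large_cut:
  assumes \<pi>: "\<pi> \<in> V \<rightarrow>\<^sub>E {..<r}" and r: "r \<ge> 2" "32 * real r * \<theta> \<le> 1"
    and cut: "(1 - 1 / real r) * p * n ^ 2 - \<theta> ^ 5 * n ^ 2 \<le> cross g \<pi>" and del: "\<delta> \<le> \<theta> ^ 6"
    and i: "i < r"
  shows "n / (2 * real r) \<le> real (card {v \<in> V. \<pi> v = i})"
proof -
  have n0: "n > 0" using n_ge_1 by simp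
  define s where "s i = (\<Sum>v\<in>V. of_bool (\<pi> v = i) :: real)" for i
  have ssum: "(\<Sum>i<r. s i) = n"
  proof -
    have "(\<Sum>i<r. s i) = (\<Sum>v\<in>V. \<Sum>i<r. of_bool (\<pi> v = i))" unfolding s_def by (rule sum.swap)
    also have "\<dots> = (\<Sum>v\<in>V. 1)" by (intro sum.cong refl sum_colours[OF \<pi>])
    finally show ?thesis by simp
  qed
  have "(\<Sum>i<r. p * s i * s i - \<delta> * n ^ 2) \<le> (\<Sum>i<r. \<Sum>u\<in>V. \<Sum>v\<in>V. of_bool (\<pi> u = i) * of_bool (\<pi> v = i) * g u v)"
    unfolding s_def by (intro sum_mono edge_count(2)) auto
  also have "\<dots> = (\<Sum>u\<in>V. \<Sum>i<r. \<Sum>v\<in>V. of_bool (\<pi> u = i) * of_bool (\<pi> v = i) * g u v)" by (rule sum.swap)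
  also have "\<dots> = (\<Sum>u\<in>V. \<Sum>v\<in>V. \<Sum>i<r. of_bool (\<pi> u = i) * of_bool (\<pi> v = i) * g u v)"
    by (intro sum.cong refl sum.swap)
  also have "\<dots> = inside g \<pi>"
    unfolding inside_def
  proof (intro sum.cong refl)
    fix u v assume uv: "u \<in> V" "v \<in> V"
    have "(\<Sum>i<r. of_bool (\<pi> u = i) * of_bool (\<pi> v = i) * g u v) = (\<Sum>i<r. of_bool (\<pi> u = i) * (of_bool (\<pi> u = \<pi> v) * g u v))"
      by (intro sum.cong refl) (auto simp: of_bool_def)
    also have "\<dots> = (\<Sum>i<r. of_bool (\<pi> u = i)) * (of_bool (\<pi> u = \<pi> v) * g u v)" by (rule sum_distrib_right[symmetric])
    finally show "(\<Sum>i<r. of_bool (\<pi> u = i) * of_bool (\<pi> v = i) * g u v) = of_bool (\<pi> u = \<pi> v) * g u v"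
      using sum_colours[OF \<pi> uv(1)] by simp
  qed
  finally have "p * (\<Sum>i<r. s i ^ 2) - real r * \<delta> * n ^ 2 \<le> inside g \<pi>"
    by (simp add: sum_subtractf sum_distrib_left power2_eq_square mult.assoc)
  moreover have "(\<Sum>x\<in>V. deg g x) \<le> (p + \<delta>) * n ^ 2"
    using edge_count(1)[of "\<lambda>_. 1" "\<lambda>_. 1"] by (simp add: deg_def algebra_simps power2_eq_square)
  ultimately have "p * (\<Sum>i<r. s i ^ 2) \<le> (p + \<delta>) * n ^ 2 + real r * \<delta> * n ^ 2 - cross g \<pi>"
    using cross_add_inside[of g \<pi>] by linarith
  also have "\<dots> \<le> p * n ^ 2 / real r + ((real r + 1) * \<delta> + \<theta> ^ 5) * n ^ 2"
    using cut by (simp add: algebra_simps)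
  also have "\<dots> \<le> p * n ^ 2 / real r + 2 * \<theta> ^ 5 * n ^ 2"
  proof -
    have "(real r + 1) * \<delta> \<le> (2 * real r) * \<theta> ^ 6" using r del delta_nonneg by (intro mult_mono) auto
    also have "\<dots> = (2 * real r * \<theta>) * \<theta> ^ 5" by (simp add: eval_nat_numeral)
    also have "\<dots> \<le> 1 * \<theta> ^ 5" using r theta_pos by (intro mult_right_mono) auto
    finally have "((real r + 1) * \<delta> + \<theta> ^ 5) * n ^ 2 \<le> (2 * \<theta> ^ 5) * n ^ 2" by (intro mult_right_mono) auto
    then show ?thesis by simp
  qed
  finally have "p * ((\<Sum>i<r. s i ^ 2) - n ^ 2 / real r) \<le> 2 * \<theta> ^ 5 * n ^ 2" by (simp add: algebra_simps)
  moreover have "(\<Sum>i<r. s i ^ 2) - n ^ 2 / real r = (\<Sum>i<r. (s i - n / real r) ^ 2)"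
  proof -
    have "(\<Sum>i<r. (s i - n / real r) ^ 2) = (\<Sum>i<r. s i ^ 2 - 2 * (n / real r) * s i + (n / real r) ^ 2)"
      by (intro sum.cong refl) (simp add: power2_diff)
    also have "\<dots> = (\<Sum>i<r. s i ^ 2) - 2 * (n / real r) * (\<Sum>i<r. s i) + real r * (n / real r) ^ 2"
      unfolding sum.distrib sum_subtractf sum_distrib_left[symmetric] by simp
    also have "\<dots> = (\<Sum>i<r. s i ^ 2) - n ^ 2 / real r"
      unfolding ssum using r by (simp add: field_simps power2_eq_square)
    finally show ?thesis by simp
  qed
  ultimately have "p * (\<Sum>i<r. (s i - n / real r) ^ 2) \<le> 2 * \<theta> ^ 5 * n ^ 2" by simp
  moreover have "\<theta> * (s i - n / real r) ^ 2 \<le> p * (\<Sum>i<r. (s i - n / real r) ^ 2)"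
    using i theta_le_p p_pos theta_pos by (intro mult_mono member_le_sum) auto
  ultimately have "\<theta> * (s i - n / real r) ^ 2 \<le> \<theta> * (2 * \<theta> ^ 4 * n ^ 2)" by (simp add: eval_nat_numeral)
  then have "(s i - n / real r) ^ 2 \<le> 2 * \<theta> ^ 4 * n ^ 2" using theta_pos by (simp only: mult_le_cancel_left_pos)
  also have "\<dots> \<le> (2 * \<theta> ^ 2 * n) ^ 2" by (simp add: power_mult_distrib flip: power_mult)
  finally have sq: "(s i - n / real r) ^ 2 \<le> (2 * \<theta> ^ 2 * n) ^ 2" .
  have "\<bar>s i - n / real r\<bar> \<le> 2 * \<theta> ^ 2 * n"
    using sq by (rule power2_le_iff_abs_le[THEN iffD1, rotated]) (use theta_pos in simp)
  moreover have "2 * \<theta> ^ 2 * n \<le> n / (2 * real r)"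
  proof -
    have "(4 * real r * \<theta>) * \<theta> \<le> 1 * 1" using r theta_pos theta_le_1 by (intro mult_mono) auto
    then have "(4 * real r * \<theta> * \<theta>) * n \<le> 1 * n" by (intro mult_right_mono) auto
    then show ?thesis using r by (simp add: field_simps power2_eq_square)
  qed
  moreover have "n / real r = n / (2 * real r) + n / (2 * real r)" using r by (simp add: field_simps)
  moreover have "s i = real (card {v \<in> V. \<pi> v = i})"
    using sum_indicator[of "{v \<in> V. \<pi> v = i}" "\<lambda>_. 1"] unfolding s_def by (simp add: of_bool_def)
  ultimately show ?thesis by linarith
qed

lemma degree_cut_colour:
  assumes "sub h"
  shows "(\<Sum>v\<in>V. of_bool (\<pi> v = i) * h x v) = real (card {v \<in> V. \<pi> v = i \<and> h x v = 1})"
proof -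
  have "(\<Sum>v\<in>V. of_bool (\<pi> v = i) * h x v) = (\<Sum>v\<in>V. of_bool (v \<in> {v \<in> V. \<pi> v = i \<and> h x v = 1}) * 1)"
    using subD(1)[OF assms, of x] by (intro sum.cong refl) (force simp: of_bool_def)
  also have "\<dots> = (\<Sum>v\<in>{v \<in> V. \<pi> v = i \<and> h x v = 1}. 1)" by (rule sum_indicator) auto
  finally show ?thesis by simp
qed

text \<open>\<open>Bo\<close> stands for the monochromatic edges of \<open>h\<close>,
  \<open>Mo\<close> for the cut edges of \<open>g\<close> missing in \<open>h\<close>,
  \<open>Bat\<close> for the atypical monochromatic edges. Maximality gives \<open>Mo\<close> \<le>
  \<open>Bo\<close>. A monochromatic edge that is not atypical is charged to an end missing
  \<theta>^4 n cut edges; monochromatic degrees are at most \<theta>^7 n, so these edges number at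
  most a constant times \<theta>^3 \<open>Mo\<close>, and \<open>Bo\<close> \<le> 2
  \<open>Bat\<close>. If \<open>Bat\<close> were positive, m disjoint atypical edges with
  \<open>Bat\<close> \<le> m \<theta>^6 n would yield, by \<open>typical\<close>, a cut with more
  edges than \<open>h\<close>.\<close>

lemma exact_structure:
  assumes r: "r \<ge> 2" "32 * real r * \<theta> \<le> 1" "32 * real r \<le> n"
    and j: "j = 4 * r + 18" and J: "J = 3 ^ r * (j + 13) + 1"
    and del: "\<delta> \<le> \<theta> ^ (2 ^ (r + 1) * (J + 3))"
    and ty: "typical r" and h: "sub h" and free: "kfree (Suc r) h"
    and max: "\<And>\<pi>. \<pi> \<in> V \<rightarrow>\<^sub>E {..<r} \<Longrightarrow> cross g \<pi> \<le> (\<Sum>x\<in>V. deg h x)"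
  shows "\<exists>\<pi>\<in>V \<rightarrow>\<^sub>E {..<r}. inside h \<pi> = 0"
proof -
  have n0: "n > 0" using n_ge_1 by simp
  note h01 = subD(1)[OF h] and k0 = coD(3)[OF h] and h0 = subD(6)[OF h]
  define K where "K = 2 * J + 3"
  have "1 * (2 * J + 3) \<le> 2 ^ r * (2 * J + 6)" by (intro mult_mono) auto
  then have "K \<le> 2 ^ (r + 1) * (J + 3)" by (simp add: K_def algebra_simps)
  then have dK: "\<delta> \<le> \<theta> ^ K" using del theta_mono by (meson order_trans)
  have "1 * (j + 13) \<le> 3 ^ r * (j + 13)" by (intro mult_right_mono) auto
  also have "\<dots> \<le> K" unfolding K_def J by (rule order_trans[OF _ le_add1]) simp
  finally have jK: "j + 1 \<le> K" by simp
  have dj: "\<delta> \<le> \<theta> ^ j" using dK theta_mono[of j K] jK by simp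
  obtain c where c: "c = (\<Sum>x\<in>V. deg h x)" by simp
  have "(1 - 1 / real r) * (p - \<delta>) * n ^ 2 \<le> c"
    using max_cut_large[of r] max r unfolding c by (meson le_trans not_less order_trans one_le_numeral)
  moreover have "(1 - 1 / real r) * \<delta> * n ^ 2 \<le> 1 * \<theta> ^ K * n ^ 2"
    using r dK delta_nonneg by (intro mult_right_mono mult_mono) auto
  ultimately have cK: "(1 - 1 / real r) * p * n ^ 2 - \<theta> ^ K * n ^ 2 \<le> c"
    by (simp add: algebra_simps diff_divide_distrib)
  have r4: "4 * real r * \<theta> \<le> 1" using r theta_pos mult_right_mono[of 4 32 "real r * \<theta>"] by simp
  obtain col where col: "\<And>v. col v < r" "inside h col \<le> \<theta> ^ j * n ^ 2"
    using stability[OF r(1) r4 J del h free] cK unfolding inside_def K_def c by blast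
  obtain \<pi> where \<pi>: "\<pi> \<in> V \<rightarrow>\<^sub>E {..<r}" and opt: "\<And>\<pi>'. \<pi>' \<in> V \<rightarrow>\<^sub>E {..<r} \<Longrightarrow> cross h \<pi>' \<le> cross h \<pi>"
    using max_cut_exists[of r h] r by (metis One_nat_def Suc_leD numeral_2_eq_2)
  have "restrict col V \<in> V \<rightarrow>\<^sub>E {..<r}" using col by auto
  moreover have "cross h (restrict col V) = cross h col" unfolding cross_def by (intro sum.cong refl) auto
  ultimately have "cross h col \<le> cross h \<pi>" using opt by metis
  define Bo where "Bo = inside h \<pi>"
  define Mo where "Mo = cross (co h) \<pi>"
  have Bo_le: "Bo \<le> \<theta> ^ j * n ^ 2"
    using cross_add_inside[of h \<pi>] cross_add_inside[of h col] \<open>cross h col \<le> cross h \<pi>\<close> col(2)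
    unfolding Bo_def by linarith
  have Bo0: "0 \<le> Bo" unfolding Bo_def inside_def using h0 by (intro sum_nonneg) auto
  have gM: "cross g \<pi> = cross h \<pi> + Mo"
    unfolding cross_def Mo_def sum.distrib[symmetric] by (intro sum.cong refl) (simp add: co_def algebra_simps)
  have cB: "cross h \<pi> + Bo = c" using cross_add_inside[of h \<pi>] by (simp add: Bo_def c)
  \<comment> \<open>The sum c is at least cross g \<pi> = cross h \<pi> + \<open>Mo\<close>, and it
    equals cross h \<pi> + \<open>Bo\<close>.\<close>
  have MB: "Mo \<le> Bo" using max[OF \<pi>] gM cB c by linarith
  have Mo0: "0 \<le> Mo" unfolding Mo_def cross_def using k0 by (intro sum_nonneg) auto
  have bal: "n / (2 * real r) \<le> real (card {v \<in> V. \<pi> v = i})" if "i < r" for i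
  proof (rule balanced_if_large_cut[OF \<pi> r(1,2) _ _ that])
    have "\<theta> ^ K * n ^ 2 + \<theta> ^ j * n ^ 2 \<le> \<theta> ^ 6 * n ^ 2 + \<theta> ^ 6 * n ^ 2"
      using jK by (intro add_mono mult_right_mono theta_mono) (auto simp: j)
    also have "\<dots> = (2 * \<theta>) * (\<theta> ^ 5 * n ^ 2)" by (simp add: eval_nat_numeral)
    also have "\<dots> \<le> 1 * (\<theta> ^ 5 * n ^ 2)" using theta_le theta_pos by (intro mult_right_mono) auto
    finally show "(1 - 1 / real r) * p * n ^ 2 - \<theta> ^ 5 * n ^ 2 \<le> cross g \<pi>"
      using cK Bo_le cB gM Mo0 by linarith
    show "\<delta> \<le> \<theta> ^ 6" using dj theta_mono[of 6 j] by (simp add: j)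
  qed
  \<comment> \<open>\<open>transversal_clique\<close> with k = 7 and at most r classes asks for the
    exponent 2 * 7 + 4 r + 3 = 4 r + 17; j has one power more, which absorbs the factor 2 in
    \<open>ee\<close>.\<close>
  define e where "e = \<theta> ^ (4 * r + 17)"
  have ee: "\<delta> * n ^ 2 + cross (co h) \<pi> \<le> e * n ^ 2"
  proof -
    have "\<delta> * n ^ 2 + cross (co h) \<pi> \<le> \<theta> ^ j * n ^ 2 + \<theta> ^ j * n ^ 2"
      using mult_right_mono[OF dj, of "n ^ 2"] MB Bo_le unfolding Mo_def by simp
    also have "\<dots> = (2 * \<theta>) * (e * n ^ 2)" by (simp add: j e_def eval_nat_numeral)
    also have "\<dots> \<le> 1 * (e * n ^ 2)" using theta_le theta_pos by (intro mult_right_mono) (auto simp: e_def)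
    finally show ?thesis by simp
  qed
  have clique: "\<exists>f. \<forall>i\<in>I. f i \<in> S i \<and> (\<forall>j\<in>I. i \<noteq> j \<longrightarrow> h (f i) (f j) = 1)"
    if I: "I \<subseteq> {..<r}" and S: "\<And>i. i \<in> I \<Longrightarrow> S i \<subseteq> {v \<in> V. \<pi> v = i} \<and> \<theta> ^ 7 * n \<le> real (card (S i))"
    for I :: "nat set" and S
  proof (rule transversal_clique[OF _ h])
    show finI: "finite I" using I finite_subset by blast
    have cI: "card I \<le> r" using card_mono[OF _ I] by simp
    have "4 * real (card I) * \<theta> \<le> 4 * real r * \<theta>" using cI theta_pos by (intro mult_right_mono) auto
    then show "4 * real (card I) * \<theta> \<le> 1" using r4 by linarith
    show "e \<le> \<theta> ^ (2 * 7 + 4 * card I + 3)" unfolding e_def using cI by (intro theta_mono) simp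
    fix i j A B assume "i \<in> I" "j \<in> I" "i \<noteq> j" "A \<subseteq> S i" "B \<subseteq> S j"
    then show "p * real (card A) * real (card B) - e * n ^ 2 \<le> (\<Sum>u\<in>A. \<Sum>v\<in>B. h u v)"
      using S by (intro cross_density[OF h _ _ _ ee, of A i B j]) blast+
  qed (use S in auto)
  define dB where "dB x = (\<Sum>v\<in>V. of_bool (\<pi> v = \<pi> x) * h x v)" for x
  define dM where "dM x = (\<Sum>v\<in>V. of_bool (\<pi> x \<noteq> \<pi> v) * co h x v)" for x
  have dB0: "0 \<le> dB x" for x unfolding dB_def using h0 by (intro sum_nonneg) auto
  have dM0: "0 \<le> dM x" for x unfolding dM_def using k0 by (intro sum_nonneg) auto
  have Bo_sum: "Bo = (\<Sum>x\<in>V. dB x)" unfolding Bo_def inside_def dB_def by (simp add: eq_commute)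
  have Mo_sum: "Mo = (\<Sum>x\<in>V. dM x)" unfolding Mo_def cross_def dM_def by simp
  \<comment> \<open>If x had \<theta>^7 n neighbours in every class, a transversal clique among them
    would extend by x to r + 1 vertices. So some class has fewer, and by local optimality so has the
    class of x.\<close>
  have dB_le: "dB x \<le> \<theta> ^ 7 * n" if x: "x \<in> V" for x
  proof -
    define S where "S i = {v \<in> V. \<pi> v = i \<and> h x v = 1}" for i
    have "\<exists>i<r. real (card (S i)) < \<theta> ^ 7 * n"
    proof (rule ccontr)
      assume neg: "\<not> ?thesis"
      have big: "\<theta> ^ 7 * n \<le> real (card (S i))" if "i < r" for i using neg that not_less by blast
      have "\<exists>f. \<forall>i\<in>{..<r}. f i \<in> S i \<and> (\<forall>j\<in>{..<r}. i \<noteq> j \<longrightarrow> h (f i) (f j) = 1)"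
      proof (rule clique)
        show "S i \<subseteq> {v \<in> V. \<pi> v = i} \<and> \<theta> ^ 7 * n \<le> real (card (S i))" if "i \<in> {..<r}" for i
          using big that by (auto simp: S_def)
      qed simp
      then obtain f where f: "\<And>i. i < r \<Longrightarrow> f i \<in> S i" "\<And>i j. i < r \<Longrightarrow> j < r \<Longrightarrow> i \<noteq> j \<Longrightarrow> h (f i) (f j) = 1" by blast
      have pf: "\<pi> (f i) = i" "h x (f i) = 1" if "i < r" for i using f(1)[OF that] by (auto simp: S_def)
      have inj: "inj_on f {..<r}" using pf(1) by (intro inj_onI) (metis lessThan_iff)
      have xf: "x \<notin> f ` {..<r}" using pf(2) subD(5)[OF h, of x] by force
      have "card (insert x (f ` {..<r})) = Suc r" using xf card_image[OF inj] by simp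
      moreover have "insert x (f ` {..<r}) \<subseteq> V" using f(1) x by (auto simp: S_def)
      moreover have "h x (f i) = 1" "h (f i) x = 1" if "i < r" for i
        using f(1)[OF that] subD(2)[OF h, of x "f i"] by (auto simp: S_def)
      then have "\<forall>u\<in>insert x (f ` {..<r}). \<forall>v\<in>insert x (f ` {..<r}). u \<noteq> v \<longrightarrow> h u v = 1"
        using f(2) by auto
      ultimately show False using free unfolding kfree_def by blast
    qed
    then obtain i where i: "i < r" "real (card (S i)) < \<theta> ^ 7 * n" by blast
    have "dB x \<le> (\<Sum>v\<in>V. of_bool (\<pi> v = i) * h x v)"
      unfolding dB_def by (rule max_cut_local[OF subD(2)[OF h] subD(5)[OF h] \<pi> opt x i(1)])
    also have "\<dots> = real (card (S i))" unfolding S_def by (rule degree_cut_colour[OF h])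
    finally show ?thesis using i(2) by linarith
  qed
  define At where "At x y \<longleftrightarrow> (\<exists>i<r. i \<noteq> \<pi> x \<and> (\<Sum>z\<in>V. of_bool (\<pi> z = i) * (g x z * g y z)) < \<theta> ^ 3 * n)" for x y
  \<comment> \<open>No transversal clique in the other r - 1 classes completes the edge, so some
    class i has fewer than \<theta>^7 n common \<open>h\<close>-neighbours of x and y. If the pair
    has \<theta>^3 n common \<open>g\<close>-neighbours there, all but \<theta>^7 n of them are lost
    to missing cut edges at x or at y.\<close>
  have bad_edge: "At x y \<or> \<theta> ^ 4 * n \<le> dM x \<or> \<theta> ^ 4 * n \<le> dM y"
    if xy: "x \<in> V" "y \<in> V" "\<pi> x = \<pi> y" "h x y = 1" for x y
  proof -
    define S where "S i = {v \<in> V. \<pi> v = i \<and> h x v = 1 \<and> h y v = 1}" for i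
    let ?I = "{..<r} - {\<pi> x}"
    have "\<exists>i\<in>?I. real (card (S i)) < \<theta> ^ 7 * n"
    proof (rule ccontr)
      assume neg: "\<not> ?thesis"
      have big: "\<theta> ^ 7 * n \<le> real (card (S i))" if "i \<in> ?I" for i using neg that not_less by blast
      have "\<exists>f. \<forall>i\<in>?I. f i \<in> S i \<and> (\<forall>j\<in>?I. i \<noteq> j \<longrightarrow> h (f i) (f j) = 1)"
      proof (rule clique)
        show "S i \<subseteq> {v \<in> V. \<pi> v = i} \<and> \<theta> ^ 7 * n \<le> real (card (S i))" if "i \<in> ?I" for i
          using big[OF that] by (auto simp: S_def)
      qed blast
      then obtain f where f: "\<And>i. i \<in> ?I \<Longrightarrow> f i \<in> S i" "\<And>i j. i \<in> ?I \<Longrightarrow> j \<in> ?I \<Longrightarrow> i \<noteq> j \<Longrightarrow> h (f i) (f j) = 1" by blast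
      have pf: "\<pi> (f i) = i" "h x (f i) = 1" "h y (f i) = 1" if "i \<in> ?I" for i
        using f(1)[OF that] by (auto simp: S_def)
      have inj: "inj_on f ?I" using pf(1) by (intro inj_onI) metis
      have xf: "x \<notin> f ` ?I" "y \<notin> f ` ?I" using pf(2,3) subD(5)[OF h, of x] subD(5)[OF h, of y] by force+
      have ne: "x \<noteq> y" using xy(4) subD(5)[OF h, of x] by auto
      have "\<pi> x \<in> {..<r}" using \<pi> xy(1) by auto
      then have "card ?I = r - 1" by simp
      then have "card (insert x (insert y (f ` ?I))) = Suc r" using xf ne card_image[OF inj] r by simp
      moreover have "insert x (insert y (f ` ?I)) \<subseteq> V" using f(1) xy by (auto simp: S_def)
      moreover have hh: "h x (f i) = 1" "h (f i) x = 1" "h y (f i) = 1" "h (f i) y = 1" if "i \<in> ?I" for i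
        using f(1)[OF that] subD(2)[OF h, of x "f i"] subD(2)[OF h, of y "f i"] by (auto simp: S_def)
      moreover have "h y x = 1" using xy(4) subD(2)[OF h, of x y] by simp
      then have "\<forall>u\<in>insert x (insert y (f ` ?I)). \<forall>v\<in>insert x (insert y (f ` ?I)). u \<noteq> v \<longrightarrow> h u v = 1"
        using f(2) hh xy(4) by (intro ballI impI) (elim insertE imageE; simp; metis)
      ultimately show False using free unfolding kfree_def by blast
    qed
    then obtain i where i: "i < r" "i \<noteq> \<pi> x" "real (card (S i)) < \<theta> ^ 7 * n" by blast
    have "(\<Sum>z\<in>V. of_bool (\<pi> z = i) * (g x z * g y z)) \<le>
       (\<Sum>z\<in>V. of_bool (z \<in> S i) * 1 + of_bool (\<pi> x \<noteq> \<pi> z) * co h x z + of_bool (\<pi> y \<noteq> \<pi> z) * co h y z)"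
    proof (rule sum_mono)
      fix z assume z: "z \<in> V"
      show "of_bool (\<pi> z = i) * (g x z * g y z) \<le>
         of_bool (z \<in> S i) * 1 + of_bool (\<pi> x \<noteq> \<pi> z) * co h x z + of_bool (\<pi> y \<noteq> \<pi> z) * co h y z"
      proof (cases "\<pi> z = i")
        case True
        then have ne: "\<pi> x \<noteq> \<pi> z" "\<pi> y \<noteq> \<pi> z" using i(2) xy(3) by auto
        have s: "of_bool (z \<in> S i) = h x z * h y z"
          using h01[of x z] h01[of y z] True z unfolding S_def by auto
        have "g x z * g y z \<le> h x z * h y z + co h x z + co h y z"
          using coD(5)[OF h, of x z] coD(5)[OF h, of y z] h01[of x z] h01[of y z]
            coD(1)[OF h, of x z] coD(1)[OF h, of y z] coD(6)[OF h, of x z] coD(6)[OF h, of y z] by auto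
        then show ?thesis using ne s True by simp
      next
        case False
        have "0 \<le> of_bool (z \<in> S i) * 1 + of_bool (\<pi> x \<noteq> \<pi> z) * co h x z + of_bool (\<pi> y \<noteq> \<pi> z) * co h y z"
          using k0 by (intro add_nonneg_nonneg mult_nonneg_nonneg) auto
        then show ?thesis using False by simp
      qed
    qed
    also have "\<dots> = real (card (S i)) + dM x + dM y"
    proof -
      have "(\<Sum>z\<in>V. of_bool (z \<in> S i) * 1) = real (card (S i))"
        by (subst sum_indicator) (auto simp: S_def)
      then show ?thesis unfolding dM_def sum.distrib by simp
    qed
    finally have le: "(\<Sum>z\<in>V. of_bool (\<pi> z = i) * (g x z * g y z)) \<le> \<theta> ^ 7 * n + dM x + dM y" using i(3) by linarith
    show ?thesis
    proof (cases "(\<Sum>z\<in>V. of_bool (\<pi> z = i) * (g x z * g y z)) < \<theta> ^ 3 * n")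
      case True
      then show ?thesis using i unfolding At_def by blast
    next
      case False
      have "\<theta> ^ 7 * n \<le> \<theta> ^ 4 * n" by (intro mult_right_mono theta_mono) auto
      moreover have "(3 * \<theta>) * (\<theta> ^ 3 * n) \<le> 1 * (\<theta> ^ 3 * n)" using theta_le theta_pos by (intro mult_right_mono) auto
      then have "3 * (\<theta> ^ 4 * n) \<le> \<theta> ^ 3 * n" by (simp add: eval_nat_numeral)
      ultimately show ?thesis using False le by linarith
    qed
  qed
  define R :: "'a \<Rightarrow> 'a \<Rightarrow> real" where "R x y = of_bool (x \<in> V \<and> y \<in> V \<and> \<pi> x = \<pi> y \<and> h x y = 1 \<and> (At x y \<or> At y x))" for x y
  have R01: "R x y \<in> {0, 1 :: real}" for x y unfolding R_def by (simp only: of_bool_def split: if_split) simp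
  have Rsym: "R x y = R y x" for x y using subD(2)[OF h, of x y] unfolding R_def by (auto simp: of_bool_def)
  have Rirr: "R x x = 0" for x using subD(5)[OF h, of x] by (simp add: R_def)
  define Bat where "Bat = (\<Sum>x\<in>V. \<Sum>y\<in>V. R x y)"
  have Bat: "Bo \<le> 2 * Bat"
  proof -
    let ?w = "\<lambda>x. of_bool (\<theta> ^ 4 * n \<le> dM x) :: real"
    have "Bo \<le> (\<Sum>x\<in>V. \<Sum>y\<in>V. R x y + ?w x * (of_bool (\<pi> y = \<pi> x) * h x y) + ?w y * (of_bool (\<pi> x = \<pi> y) * h y x))"
      unfolding Bo_def inside_def
    proof (intro sum_mono)
      fix x y assume xy: "x \<in> V" "y \<in> V"
      have pos: "0 \<le> R x y" "0 \<le> ?w x * (of_bool (\<pi> y = \<pi> x) * h x y)" "0 \<le> ?w y * (of_bool (\<pi> x = \<pi> y) * h y x)"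
        using h0 unfolding R_def by auto
      show "of_bool (\<pi> x = \<pi> y) * h x y \<le> R x y + ?w x * (of_bool (\<pi> y = \<pi> x) * h x y) + ?w y * (of_bool (\<pi> x = \<pi> y) * h y x)"
      proof (cases "\<pi> x = \<pi> y \<and> h x y = 1")
        case True
        then have "h y x = 1" using subD(2)[OF h, of x y] by simp
        then have "R x y = 1 \<or> ?w x * (of_bool (\<pi> y = \<pi> x) * h x y) = 1 \<or> ?w y * (of_bool (\<pi> x = \<pi> y) * h y x) = 1"
          using bad_edge[OF xy] True xy unfolding R_def by auto
        then show ?thesis using True pos by auto
      next
        case False
        then have "of_bool (\<pi> x = \<pi> y) * h x y = 0" using h01[of x y] by auto
        then show ?thesis using pos by linarith
      qed
    qed
    also have "\<dots> = Bat + (\<Sum>x\<in>V. \<Sum>y\<in>V. ?w x * (of_bool (\<pi> y = \<pi> x) * h x y)) + (\<Sum>x\<in>V. \<Sum>y\<in>V. ?w y * (of_bool (\<pi> x = \<pi> y) * h y x))"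
      unfolding Bat_def sum.distrib by simp
    also have "(\<Sum>x\<in>V. \<Sum>y\<in>V. ?w y * (of_bool (\<pi> x = \<pi> y) * h y x)) = (\<Sum>y\<in>V. \<Sum>x\<in>V. ?w y * (of_bool (\<pi> x = \<pi> y) * h y x))"
      by (rule sum.swap)
    also have "(\<Sum>x\<in>V. \<Sum>y\<in>V. ?w x * (of_bool (\<pi> y = \<pi> x) * h x y)) = (\<Sum>x\<in>V. ?w x * dB x)"
      unfolding dB_def sum_distrib_left ..
    finally have 1: "Bo \<le> Bat + 2 * (\<Sum>x\<in>V. ?w x * dB x)" by simp
    \<comment> \<open>Each x counted here has dB x \<le> \<theta>^7 n and dM x \<ge> \<theta>^4 n,
      hence dB x \<le> \<theta>^3 dM x.\<close>
    have "\<theta> ^ 4 * n * (\<Sum>x\<in>V. ?w x * dB x) \<le> (\<Sum>x\<in>V. \<theta> ^ 7 * n * dM x)"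
      unfolding sum_distrib_left
    proof (rule sum_mono)
      fix x assume x: "x \<in> V"
      show "\<theta> ^ 4 * n * (?w x * dB x) \<le> \<theta> ^ 7 * n * dM x"
      proof (cases "\<theta> ^ 4 * n \<le> dM x")
        case True
        then have "(\<theta> ^ 4 * n) * dB x \<le> dM x * (\<theta> ^ 7 * n)"
          using dB_le[OF x] dB0 dM0 by (intro mult_mono)
        then show ?thesis using True by (simp add: mult_ac)
      next
        case False
        then show ?thesis using dM0 theta_pos by simp
      qed
    qed
    also have "\<dots> = \<theta> ^ 4 * n * (\<theta> ^ 3 * Mo)"
      unfolding Mo_sum sum_distrib_left[symmetric] by (simp add: eval_nat_numeral)
    finally have "(\<Sum>x\<in>V. ?w x * dB x) \<le> \<theta> ^ 3 * Mo"
      using theta_pos n0 by (simp only: mult_le_cancel_left_pos mult_pos_pos zero_less_power)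
    also have "\<dots> \<le> 1 / 4 * Bo"
    proof (rule mult_mono)
      have "\<theta> ^ 3 \<le> \<theta> ^ 1" by (rule theta_mono) simp
      then show "\<theta> ^ 3 \<le> 1 / 4" using theta_le by simp
    qed (use MB Mo0 in auto)
    finally show ?thesis using 1 by linarith
  qed
  have "Bo = 0"
  proof (rule ccontr)
    assume "Bo \<noteq> 0"
    then have Batp: "0 < Bat" using Bo0 Bat by linarith
    define d where "d = \<theta> ^ 7 * n"
    have d0: "0 < d" using theta_pos n0 by (simp add: d_def)
    have Rdeg: "(\<Sum>y\<in>V. R x y) \<le> d" if x: "x \<in> V" for x
    proof -
      have "(\<Sum>y\<in>V. R x y) \<le> dB x" unfolding dB_def
        using h0 by (intro sum_mono) (auto simp: R_def of_bool_def)
      then show ?thesis using dB_le[OF x] unfolding d_def by linarith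
    qed
    define m0 where "m0 = nat \<lfloor>n / (16 * real r)\<rfloor>"
    have "2 \<le> n / (16 * real r)" using r by (simp add: field_simps)
    then have m0: "real m0 \<le> n / (16 * real r)" "n / (16 * real r) - 1 \<le> real m0" "1 \<le> m0"
      unfolding m0_def by linarith+
    have m0': "n / (32 * real r) \<le> real m0" using m0(2) \<open>2 \<le> n / (16 * real r)\<close> by (simp add: field_simps)
    \<comment> \<open>The largest m for which \<open>matching_exists\<close> applies below the cap
      m0 taken from \<open>typical\<close>. If the size of \<open>Bat\<close> stops it, then
      \<open>Bat\<close> \<le> 4 d (m + 1); if the cap does, the trivial bound \<open>Bat\<close>
      \<le> n d suffices, since m0 is of order n / r.\<close>
    define P where "P m \<longleftrightarrow> m < m0 \<and> 4 * d * real m < Bat" for m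
    have "P 0" using m0 Batp by (simp add: P_def)
    moreover have "\<And>m. P m \<Longrightarrow> m \<le> m0" by (simp add: P_def)
    ultimately obtain m where m: "P m" "\<And>k. P k \<Longrightarrow> k \<le> m" using Nat.ex_has_greatest_nat[of P 0 m0] by metis
    obtain L where L: "length L = Suc m" "distinct (concat (map (\<lambda>(x, y). [x, y]) L))"
      and L3: "\<forall>(x, y)\<in>set L. x \<in> V \<and> y \<in> V \<and> R x y = 1"
      using matching_exists[of R d m] R01 Rsym Rirr Rdeg m(1) unfolding P_def Bat_def by blast
    have small: "Bat \<le> real (Suc m) * \<theta> ^ 6 * n"
    proof (cases "Suc m < m0")
      case True
      then have "\<not> P (Suc m)" using m(2)[of "Suc m"] by auto
      then have "Bat \<le> 4 * d * real (Suc m)" using True by (simp add: P_def)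
      also have "\<dots> = (4 * \<theta>) * (real (Suc m) * \<theta> ^ 6 * n)" by (simp add: d_def eval_nat_numeral)
      also have "\<dots> \<le> 1 * (real (Suc m) * \<theta> ^ 6 * n)" using theta_le theta_pos by (intro mult_right_mono) auto
      finally show ?thesis by simp
    next
      case False
      then have sm: "Suc m = m0" using m(1) by (simp add: P_def)
      have "Bat \<le> (\<Sum>x\<in>V. d)" unfolding Bat_def using Rdeg by (rule sum_mono)
      also have "\<dots> = \<theta> * (\<theta> ^ 6 * n * n)" by (simp add: d_def eval_nat_numeral)
      also have "\<dots> \<le> 1 / (32 * real r) * (\<theta> ^ 6 * n * n)"
        using r theta_pos by (intro mult_right_mono) (auto simp: field_simps)
      also have "\<dots> = n / (32 * real r) * (\<theta> ^ 6 * n)" by simp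
      also have "\<dots> \<le> real m0 * (\<theta> ^ 6 * n)" using m0' theta_pos by (intro mult_right_mono) auto
      finally show ?thesis using sm by (simp add: mult.assoc)
    qed
    define ch where "ch x y = (SOME i. i < r \<and> i \<noteq> \<pi> x \<and> (\<Sum>z\<in>V. of_bool (\<pi> z = i) * (g x z * g y z)) < \<theta> ^ 3 * n)" for x y
    have gs: "(\<Sum>z\<in>V. of_bool (\<pi> z = i) * (g y z * g x z)) = (\<Sum>z\<in>V. of_bool (\<pi> z = i) * (g x z * g y z))" for i x y
      by (simp add: mult.commute)
    have ch: "ch x y < r \<and> ch x y \<noteq> \<pi> x \<and> (\<Sum>z\<in>V. of_bool (\<pi> z = ch x y) * (g x z * g y z)) < \<theta> ^ 3 * n"
      if "R x y = 1" for x y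
    proof -
      have "At x y \<or> At y x" "\<pi> x = \<pi> y" using that by (auto simp: R_def of_bool_def split: if_splits)
      then have "\<exists>i. i < r \<and> i \<noteq> \<pi> x \<and> (\<Sum>z\<in>V. of_bool (\<pi> z = i) * (g x z * g y z)) < \<theta> ^ 3 * n"
        unfolding At_def gs[of _ y x] by auto
      then show ?thesis unfolding ch_def by (rule someI_ex)
    qed
    define D where "D = map (\<lambda>(x, y). (x, y, ch x y)) L"
    have lenD: "length D = Suc m" by (simp add: D_def L)
    have "concat (map (\<lambda>(x, y, i). [x, y]) D) = concat (map (\<lambda>(x, y). [x, y]) L)"
      unfolding D_def by (induction L) auto
    then have distD: "distinct (concat (map (\<lambda>(x, y, i). [x, y]) D))" using L(2) by simp
    have "real (Suc m) \<le> real m0" using m(1) by (simp add: P_def)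
    then have "16 * real r * real (length D) \<le> 16 * real r * real m0"
      unfolding lenD by (intro mult_left_mono) auto
    also have "\<dots> \<le> n" using m0(1) r by (simp add: field_simps)
    finally have "16 * real r * real (length D) \<le> n" .
    moreover have "\<forall>(x, y, i)\<in>set D. x \<in> V \<and> y \<in> V \<and> \<pi> x = \<pi> y \<and> i < r \<and> i \<noteq> \<pi> x \<and>
        (\<Sum>z\<in>V. of_bool (\<pi> z = i) * (g x z * g y z)) < \<theta> ^ 3 * n"
    proof -
      have "x \<in> V \<and> y \<in> V \<and> \<pi> x = \<pi> y \<and> ch x y < r \<and> ch x y \<noteq> \<pi> x \<and>
        (\<Sum>z\<in>V. of_bool (\<pi> z = ch x y) * (g x z * g y z)) < \<theta> ^ 3 * n" if "(x, y) \<in> set L" for x y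
      proof -
        have "x \<in> V" "y \<in> V" "R x y = 1" using L3 that by auto
        moreover from this have "\<pi> x = \<pi> y" by (simp add: R_def of_bool_def split: if_splits)
        ultimately show ?thesis using ch by blast
      qed
      then show ?thesis unfolding D_def by auto
    qed
    moreover have "D \<noteq> []" using lenD by auto
    ultimately obtain \<pi>' where \<pi>': "\<pi>' \<in> V \<rightarrow>\<^sub>E {..<r}" "cross g \<pi> + 2 * real (length D) * \<theta> ^ 6 * n < cross g \<pi>'"
      using ty[unfolded typical_def, rule_format, OF \<pi>, of D] bal distD by blast
    have "cross g \<pi>' \<le> c" using max[OF \<pi>'(1)] c by simp
    also have "c \<le> cross g \<pi> + 2 * Bat" using cB gM Mo0 Bat by linarith
    also have "\<dots> \<le> cross g \<pi> + 2 * (real (length D) * \<theta> ^ 6 * n)" using small lenD by simp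
    finally show False using \<pi>'(2) by simp
  qed
  then show ?thesis using \<pi> unfolding Bo_def by blast
qed

end

section \<open>Random subsets of a finite set\<close>

text \<open>The expectation of f over a random subset of E that contains each element independently
  with probability p. As a finite sum it makes conditioning on one element an algebraic identity,
  \<open>bexp_insert\<close>, on which the inductions over E rest.\<close>

definition bexp :: "real \<Rightarrow> 'e set \<Rightarrow> ('e set \<Rightarrow> real) \<Rightarrow> real" where
  "bexp p E f = (\<Sum>X\<in>Pow E. p ^ card X * (1 - p) ^ card (E - X) * f X)"

lemma bexp_empty [simp]: "bexp p {} f = f {}"
  by (simp add: bexp_def)

lemma bexp_insert:
  assumes "finite E" "e \<notin> E"
  shows "bexp p (insert e E) f = p * bexp p E (\<lambda>X. f (insert e X)) + (1 - p) * bexp p E f"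
proof -
  have inj: "inj_on (insert e) (Pow E)" using assms by (auto simp: inj_on_def)
  have dis: "Pow E \<inter> insert e ` Pow E = {}" using assms by auto
  let ?w = "\<lambda>X. p ^ card X * (1 - p) ^ card (insert e E - X) * f X"
  have "bexp p (insert e E) f = (\<Sum>X\<in>Pow E. ?w X) + (\<Sum>X\<in>insert e ` Pow E. ?w X)"
    unfolding bexp_def Pow_insert using assms dis by (intro sum.union_disjoint) auto
  also have "(\<Sum>X\<in>insert e ` Pow E. ?w X) = (\<Sum>X\<in>Pow E. ?w (insert e X))"
    by (simp only: sum.reindex[OF inj] o_def)
  also have "\<dots> = p * bexp p E (\<lambda>X. f (insert e X))"
    unfolding bexp_def sum_distrib_left
  proof (rule sum.cong[OF refl])
    fix X assume X: "X \<in> Pow E"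
    have "finite X" using X assms finite_subset by auto
    moreover have "insert e E - insert e X = E - X" "e \<notin> X" using X assms by auto
    ultimately show "?w (insert e X) = p * (p ^ card X * (1 - p) ^ card (E - X) * f (insert e X))" by simp
  qed
  also have "(\<Sum>X\<in>Pow E. ?w X) = (1 - p) * bexp p E f"
    unfolding bexp_def sum_distrib_left
  proof (rule sum.cong[OF refl])
    fix X assume X: "X \<in> Pow E"
    have "insert e E - X = insert e (E - X)" "e \<notin> E - X" using X assms by auto
    then show "?w X = (1 - p) * (p ^ card X * (1 - p) ^ card (E - X) * f X)" using assms by simp
  qed
  finally show ?thesis by simp
qed

lemma bexp_remove:
  assumes "finite E" "e \<in> E"
  shows "bexp p E f = p * bexp p (E - {e}) (\<lambda>X. f (insert e X)) + (1 - p) * bexp p (E - {e}) f"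
  using bexp_insert[of "E - {e}" e p f] assms by (simp add: insert_absorb)

lemma bexp_cong: "(\<And>X. X \<subseteq> E \<Longrightarrow> f X = g X) \<Longrightarrow> bexp p E f = bexp p E g"
  unfolding bexp_def by (intro sum.cong) auto

lemma bexp_add: "bexp p E (\<lambda>X. f X + g X) = bexp p E f + bexp p E g"
  by (simp add: bexp_def distrib_left sum.distrib)

lemma bexp_diff: "bexp p E (\<lambda>X. f X - g X) = bexp p E f - bexp p E g"
  by (simp add: bexp_def right_diff_distrib sum_subtractf)

lemma bexp_cmult: "bexp p E (\<lambda>X. c * f X) = c * bexp p E f"
  by (simp add: bexp_def sum_distrib_left mult_ac)

lemma bexp_sum: "bexp p E (\<lambda>X. \<Sum>i\<in>I. f i X) = (\<Sum>i\<in>I. bexp p E (f i))"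
  unfolding bexp_def sum_distrib_left by (rule sum.swap)

lemma bexp_const: "finite E \<Longrightarrow> bexp p E (\<lambda>_. c) = c"
proof (induction E rule: finite_induct)
  case (insert e E)
  then show ?case by (simp add: bexp_insert algebra_simps)
qed simp

lemma bexp_mono:
  assumes "0 \<le> p" "p \<le> 1" "\<And>X. X \<subseteq> E \<Longrightarrow> f X \<le> g X"
  shows "bexp p E f \<le> bexp p E g"
  unfolding bexp_def using assms by (intro sum_mono mult_left_mono) auto

lemma bexp_nonneg:
  assumes "0 \<le> p" "p \<le> 1" "\<And>X. X \<subseteq> E \<Longrightarrow> 0 \<le> f X"
  shows "0 \<le> bexp p E f"
  unfolding bexp_def using assms by (intro sum_nonneg mult_nonneg_nonneg) auto

text \<open>Plain Harris does not apply below: the Gibbs weight of a colouring is monotone only in the edges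
  that it cuts.\<close>

lemma harris:
  assumes "finite E" and p: "0 \<le> p" "p \<le> 1"
    and "\<And>e. e \<in> E \<Longrightarrow>
      (\<forall>X\<subseteq>E - {e}. f X \<le> f (insert e X) \<and> g (insert e X) \<le> g X) \<or>
      (\<forall>X\<subseteq>E - {e}. g (insert e X) = g X) \<or> (\<forall>X\<subseteq>E - {e}. f (insert e X) = f X)"
  shows "bexp p E (\<lambda>X. f X * g X) \<le> bexp p E f * bexp p E g"
  using assms(1,4)
proof (induction E arbitrary: f g rule: finite_induct)
  case empty
  then show ?case by simp
next
  case (insert e E)
  let ?f1 = "\<lambda>X. f (insert e X)" and ?g1 = "\<lambda>X. g (insert e X)"
  define a0 a1 b0 b1 where "a0 = bexp p E f" and "a1 = bexp p E ?f1" and "b0 = bexp p E g" and "b1 = bexp p E ?g1"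
  have sub: "X \<subseteq> insert e E - {x}" "insert e X \<subseteq> insert e E - {x}" if "x \<in> E" "X \<subseteq> E - {x}" for x X
    using that insert.hyps by auto
  have 0: "bexp p E (\<lambda>X. f X * g X) \<le> a0 * b0" unfolding a0_def b0_def
  proof (rule insert.IH)
    fix x assume x: "x \<in> E"
    from insert.prems[OF insertI2[OF x]] show "(\<forall>X\<subseteq>E - {x}. f X \<le> f (insert x X) \<and> g (insert x X) \<le> g X) \<or>
      (\<forall>X\<subseteq>E - {x}. g (insert x X) = g X) \<or> (\<forall>X\<subseteq>E - {x}. f (insert x X) = f X)"
    proof (elim disjE)
      assume a: "\<forall>X\<subseteq>insert e E - {x}. f X \<le> f (insert x X) \<and> g (insert x X) \<le> g X"
      then show ?thesis using sub(1)[OF x] by simp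
    next
      assume a: "\<forall>X\<subseteq>insert e E - {x}. g (insert x X) = g X"
      then show ?thesis using sub(1)[OF x] by simp
    next
      assume a: "\<forall>X\<subseteq>insert e E - {x}. f (insert x X) = f X"
      then show ?thesis using sub(1)[OF x] by simp
    qed
  qed
  have 1: "bexp p E (\<lambda>X. ?f1 X * ?g1 X) \<le> a1 * b1" unfolding a1_def b1_def
  proof (rule insert.IH)
    fix x assume x: "x \<in> E"
    from insert.prems[OF insertI2[OF x]] show "(\<forall>X\<subseteq>E - {x}. ?f1 X \<le> ?f1 (insert x X) \<and> ?g1 (insert x X) \<le> ?g1 X) \<or>
      (\<forall>X\<subseteq>E - {x}. ?g1 (insert x X) = ?g1 X) \<or> (\<forall>X\<subseteq>E - {x}. ?f1 (insert x X) = ?f1 X)"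
    proof (elim disjE)
      assume a: "\<forall>X\<subseteq>insert e E - {x}. f X \<le> f (insert x X) \<and> g (insert x X) \<le> g X"
      then show ?thesis using sub(2)[OF x] unfolding insert_commute[of e x] by simp
    next
      assume a: "\<forall>X\<subseteq>insert e E - {x}. g (insert x X) = g X"
      then show ?thesis using sub(2)[OF x] unfolding insert_commute[of e x] by simp
    next
      assume a: "\<forall>X\<subseteq>insert e E - {x}. f (insert x X) = f X"
      then show ?thesis using sub(2)[OF x] unfolding insert_commute[of e x] by simp
    qed
  qed
  \<comment> \<open>The alternatives at e survive averaging over the remaining elements, so that (a1
    - a0) (b1 - b0) \<le> 0; this product is the covariance that e contributes.\<close>
  have alt: "(a0 \<le> a1 \<and> b1 \<le> b0) \<or> b1 = b0 \<or> a1 = a0"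
  proof -
    have E: "insert e E - {e} = E" using insert.hyps by auto
    consider "\<forall>X\<subseteq>E. f X \<le> ?f1 X \<and> ?g1 X \<le> g X" | "\<forall>X\<subseteq>E. ?g1 X = g X" | "\<forall>X\<subseteq>E. ?f1 X = f X"
      using insert.prems[of e] unfolding E by blast
    then show ?thesis
    proof cases
      case 1
      then show ?thesis unfolding a0_def a1_def b0_def b1_def using p by (intro disjI1 conjI bexp_mono) auto
    next
      case 2
      then have "b1 = b0" unfolding b0_def b1_def by (intro bexp_cong) auto
      then show ?thesis by simp
    next
      case 3
      then have "a1 = a0" unfolding a0_def a1_def by (intro bexp_cong) auto
      then show ?thesis by simp
    qed
  qed
  have "bexp p (insert e E) (\<lambda>X. f X * g X) = p * bexp p E (\<lambda>X. ?f1 X * ?g1 X) + (1 - p) * bexp p E (\<lambda>X. f X * g X)"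
    by (rule bexp_insert[OF insert.hyps])
  also have "\<dots> \<le> p * (a1 * b1) + (1 - p) * (a0 * b0)"
    using 0 1 p by (intro add_mono mult_left_mono) auto
  also have "\<dots> = (p * a1 + (1 - p) * a0) * (p * b1 + (1 - p) * b0) + p * (1 - p) * ((a1 - a0) * (b1 - b0))"
    by (simp add: algebra_simps)
  also have "p * (1 - p) * ((a1 - a0) * (b1 - b0)) \<le> p * (1 - p) * 0"
    using p alt by (intro mult_left_mono) (auto simp: mult_le_0_iff)
  finally show ?case
    unfolding a0_def a1_def b0_def b1_def by (simp add: bexp_insert[OF insert.hyps])
qed

section \<open>Exponential moments and deviation bounds\<close>

lemma exp_le_quadratic:
  assumes "\<bar>x\<bar> \<le> (1 :: real)"
  shows "exp x \<le> 1 + x + x ^ 2"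
proof (cases "x \<ge> 0")
  case True
  then show ?thesis using exp_bound[of x] assms by simp
next
  case False
  define y where "y = - x"
  have y: "0 \<le> y" "y \<le> 1" using False assms by (auto simp: y_def)
  have "1 + y \<le> exp y" by (rule exp_ge_add_one_self)
  then have "exp (- y) \<le> 1 / (1 + y)" using y by (simp add: exp_minus divide_inverse le_imp_inverse_le)
  also have "\<dots> \<le> 1 - y + y ^ 2"
  proof -
    have "1 \<le> (1 - y + y ^ 2) * (1 + y)" using y by (simp add: algebra_simps power2_eq_square)
    then show ?thesis using y by (simp add: pos_divide_le_eq)
  qed
  finally show ?thesis by (simp add: y_def)
qed

text \<open>By independence every element of E in F contributes a factor of at most exp(s^2) and
  every other element the factor 1.\<close>

lemma bexp_exp_le:
  assumes "finite E" and p: "0 \<le> p" "p \<le> 1" and s: "\<bar>s\<bar> \<le> 1"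
  shows "bexp p E (\<lambda>X. exp (s * (real (card (X \<inter> F)) - p * real (card (E \<inter> F))))) \<le> exp (s ^ 2 * real (card (E \<inter> F)))"
  using assms(1)
proof (induction E rule: finite_induct)
  case empty
  then show ?case by simp
next
  case (insert e E)
  let ?f = "\<lambda>E X. exp (s * (real (card (X \<inter> F)) - p * real (card (E \<inter> F))))"
  show ?case
  proof (cases "e \<in> F")
    case False
    then have "bexp p (insert e E) (?f (insert e E)) = p * bexp p E (?f E) + (1 - p) * bexp p E (?f E)"
      unfolding bexp_insert[OF insert.hyps] by simp
    also have "\<dots> = bexp p E (?f E)" by (simp add: algebra_simps)
    finally show ?thesis using insert.IH False by simp
  next
    case True
    have cE: "card (insert e E \<inter> F) = Suc (card (E \<inter> F))" using True insert.hyps by simp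
    have "bexp p E (\<lambda>X. ?f (insert e E) (insert e X)) = bexp p E (\<lambda>X. exp (s * (1 - p)) * ?f E X)"
    proof (rule bexp_cong)
      fix X assume "X \<subseteq> E"
      then have "finite X" "e \<notin> X" using insert.hyps finite_subset by auto
      then have "card (insert e X \<inter> F) = Suc (card (X \<inter> F))" using True by simp
      then show "?f (insert e E) (insert e X) = exp (s * (1 - p)) * ?f E X"
        unfolding cE exp_add[symmetric] by (simp add: algebra_simps)
    qed
    moreover have "bexp p E (?f (insert e E)) = bexp p E (\<lambda>X. exp (- (s * p)) * ?f E X)"
      unfolding cE exp_add[symmetric] by (simp add: algebra_simps)
    ultimately have "bexp p (insert e E) (?f (insert e E)) =
        (p * exp (s * (1 - p)) + (1 - p) * exp (- (s * p))) * bexp p E (?f E)"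
      unfolding bexp_insert[OF insert.hyps] bexp_cmult by (simp add: algebra_simps)
    also have "\<dots> \<le> exp (s ^ 2) * exp (s ^ 2 * real (card (E \<inter> F)))"
    proof (rule mult_mono)
      have b: "\<bar>s * (1 - p)\<bar> \<le> 1" "\<bar>- (s * p)\<bar> \<le> 1"
        using s p by (simp_all add: abs_mult mult_le_one)
      have "p * exp (s * (1 - p)) + (1 - p) * exp (- (s * p)) \<le>
          p * (1 + s * (1 - p) + (s * (1 - p)) ^ 2) + (1 - p) * (1 + - (s * p) + (- (s * p)) ^ 2)"
        using p by (intro add_mono mult_left_mono exp_le_quadratic b) auto
      also have "\<dots> = 1 + s ^ 2 * (p * (1 - p))"
        by (simp add: power2_eq_square) (simp add: algebra_simps)
      also have "\<dots> \<le> 1 + s ^ 2 * 1" using p by (intro add_left_mono mult_left_mono mult_le_one) auto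
      also have "\<dots> \<le> exp (s ^ 2)" using exp_ge_add_one_self[of "s ^ 2"] by simp
      finally show "p * exp (s * (1 - p)) + (1 - p) * exp (- (s * p)) \<le> exp (s ^ 2)" .
    qed (use insert.IH p in \<open>auto intro: bexp_nonneg\<close>)
    also have "\<dots> = exp (s ^ 2 * real (card (insert e E \<inter> F)))"
      unfolding cE exp_add[symmetric] by (simp add: algebra_simps)
    finally show ?thesis .
  qed
qed

text \<open>Exponential Markov inequality for both tails and a union bound over the family; s stays
  free so that each application can choose it.\<close>

lemma deviation_probability:
  assumes E: "finite E" and p: "0 \<le> p" "p \<le> 1" and s: "0 \<le> s" "s \<le> 1"
    and fin: "finite \<F>" and \<F>: "\<And>F. F \<in> \<F> \<Longrightarrow> F \<subseteq> E \<and> real (card F) \<le> M"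
  shows "bexp p E (\<lambda>X. of_bool (\<exists>F\<in>\<F>. \<bar>real (card (X \<inter> F)) - p * real (card F)\<bar> > d)) \<le>
    2 * real (card \<F>) * exp (s ^ 2 * M - s * d)"
proof -
  let ?y = "\<lambda>F X. real (card (X \<inter> F)) - p * real (card F)"
  have "bexp p E (\<lambda>X. of_bool (\<exists>F\<in>\<F>. \<bar>?y F X\<bar> > d)) \<le>
     bexp p E (\<lambda>X. \<Sum>F\<in>\<F>. exp (- (s * d)) * (exp (s * ?y F X) + exp ((- s) * ?y F X)))"
  proof (rule bexp_mono[OF p])
    fix X
    show "of_bool (\<exists>F\<in>\<F>. \<bar>?y F X\<bar> > d) \<le> (\<Sum>F\<in>\<F>. exp (- (s * d)) * (exp (s * ?y F X) + exp ((- s) * ?y F X)))"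
    proof (cases "\<exists>F\<in>\<F>. \<bar>?y F X\<bar> > d")
      case True
      then obtain F where F: "F \<in> \<F>" "\<bar>?y F X\<bar> > d" by blast
      have "exp (s * d) \<le> exp (s * \<bar>?y F X\<bar>)" using F s by (simp add: mult_left_mono)
      also have "\<dots> \<le> exp (s * ?y F X) + exp ((- s) * ?y F X)"
        by (cases "?y F X \<ge> 0") (auto simp: abs_if algebra_simps)
      finally have "exp (- (s * d)) * exp (s * d) \<le> exp (- (s * d)) * (exp (s * ?y F X) + exp ((- s) * ?y F X))"
        by (intro mult_left_mono) auto
      then have "1 \<le> exp (- (s * d)) * (exp (s * ?y F X) + exp ((- s) * ?y F X))"
        by (simp flip: exp_add)
      also have "\<dots> \<le> (\<Sum>F\<in>\<F>. exp (- (s * d)) * (exp (s * ?y F X) + exp ((- s) * ?y F X)))"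
        using F(1) fin by (intro member_le_sum) (auto intro: add_nonneg_nonneg)
      finally show ?thesis using True by simp
    next
      case False
      have "0 \<le> (\<Sum>F\<in>\<F>. exp (- (s * d)) * (exp (s * ?y F X) + exp ((- s) * ?y F X)))"
        by (intro sum_nonneg mult_nonneg_nonneg add_nonneg_nonneg) auto
      then show ?thesis using False by simp
    qed
  qed
  also have "\<dots> = (\<Sum>F\<in>\<F>. exp (- (s * d)) * (bexp p E (\<lambda>X. exp (s * ?y F X)) + bexp p E (\<lambda>X. exp ((- s) * ?y F X))))"
    by (simp only: bexp_sum bexp_cmult bexp_add)
  also have "\<dots> \<le> (\<Sum>F\<in>\<F>. exp (- (s * d)) * (exp (s ^ 2 * M) + exp (s ^ 2 * M)))"
  proof (intro sum_mono mult_left_mono add_mono)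
    fix F assume F: "F \<in> \<F>"
    then have EF: "E \<inter> F = F" "real (card F) \<le> M" using \<F> by auto
    have e: "exp (s ^ 2 * real (card F)) \<le> exp (s ^ 2 * M)" using EF by (simp add: mult_left_mono)
    have "bexp p E (\<lambda>X. exp (s * ?y F X)) \<le> exp (s ^ 2 * real (card F))"
      using bexp_exp_le[OF E p, of s F] s unfolding EF by simp
    then show "bexp p E (\<lambda>X. exp (s * ?y F X)) \<le> exp (s ^ 2 * M)" using e by (rule order_trans)
    have "bexp p E (\<lambda>X. exp ((- s) * ?y F X)) \<le> exp (s ^ 2 * real (card F))"
      using bexp_exp_le[OF E p, of "- s" F] s unfolding EF by simp
    then show "bexp p E (\<lambda>X. exp ((- s) * ?y F X)) \<le> exp (s ^ 2 * M)" using e by (rule order_trans)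
  qed auto
  also have "\<dots> = 2 * real (card \<F>) * exp (s ^ 2 * M - s * d)"
    by (simp add: exp_diff exp_minus divide_inverse)
  finally show ?thesis .
qed

section \<open>Translation from \<open>Gnp\<close> to \<open>bexp\<close>\<close>

lemma bernoulli_set_probability:
  assumes E: "finite E" and p: "0 \<le> p" "p \<le> 1"
  shows "measure_pmf.prob (map_pmf (\<lambda>X. {e \<in> E. X e}) (Pi_pmf E False (\<lambda>_. bernoulli_pmf p))) A =
    bexp p E (\<lambda>X. of_bool (X \<in> A))"
proof -
  let ?P = "Pi_pmf E False (\<lambda>_. bernoulli_pmf p)"
  let ?R = "map_pmf (\<lambda>X. {e \<in> E. X e}) ?P"
  have pm: "pmf ?R Y = p ^ card Y * (1 - p) ^ card (E - Y)" if Y: "Y \<subseteq> E" for Y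
  proof -
    have "pmf ?R Y = measure_pmf.prob ?P (((\<lambda>X. {e \<in> E. X e}) -` {Y}) \<inter> set_pmf ?P)"
      by (simp add: pmf_map measure_Int_set_pmf)
    \<comment> \<open>On the support the indicator takes the default False outside E, so only one
      function yields the set Y.\<close>
    also have "((\<lambda>X. {e \<in> E. X e}) -` {Y}) \<inter> set_pmf ?P = {\<lambda>e. e \<in> Y} \<inter> set_pmf ?P"
      using set_Pi_pmf_subset[OF E, of False "\<lambda>_. bernoulli_pmf p"] Y by fastforce
    also have "measure_pmf.prob ?P \<dots> = pmf ?P (\<lambda>e. e \<in> Y)"
      by (simp add: measure_Int_set_pmf pmf.rep_eq)
    also have "\<dots> = (\<Prod>e\<in>E. pmf (bernoulli_pmf p) (e \<in> Y))"
      using E Y by (intro pmf_Pi') auto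
    also have "\<dots> = (\<Prod>e\<in>E. if e \<in> Y then p else 1 - p)" using p by (intro prod.cong) auto
    also have "\<dots> = p ^ card Y * (1 - p) ^ card (E - Y)"
      using E Y by (simp add: prod.If_cases Int_absorb1 Diff_eq)
    finally show ?thesis .
  qed
  have "measure_pmf.prob ?R A = measure_pmf.prob ?R (A \<inter> set_pmf ?R)" by (rule measure_Int_set_pmf[symmetric])
  also have "\<dots> = measure_pmf.prob ?R (Pow E \<inter> A \<inter> set_pmf ?R)"
    by (intro arg_cong[of _ _ "measure_pmf.prob ?R"]) auto
  also have "\<dots> = measure_pmf.prob ?R (Pow E \<inter> A)" by (rule measure_Int_set_pmf)
  also have "\<dots> = (\<Sum>Y\<in>Pow E \<inter> A. pmf ?R Y)" using E by (intro measure_measure_pmf_finite) auto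
  also have "\<dots> = (\<Sum>Y\<in>Pow E \<inter> A. p ^ card Y * (1 - p) ^ card (E - Y))" by (intro sum.cong refl pm) auto
  also have "\<dots> = bexp p E (\<lambda>X. of_bool (X \<in> A))"
    unfolding bexp_def using E by (intro sum.mono_neutral_cong_left) auto
  finally show ?thesis .
qed

lemma Gnp_prob:
  assumes p: "0 \<le> p" "p \<le> 1"
  shows "measure_pmf.prob (Gnp n p) A = bexp p (nsets {1..n} 2) (\<lambda>X. of_bool (({1..n}, X) \<in> A))"
proof -
  have "Gnp n p = map_pmf (Pair {1..n}) (map_pmf (\<lambda>X. {e \<in> nsets {1..n} 2. X e})
      (Pi_pmf (nsets {1..n} 2) False (\<lambda>_. bernoulli_pmf p)))"
    unfolding Gnp_def map_pmf_comp by simp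
  then have "measure_pmf.prob (Gnp n p) A = measure_pmf.prob (map_pmf (\<lambda>X. {e \<in> nsets {1..n} 2. X e})
      (Pi_pmf (nsets {1..n} 2) False (\<lambda>_. bernoulli_pmf p))) (Pair {1..n} -` A)"
    by (simp only: measure_map_pmf)
  also have "\<dots> = bexp p (nsets {1..n} 2) (\<lambda>X. of_bool (X \<in> Pair {1..n} -` A))"
    by (rule bernoulli_set_probability) (use p finite_imp_finite_nsets in auto)
  finally show ?thesis by simp
qed

section \<open>The Gibbs measure on states\<close>

locale gibbs_measure =
  fixes E :: "'e set" and S :: "'s set" and C :: "'s \<Rightarrow> 'e set"
  assumes finite_E: "finite E" and finite_S: "finite S" and S_nonempty: "S \<noteq> {}"
    and C_subset: "\<And>\<pi>. \<pi> \<in> S \<Longrightarrow> C \<pi> \<subseteq> E"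
begin

definition partition_function :: "'e set \<Rightarrow> real" where
  "partition_function X = (\<Sum>\<pi>\<in>S. 2 ^ card (X \<inter> C \<pi>))"

definition gibbs :: "'e set \<Rightarrow> 's \<Rightarrow> real" where
  "gibbs X \<pi> = 2 ^ card (X \<inter> C \<pi>) / partition_function X"

definition marginal :: "'e set \<Rightarrow> 'e \<Rightarrow> real" where
  "marginal X e = (\<Sum>\<pi>\<in>S. of_bool (e \<in> C \<pi>) * gibbs X \<pi>)"

lemma partition_function_pos: "0 < partition_function X"
  unfolding partition_function_def using finite_S S_nonempty by (intro sum_pos) auto

lemma gibbs_pos: "0 < gibbs X \<pi>"
  unfolding gibbs_def using partition_function_pos by simp

lemma sum_gibbs: "(\<Sum>\<pi>\<in>S. gibbs X \<pi>) = 1"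
  unfolding gibbs_def sum_divide_distrib[symmetric] partition_function_def[symmetric]
  using partition_function_pos[of X] by simp

lemma marginal_bounds: "0 \<le> marginal X e" "marginal X e \<le> 1"
proof -
  show "0 \<le> marginal X e"
    unfolding marginal_def using gibbs_pos by (intro sum_nonneg) (auto simp: less_imp_le)
  have "marginal X e \<le> (\<Sum>\<pi>\<in>S. gibbs X \<pi>)"
    unfolding marginal_def using gibbs_pos by (intro sum_mono) (auto simp: of_bool_def less_imp_le)
  then show "marginal X e \<le> 1" by (simp add: sum_gibbs)
qed

lemma sum_of_bool_mem:
  assumes "Y \<subseteq> E"
  shows "(\<Sum>e\<in>E. of_bool (e \<in> Y) :: real) = real (card Y)"
proof -
  have "(\<Sum>e\<in>E. of_bool (e \<in> Y) :: real) = (\<Sum>e\<in>Y. 1)"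
    using assms finite_E by (intro sum.mono_neutral_cong_right) auto
  then show ?thesis by simp
qed

lemma card_insert_Int:
  assumes "finite X" "e \<notin> X"
  shows "(2 :: real) ^ card (insert e X \<inter> A) = 2 ^ card (X \<inter> A) * (1 + of_bool (e \<in> A))"
  using assms by (cases "e \<in> A") auto

text \<open>Adding e doubles the weight of exactly the states that cut e, whose share is the
  marginal.\<close>

lemma partition_function_insert:
  assumes "finite X" "e \<notin> X"
  shows "partition_function (insert e X) = partition_function X * (1 + marginal X e)"
proof -
  have "partition_function X * marginal X e = (\<Sum>\<pi>\<in>S. of_bool (e \<in> C \<pi>) * 2 ^ card (X \<inter> C \<pi>))"
    unfolding marginal_def gibbs_def sum_distrib_left using partition_function_pos[of X]
    by (intro sum.cong) auto
  then have "partition_function X * (1 + marginal X e) =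
      (\<Sum>\<pi>\<in>S. 2 ^ card (X \<inter> C \<pi>)) + (\<Sum>\<pi>\<in>S. of_bool (e \<in> C \<pi>) * 2 ^ card (X \<inter> C \<pi>))"
    by (simp only: distrib_left mult_1_right partition_function_def)
  also have "\<dots> = (\<Sum>\<pi>\<in>S. 2 ^ card (X \<inter> C \<pi>) * (1 + of_bool (e \<in> C \<pi>)))"
    unfolding sum.distrib[symmetric] by (intro sum.cong refl) (simp add: algebra_simps)
  finally show ?thesis
    unfolding partition_function_def by (simp only: card_insert_Int[OF assms])
qed

lemma gibbs_insert:
  assumes "finite X" "e \<notin> X"
  shows "gibbs (insert e X) \<pi> = gibbs X \<pi> * (1 + of_bool (e \<in> C \<pi>)) / (1 + marginal X e)"
  unfolding gibbs_def partition_function_insert[OF assms] card_insert_Int[OF assms] by simp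

lemma gibbs_mono:
  assumes "finite X" "e \<notin> X" "e \<in> C \<pi>"
  shows "gibbs X \<pi> \<le> gibbs (insert e X) \<pi>"
proof -
  have "gibbs X \<pi> * (1 + marginal X e) \<le> gibbs X \<pi> * 2"
    using gibbs_pos[of X \<pi>] marginal_bounds[of X e] by (intro mult_left_mono) auto
  then show ?thesis
    unfolding gibbs_insert[OF assms(1,2)] using assms(3) marginal_bounds[of X e] by (simp add: pos_le_divide_eq)
qed

lemma marginal_insert:
  assumes "finite X" "e \<notin> X"
  shows "marginal (insert e X) e = 2 * marginal X e / (1 + marginal X e)"
proof -
  have "marginal (insert e X) e = (\<Sum>\<pi>\<in>S. 2 * (of_bool (e \<in> C \<pi>) * gibbs X \<pi>) / (1 + marginal X e))"
    unfolding marginal_def[of "insert e X"] gibbs_insert[OF assms] by (intro sum.cong) auto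
  also have "\<dots> = 2 * marginal X e / (1 + marginal X e)"
    unfolding marginal_def[of X] by (simp only: sum_divide_distrib sum_distrib_left)
  finally show ?thesis .
qed

text \<open>Given X without e, let a and b be the marginals of e before and after adding e. The
  right-hand side averages p (1 - p) (b - a), and b = 2a / (1 + a) makes b - a at least a (1 - a) /
  2 as well as b (1 - b) / 2. So it dominates their mixture with weights 1 - p and p, which is the
  conditional expectation of half the variance.\<close>

lemma marginal_covariance:
  assumes p: "0 \<le> p" "p \<le> 1" and e: "e \<in> E"
  shows "p * (1 - p) / 2 * bexp p E (\<lambda>X. marginal X e * (1 - marginal X e)) \<le>
     bexp p E (\<lambda>X. (of_bool (e \<in> X) - p) * marginal X e)"
proof -
  let ?E = "E - {e}"
  let ?a = "\<lambda>X. marginal X e" and ?b = "\<lambda>X. marginal (insert e X) e"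
  have "bexp p E (\<lambda>X. (of_bool (e \<in> X) - p) * marginal X e) =
     p * bexp p ?E (\<lambda>X. (1 - p) * ?b X) + (1 - p) * bexp p ?E (\<lambda>X. - p * ?a X)"
    unfolding bexp_remove[OF finite_E e]
    by (intro arg_cong2[of _ _ _ _ "(+)"] arg_cong2[of _ _ _ _ "(*)"] refl bexp_cong) auto
  also have "\<dots> = p * (1 - p) * bexp p ?E (\<lambda>X. ?b X - ?a X)"
    unfolding bexp_cmult bexp_diff by (simp add: algebra_simps)
  also have "\<dots> \<ge> p * (1 - p) * bexp p ?E (\<lambda>X. p / 2 * (?b X * (1 - ?b X)) + (1 - p) / 2 * (?a X * (1 - ?a X)))"
  proof (intro mult_left_mono bexp_mono p)
    fix X assume X: "X \<subseteq> ?E"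
    define a where "a = ?a X"
    have fX: "finite X" "e \<notin> X" using X finite_E finite_subset by auto
    have a: "0 \<le> a" "a \<le> 1" using marginal_bounds by (auto simp: a_def)
    have b: "?b X = 2 * a / (1 + a)" unfolding a_def by (rule marginal_insert[OF fX])
    have 1: "a * (1 - a) / 2 \<le> ?b X - a"
    proof -
      have "?b X - a = a * (1 - a) / (1 + a)" unfolding b using a by (simp add: field_simps)
      also have "\<dots> \<ge> a * (1 - a) / 2" using a by (intro divide_left_mono mult_nonneg_nonneg) auto
      finally show ?thesis .
    qed
    have 2: "?b X * (1 - ?b X) / 2 \<le> ?b X - a"
    proof -
      have "?b X * (1 - ?b X) = 2 * (a * (1 - a) / (1 + a)) / (1 + a)" unfolding b using a by (simp add: field_simps)
      also have "\<dots> \<le> 2 * (a * (1 - a) / (1 + a)) / 1" using a by (intro divide_left_mono) auto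
      also have "a * (1 - a) / (1 + a) = ?b X - a" unfolding b using a by (simp add: field_simps)
      finally show ?thesis by simp
    qed
    have eq: "p / 2 * x + (1 - p) / 2 * y = p * (x / 2) + (1 - p) * (y / 2)" "p * x + (1 - p) * x = x" for x y
      by (simp_all add: algebra_simps)
    have "p * (?b X * (1 - ?b X) / 2) + (1 - p) * (a * (1 - a) / 2) \<le> p * (?b X - a) + (1 - p) * (?b X - a)"
      using 1 2 p by (intro add_mono mult_left_mono) auto
    then show "p / 2 * (?b X * (1 - ?b X)) + (1 - p) / 2 * (?a X * (1 - ?a X)) \<le> ?b X - ?a X"
      unfolding a_def eq .
  qed (use p in auto)
  also have "p * (1 - p) * bexp p ?E (\<lambda>X. p / 2 * (?b X * (1 - ?b X)) + (1 - p) / 2 * (?a X * (1 - ?a X)))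
     = p * (1 - p) / 2 * bexp p E (\<lambda>X. marginal X e * (1 - marginal X e))"
  proof -
    have "p * (1 - p) * (p / 2 * x + (1 - p) / 2 * y) = p * (1 - p) / 2 * (p * x + (1 - p) * y)" for x y
      by (simp add: field_simps)
    then show ?thesis unfolding bexp_remove[OF finite_E e] bexp_add bexp_cmult .
  qed
  finally show ?thesis .
qed

text \<open>Exchanging sums, the sum over e of (1_e - p) times the marginal is the Gibbs average of
  card (X \<inter> C \<pi>) - p card (C \<pi>). This is at most d outside the deviation event and at
  most card E on it, while \<open>marginal_covariance\<close> bounds its expectation from
  below.\<close>

lemma total_variance:
  assumes p: "0 \<le> p" "p \<le> 1" and d: "0 \<le> d"
    and dev: "bexp p E (\<lambda>X. of_bool (\<exists>\<pi>\<in>S. \<bar>real (card (X \<inter> C \<pi>)) - p * real (card (C \<pi>))\<bar> > d)) \<le> \<epsilon>"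
  shows "p * (1 - p) / 2 * bexp p E (\<lambda>X. \<Sum>e\<in>E. marginal X e * (1 - marginal X e)) \<le> d + real (card E) * \<epsilon>"
proof -
  let ?bad = "\<lambda>X. \<exists>\<pi>\<in>S. \<bar>real (card (X \<inter> C \<pi>)) - p * real (card (C \<pi>))\<bar> > d"
  have "p * (1 - p) / 2 * bexp p E (\<lambda>X. \<Sum>e\<in>E. marginal X e * (1 - marginal X e)) =
     (\<Sum>e\<in>E. p * (1 - p) / 2 * bexp p E (\<lambda>X. marginal X e * (1 - marginal X e)))"
    by (simp only: bexp_sum sum_distrib_left)
  also have "\<dots> \<le> (\<Sum>e\<in>E. bexp p E (\<lambda>X. (of_bool (e \<in> X) - p) * marginal X e))"
    by (intro sum_mono marginal_covariance p)
  also have "\<dots> = bexp p E (\<lambda>X. \<Sum>e\<in>E. (of_bool (e \<in> X) - p) * marginal X e)" by (simp only: bexp_sum)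
  also have "\<dots> = bexp p E (\<lambda>X. \<Sum>\<pi>\<in>S. gibbs X \<pi> * (real (card (X \<inter> C \<pi>)) - p * real (card (C \<pi>))))"
  proof (rule bexp_cong)
    fix X assume X: "X \<subseteq> E"
    have "(\<Sum>e\<in>E. (of_bool (e \<in> X) - p) * marginal X e) =
        (\<Sum>e\<in>E. \<Sum>\<pi>\<in>S. (of_bool (e \<in> X) - p) * (of_bool (e \<in> C \<pi>) * gibbs X \<pi>))"
      unfolding marginal_def sum_distrib_left ..
    also have "\<dots> = (\<Sum>\<pi>\<in>S. \<Sum>e\<in>E. (of_bool (e \<in> X) - p) * (of_bool (e \<in> C \<pi>) * gibbs X \<pi>))" by (rule sum.swap)
    also have "\<dots> = (\<Sum>\<pi>\<in>S. gibbs X \<pi> * (real (card (X \<inter> C \<pi>)) - p * real (card (C \<pi>))))"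
    proof (rule sum.cong[OF refl])
      fix \<pi> assume \<pi>: "\<pi> \<in> S"
      have "(\<Sum>e\<in>E. (of_bool (e \<in> X) - p) * (of_bool (e \<in> C \<pi>) * gibbs X \<pi>)) =
         gibbs X \<pi> * (\<Sum>e\<in>E. of_bool (e \<in> X \<inter> C \<pi>) - p * of_bool (e \<in> C \<pi>))"
        unfolding sum_distrib_left by (intro sum.cong refl) (auto simp: of_bool_def)
      also have "(\<Sum>e\<in>E. of_bool (e \<in> X \<inter> C \<pi>) - p * of_bool (e \<in> C \<pi>)) =
         (\<Sum>e\<in>E. of_bool (e \<in> X \<inter> C \<pi>)) - p * (\<Sum>e\<in>E. of_bool (e \<in> C \<pi>))"
        by (simp only: sum_subtractf sum_distrib_left)
      also have "(\<Sum>e\<in>E. of_bool (e \<in> X \<inter> C \<pi>) :: real) = real (card (X \<inter> C \<pi>))"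
        using X by (intro sum_of_bool_mem) auto
      also have "(\<Sum>e\<in>E. of_bool (e \<in> C \<pi>) :: real) = real (card (C \<pi>))"
        using C_subset[OF \<pi>] by (rule sum_of_bool_mem)
      finally show "(\<Sum>e\<in>E. (of_bool (e \<in> X) - p) * (of_bool (e \<in> C \<pi>) * gibbs X \<pi>)) =
        gibbs X \<pi> * (real (card (X \<inter> C \<pi>)) - p * real (card (C \<pi>)))" .
    qed
    finally show "(\<Sum>e\<in>E. (of_bool (e \<in> X) - p) * marginal X e) =
       (\<Sum>\<pi>\<in>S. gibbs X \<pi> * (real (card (X \<inter> C \<pi>)) - p * real (card (C \<pi>))))" .
  qed
  also have "\<dots> \<le> bexp p E (\<lambda>X. d + real (card E) * of_bool (?bad X))"
  proof (rule bexp_mono[OF p])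
    fix X assume X: "X \<subseteq> E"
    have "(\<Sum>\<pi>\<in>S. gibbs X \<pi> * (real (card (X \<inter> C \<pi>)) - p * real (card (C \<pi>)))) \<le>
       (\<Sum>\<pi>\<in>S. gibbs X \<pi> * (d + real (card E) * of_bool (?bad X)))"
    proof (intro sum_mono mult_left_mono)
      fix \<pi> assume \<pi>: "\<pi> \<in> S"
      show "real (card (X \<inter> C \<pi>)) - p * real (card (C \<pi>)) \<le> d + real (card E) * of_bool (?bad X)"
      proof (cases "?bad X")
        case True
        have "real (card (X \<inter> C \<pi>)) \<le> real (card E)"
          using X finite_E by (intro of_nat_mono card_mono) auto
        moreover have "0 \<le> p * real (card (C \<pi>))" using p by simp
        moreover have "real (card E) * of_bool (?bad X) = real (card E)" using True by simp
        ultimately show ?thesis using d by linarith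
      next
        case False
        then have "\<bar>real (card (X \<inter> C \<pi>)) - p * real (card (C \<pi>))\<bar> \<le> d" using \<pi> not_less by blast
        then show ?thesis using False by simp
      qed
    qed (use gibbs_pos less_imp_le in blast)
    also have "\<dots> = d + real (card E) * of_bool (?bad X)"
      unfolding sum_distrib_right[symmetric] sum_gibbs by simp
    finally show "(\<Sum>\<pi>\<in>S. gibbs X \<pi> * (real (card (X \<inter> C \<pi>)) - p * real (card (C \<pi>)))) \<le> d + real (card E) * of_bool (?bad X)" .
  qed
  also have "\<dots> = d + real (card E) * bexp p E (\<lambda>X. of_bool (?bad X))"
    by (simp only: bexp_add bexp_cmult bexp_const[OF finite_E])
  also have "\<dots> \<le> d + real (card E) * \<epsilon>" using dev by (intro add_left_mono mult_left_mono) auto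
  finally show ?thesis .
qed

text \<open>Two independent samples differ on \<open>2 \<Sum> Var\<close> edges on average, so half of the Gibbs measure lies
  in a ball around a fixed state.\<close>

lemma partition_function_le:
  assumes "X \<subseteq> E" and var: "4 * (\<Sum>e\<in>E. marginal X e * (1 - marginal X e)) \<le> D" and D: "0 < D"
    and b: "\<And>\<pi>. \<pi> \<in> S \<Longrightarrow> card (X \<inter> C \<pi>) \<le> b"
  shows "\<exists>\<rho>\<in>S. partition_function X \<le> 2 * real (card {\<pi> \<in> S. real (card {e \<in> E. (e \<in> C \<pi>) \<noteq> (e \<in> C \<rho>)}) \<le> D}) * 2 ^ b"
proof -
  define dist where "dist \<pi> \<rho> = real (card {e \<in> E. (e \<in> C \<pi>) \<noteq> (e \<in> C \<rho>)})" for \<pi> \<rho>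
  let ?m = "gibbs X"
  have dist_sum: "dist \<pi> \<rho> = (\<Sum>e\<in>E. of_bool (e \<in> C \<pi>) * (1 - of_bool (e \<in> C \<rho>)) + (1 - of_bool (e \<in> C \<pi>)) * of_bool (e \<in> C \<rho>))" for \<pi> \<rho>
  proof -
    have "dist \<pi> \<rho> = (\<Sum>e\<in>E. of_bool (e \<in> {e \<in> E. (e \<in> C \<pi>) \<noteq> (e \<in> C \<rho>)}))"
      unfolding dist_def by (rule sum_of_bool_mem[symmetric]) auto
    also have "\<dots> = (\<Sum>e\<in>E. of_bool (e \<in> C \<pi>) * (1 - of_bool (e \<in> C \<rho>)) + (1 - of_bool (e \<in> C \<pi>)) * of_bool (e \<in> C \<rho>))"
      by (intro sum.cong refl) auto
    finally show ?thesis .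
  qed
  have "(\<Sum>\<rho>\<in>S. ?m \<rho> * (\<Sum>\<pi>\<in>S. ?m \<pi> * dist \<pi> \<rho>)) =
     (\<Sum>\<rho>\<in>S. \<Sum>\<pi>\<in>S. \<Sum>e\<in>E. ?m \<rho> * (?m \<pi> * (of_bool (e \<in> C \<pi>) * (1 - of_bool (e \<in> C \<rho>)) + (1 - of_bool (e \<in> C \<pi>)) * of_bool (e \<in> C \<rho>))))"
    unfolding dist_sum sum_distrib_left ..
  also have "\<dots> = (\<Sum>\<rho>\<in>S. \<Sum>e\<in>E. \<Sum>\<pi>\<in>S. ?m \<rho> * (?m \<pi> * (of_bool (e \<in> C \<pi>) * (1 - of_bool (e \<in> C \<rho>)) + (1 - of_bool (e \<in> C \<pi>)) * of_bool (e \<in> C \<rho>))))"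
    by (intro sum.cong refl sum.swap)
  also have "\<dots> = (\<Sum>e\<in>E. \<Sum>\<rho>\<in>S. \<Sum>\<pi>\<in>S. ?m \<rho> * (?m \<pi> * (of_bool (e \<in> C \<pi>) * (1 - of_bool (e \<in> C \<rho>)) + (1 - of_bool (e \<in> C \<pi>)) * of_bool (e \<in> C \<rho>))))"
    by (rule sum.swap)
  also have "\<dots> = (\<Sum>e\<in>E. 2 * (marginal X e * (1 - marginal X e)))"
  proof (rule sum.cong[OF refl])
    fix e
    let ?c = "\<lambda>\<pi>. of_bool (e \<in> C \<pi>) :: real"
    have "(\<Sum>\<rho>\<in>S. \<Sum>\<pi>\<in>S. ?m \<rho> * (?m \<pi> * (?c \<pi> * (1 - ?c \<rho>) + (1 - ?c \<pi>) * ?c \<rho>))) =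
       (\<Sum>\<rho>\<in>S. \<Sum>\<pi>\<in>S. ((1 - ?c \<rho>) * ?m \<rho>) * (?c \<pi> * ?m \<pi>) + (?c \<rho> * ?m \<rho>) * ((1 - ?c \<pi>) * ?m \<pi>))"
      by (intro sum.cong refl) (simp only: distrib_left mult_ac)
    also have "\<dots> = (\<Sum>\<rho>\<in>S. (1 - ?c \<rho>) * ?m \<rho>) * (\<Sum>\<pi>\<in>S. ?c \<pi> * ?m \<pi>) + (\<Sum>\<rho>\<in>S. ?c \<rho> * ?m \<rho>) * (\<Sum>\<pi>\<in>S. (1 - ?c \<pi>) * ?m \<pi>)"
      unfolding sum.distrib sum_product ..
    also have "(\<Sum>\<rho>\<in>S. (1 - ?c \<rho>) * ?m \<rho>) = 1 - marginal X e"
      unfolding marginal_def left_diff_distrib sum_subtractf by (simp add: sum_gibbs)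
    finally show "(\<Sum>\<rho>\<in>S. \<Sum>\<pi>\<in>S. ?m \<rho> * (?m \<pi> * (?c \<pi> * (1 - ?c \<rho>) + (1 - ?c \<pi>) * ?c \<rho>))) = 2 * (marginal X e * (1 - marginal X e))"
      unfolding marginal_def[symmetric] by simp
  qed
  also have "\<dots> \<le> D / 2" using var unfolding sum_distrib_left[symmetric] by simp
  finally have avg: "(\<Sum>\<rho>\<in>S. ?m \<rho> * (\<Sum>\<pi>\<in>S. ?m \<pi> * dist \<pi> \<rho>)) \<le> D / 2" .
  \<comment> \<open>Some fixed state is, on average, no farther from a random state than two random
    states are from each other.\<close>
  have "\<exists>\<rho>\<in>S. (\<Sum>\<pi>\<in>S. ?m \<pi> * dist \<pi> \<rho>) \<le> D / 2"
  proof (rule ccontr)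
    assume neg: "\<not> ?thesis"
    have "(\<Sum>\<rho>\<in>S. ?m \<rho> * (D / 2)) < (\<Sum>\<rho>\<in>S. ?m \<rho> * (\<Sum>\<pi>\<in>S. ?m \<pi> * dist \<pi> \<rho>))"
      using neg gibbs_pos finite_S S_nonempty by (intro sum_strict_mono mult_strict_left_mono) (auto simp: not_le)
    then show False using avg unfolding sum_distrib_right[symmetric] sum_gibbs by simp
  qed
  then obtain \<rho> where \<rho>: "\<rho> \<in> S" "(\<Sum>\<pi>\<in>S. ?m \<pi> * dist \<pi> \<rho>) \<le> D / 2" by blast
  let ?ball = "{\<pi> \<in> S. dist \<pi> \<rho> \<le> D}"
  \<comment> \<open>Markov's inequality: at most half of the measure lies at distance more than D
    from \<rho>. The other half is spread over the ball, whose states have measure at most 2^b / Z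
    each, with Z the partition function.\<close>
  have "(\<Sum>\<pi>\<in>S. ?m \<pi> * (D * of_bool (dist \<pi> \<rho> > D))) \<le> (\<Sum>\<pi>\<in>S. ?m \<pi> * dist \<pi> \<rho>)"
    using gibbs_pos by (intro sum_mono mult_left_mono) (auto simp: of_bool_def less_imp_le dist_def)
  then have "D * (\<Sum>\<pi>\<in>S. ?m \<pi> * of_bool (dist \<pi> \<rho> > D)) \<le> D * (1 / 2)"
    using \<rho>(2) unfolding sum_distrib_left mult.left_commute[of D] by simp
  then have far: "(\<Sum>\<pi>\<in>S. ?m \<pi> * of_bool (dist \<pi> \<rho> > D)) \<le> 1 / 2" using D by (simp only: mult_le_cancel_left_pos)
  have "1 = (\<Sum>\<pi>\<in>S. ?m \<pi> * of_bool (dist \<pi> \<rho> > D)) + (\<Sum>\<pi>\<in>S. ?m \<pi> * of_bool (dist \<pi> \<rho> \<le> D))"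
    unfolding sum.distrib[symmetric] sum_gibbs[of X, symmetric] by (intro sum.cong refl) auto
  then have "1 / 2 \<le> (\<Sum>\<pi>\<in>S. ?m \<pi> * of_bool (dist \<pi> \<rho> \<le> D))" using far by linarith
  also have "\<dots> = (\<Sum>\<pi>\<in>?ball. ?m \<pi>)"
    using finite_S by (intro sum.mono_neutral_cong_right) auto
  also have "\<dots> \<le> (\<Sum>\<pi>\<in>?ball. 2 ^ b / partition_function X)"
    unfolding gibbs_def using b partition_function_pos[of X] by (intro sum_mono divide_right_mono power_increasing) auto
  finally have "1 / 2 \<le> real (card ?ball) * 2 ^ b / partition_function X" by simp
  then have "partition_function X \<le> 2 * real (card ?ball) * 2 ^ b"
    using partition_function_pos[of X] by (simp add: field_simps)
  then show ?thesis using \<rho>(1) unfolding dist_def by blast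
qed

text \<open>The Gibbs weight of \<pi> can only grow when an edge cut by \<pi> is added, and
  \<open>w\<close> can only fall. Adding any other edge can lower the weight of \<pi>, since it
  favours other states, but \<open>w\<close> does not depend on such edges.\<close>

lemma gibbs_harris:
  assumes p: "0 \<le> p" "p \<le> 1"
    and anti: "\<And>e X. e \<in> C \<pi> \<Longrightarrow> X \<subseteq> E - {e} \<Longrightarrow> w (insert e X) \<le> w X"
    and dep: "\<And>e X. e \<in> E \<Longrightarrow> e \<notin> C \<pi> \<Longrightarrow> X \<subseteq> E - {e} \<Longrightarrow> w (insert e X) = w X"
  shows "bexp p E (\<lambda>X. gibbs X \<pi> * w X) \<le> bexp p E (\<lambda>X. gibbs X \<pi>) * bexp p E w"
proof (rule harris[OF finite_E p])
  fix e assume e: "e \<in> E"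
  show "(\<forall>X\<subseteq>E - {e}. gibbs X \<pi> \<le> gibbs (insert e X) \<pi> \<and> w (insert e X) \<le> w X) \<or>
     (\<forall>X\<subseteq>E - {e}. w (insert e X) = w X) \<or> (\<forall>X\<subseteq>E - {e}. gibbs (insert e X) \<pi> = gibbs X \<pi>)"
  proof (cases "e \<in> C \<pi>")
    case True
    have "gibbs X \<pi> \<le> gibbs (insert e X) \<pi>" if "X \<subseteq> E - {e}" for X
      using that finite_E finite_subset True by (intro gibbs_mono) auto
    then show ?thesis using anti[OF True] by blast
  next
    case False
    then show ?thesis using dep[OF e False] by blast
  qed
qed

text \<open>This takes the place of a union bound: summing over all colourings costs the factor 1
  and not their number.\<close>

lemma sum_bexp_gibbs: "(\<Sum>\<pi>\<in>S. bexp p E (\<lambda>X. gibbs X \<pi>)) = 1"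
  unfolding bexp_sum[symmetric] sum_gibbs by (rule bexp_const[OF finite_E])

end

section \<open>Near-maximum cuts of the random graph\<close>

locale graph_colouring =
  fixes V :: "'a set" and r :: nat
  assumes fin_V: "finite V" and V_ne: "V \<noteq> {}" and r_pos: "r \<ge> 1"
begin

definition edge_set :: "'a set set" where "edge_set = nsets V 2"
definition colourings :: "('a \<Rightarrow> nat) set" where "colourings = V \<rightarrow>\<^sub>E {..<r}"
definition cut :: "('a \<Rightarrow> nat) \<Rightarrow> 'a set set" where
  "cut \<pi> = {e \<in> edge_set. \<exists>u\<in>e. \<exists>v\<in>e. \<pi> u \<noteq> \<pi> v}"

lemma finite_edge_set: "finite edge_set"
  unfolding edge_set_def by (rule finite_imp_finite_nsets[OF fin_V])

lemma edge_in: "{u, v} \<in> edge_set \<longleftrightarrow> u \<in> V \<and> v \<in> V \<and> u \<noteq> v"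
  by (simp add: edge_set_def)

lemma cut_in: "{u, v} \<in> cut \<pi> \<longleftrightarrow> u \<in> V \<and> v \<in> V \<and> \<pi> u \<noteq> \<pi> v"
  unfolding cut_def by (auto simp: edge_in)

lemma edgeE:
  assumes "e \<in> edge_set"
  obtains u v where "e = {u, v}" "u \<in> V" "v \<in> V" "u \<noteq> v"
  using assms unfolding edge_set_def by (auto simp: nsets_2_eq)

lemma finite_colourings: "finite colourings"
  unfolding colourings_def using fin_V by (intro finite_PiE) auto

sublocale gibbs_measure edge_set colourings cut
proof
  have "restrict (\<lambda>_. 0) V \<in> colourings" using r_pos by (auto simp: colourings_def)
  then show "colourings \<noteq> {}" by blast
qed (auto simp: finite_edge_set finite_colourings cut_def)

lemma ordered_count:
  assumes "Y \<subseteq> edge_set"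
  shows "(\<Sum>u\<in>V. \<Sum>v\<in>V. of_bool ({u, v} \<in> Y) :: real) = 2 * real (card Y)"
proof -
  have fY: "finite Y" using assms finite_edge_set finite_subset by blast
  have "(\<Sum>u\<in>V. \<Sum>v\<in>V. of_bool ({u, v} \<in> Y) :: real) = (\<Sum>u\<in>V. \<Sum>v\<in>V. \<Sum>e\<in>Y. of_bool ({u, v} = e))"
  proof (intro sum.cong refl)
    fix u v
    have "(\<Sum>e\<in>Y. of_bool ({u, v} = e) :: real) = (\<Sum>e\<in>Y. if {u, v} = e then 1 else 0)"
      by (intro sum.cong refl) auto
    also have "\<dots> = of_bool ({u, v} \<in> Y)" using fY by (subst sum.delta') auto
    finally show "of_bool ({u, v} \<in> Y) = (\<Sum>e\<in>Y. of_bool ({u, v} = e) :: real)" ..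
  qed
  also have "\<dots> = (\<Sum>u\<in>V. \<Sum>e\<in>Y. \<Sum>v\<in>V. of_bool ({u, v} = e))" by (intro sum.cong refl sum.swap)
  also have "\<dots> = (\<Sum>e\<in>Y. \<Sum>u\<in>V. \<Sum>v\<in>V. of_bool ({u, v} = e))" by (rule sum.swap)
  also have "\<dots> = (\<Sum>e\<in>Y. 2)"
  proof (rule sum.cong[OF refl])
    fix e assume "e \<in> Y"
    then obtain a b where e: "e = {a, b}" "a \<in> V" "b \<in> V" "a \<noteq> b" using assms by (meson edgeE subsetD)
    have "(\<Sum>v\<in>V. of_bool ({u, v} = e) :: real) = of_bool (u \<in> {a, b})" for u
    proof -
      consider "u = a" | "u = b" | "u \<notin> {a, b}" by blast
      then show ?thesis
      proof cases
        case 1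
        then have "(\<Sum>v\<in>V. of_bool ({u, v} = e) :: real) = (\<Sum>v\<in>V. if b = v then 1 else 0)"
          using e by (intro sum.cong refl) (auto simp: doubleton_eq_iff)
        then show ?thesis using 1 e fin_V by simp
      next
        case 2
        then have "(\<Sum>v\<in>V. of_bool ({u, v} = e) :: real) = (\<Sum>v\<in>V. if a = v then 1 else 0)"
          using e by (intro sum.cong refl) (auto simp: doubleton_eq_iff)
        then show ?thesis using 2 e fin_V by simp
      next
        case 3
        then have "(\<Sum>v\<in>V. of_bool ({u, v} = e) :: real) = 0" using e by (intro sum.neutral) auto
        then show ?thesis using 3 by simp
      qed
    qed
    then have "(\<Sum>u\<in>V. \<Sum>v\<in>V. of_bool ({u, v} = e) :: real) = (\<Sum>u\<in>V. of_bool (u \<in> {a, b}))" by simp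
    also have "\<dots> = (\<Sum>u\<in>{a, b}. 1)" using e fin_V by (intro sum.mono_neutral_cong_right) auto
    also have "\<dots> = 2" using e by simp
    finally show "(\<Sum>u\<in>V. \<Sum>v\<in>V. of_bool ({u, v} = e) :: real) = 2" .
  qed
  finally show ?thesis by simp
qed

text \<open>A colouring \<pi> near \<rho> is encoded by a map k of colours and a list of exceptions,
  so merged or renamed classes are allowed. In a class of \<rho> some vertex u has at most sqrt(2 D)
  vertices coloured differently from it by \<pi>: otherwise the class has more than sqrt(2 D)
  vertices and more than 2 D ordered pairs with different \<pi>-colours. Taking k to be the colour
  of u leaves at most r sqrt(2 D) \<le> Q exceptions in all.\<close>

lemma ball_card:
  assumes \<rho>: "\<rho> \<in> colourings" and Q: "real r * sqrt (2 * D) \<le> real Q" and D: "D > 0"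
  shows "card {\<pi> \<in> colourings. real (card {e \<in> edge_set. (e \<in> cut \<pi>) \<noteq> (e \<in> cut \<rho>)}) \<le> D} \<le> r ^ r * (card V * r) ^ Q"
proof -
  define dec :: "(nat \<Rightarrow> nat) \<times> ('a \<times> nat) list \<Rightarrow> 'a \<Rightarrow> nat" where
    "dec kL = restrict (\<lambda>v. case map_of (snd kL) v of None \<Rightarrow> fst kL (\<rho> v) | Some c \<Rightarrow> c) V" for kL
  let ?codes = "({..<r} \<rightarrow>\<^sub>E {..<r}) \<times> {L. set L \<subseteq> V \<times> {..<r} \<and> length L = Q}"
  let ?ball = "{\<pi> \<in> colourings. real (card {e \<in> edge_set. (e \<in> cut \<pi>) \<noteq> (e \<in> cut \<rho>)}) \<le> D}"
  have fin: "finite ?codes"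
    using fin_V by (intro finite_cartesian_product finite_PiE finite_lists_length_eq) auto
  have "?ball \<subseteq> dec ` ?codes"
  proof
    fix \<pi> assume "\<pi> \<in> ?ball"
    then have \<pi>: "\<pi> \<in> colourings" and dist: "real (card {e \<in> edge_set. (e \<in> cut \<pi>) \<noteq> (e \<in> cut \<rho>)}) \<le> D" by auto
    have \<pi>r: "\<pi> v < r" "\<rho> v < r" if "v \<in> V" for v using \<pi> \<rho> that unfolding colourings_def by auto
    define W where "W j = {v \<in> V. \<rho> v = j}" for j
    have fW: "finite (W j)" for j using fin_V by (simp add: W_def)
    define q where "q = sqrt (2 * D)"
    have q: "q > 0" "q * q = 2 * D" using D by (simp_all add: q_def)
    have ex_c: "\<exists>c. c < r \<and> real (card {v \<in> W j. \<pi> v \<noteq> c}) \<le> q" if j: "j < r" for j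
    proof (cases "W j = {}")
      case True
      then show ?thesis using j q by (intro exI[of _ 0]) auto
    next
      case False
      have "\<exists>u\<in>W j. real (card {v \<in> W j. \<pi> v \<noteq> \<pi> u}) \<le> q"
      proof (rule ccontr)
        assume neg: "\<not> ?thesis"
        have large: "q < real (card (W j))"
        proof -
          obtain u where u: "u \<in> W j" using False by blast
          then have "q < real (card {v \<in> W j. \<pi> v \<noteq> \<pi> u})" using neg not_le by blast
          also have "\<dots> \<le> real (card (W j))" using fW by (intro of_nat_mono card_mono) auto
          finally show ?thesis .
        qed
        \<comment> \<open>Inside a class of \<rho>, pairs with different \<pi>-colours are cut by
          \<pi> but not by \<rho>, and count for the distance.\<close>
        let ?Y = "{e \<in> edge_set. e \<in> cut \<pi> \<and> e \<notin> cut \<rho>}"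
        have "real (card (W j)) * q \<le> (\<Sum>u\<in>W j. real (card {v \<in> W j. \<pi> v \<noteq> \<pi> u}))"
          using neg by (subst sum_constant[symmetric], intro sum_mono) (auto simp: not_le less_imp_le)
        also have "\<dots> \<le> (\<Sum>u\<in>W j. \<Sum>v\<in>V. of_bool ({u, v} \<in> ?Y))"
        proof (rule sum_mono)
          fix u assume u: "u \<in> W j"
          have "real (card {v \<in> W j. \<pi> v \<noteq> \<pi> u}) = (\<Sum>v\<in>{v \<in> W j. \<pi> v \<noteq> \<pi> u}. 1)" by simp
          also have "\<dots> \<le> (\<Sum>v\<in>{v \<in> W j. \<pi> v \<noteq> \<pi> u}. of_bool ({u, v} \<in> ?Y))"
          proof (rule sum_mono)
            fix v assume v: "v \<in> {v \<in> W j. \<pi> v \<noteq> \<pi> u}"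
            have "{u, v} \<in> cut \<pi>" using u v by (auto simp: cut_in W_def)
            moreover have "{u, v} \<notin> cut \<rho>" using u v by (auto simp: cut_in W_def)
            moreover have "{u, v} \<in> edge_set" using u v by (auto simp: edge_in W_def)
            ultimately show "1 \<le> (of_bool ({u, v} \<in> ?Y) :: real)" by simp
          qed
          also have "\<dots> \<le> (\<Sum>v\<in>V. of_bool ({u, v} \<in> ?Y))"
            using fin_V by (intro sum_mono2) (auto simp: W_def)
          finally show "real (card {v \<in> W j. \<pi> v \<noteq> \<pi> u}) \<le> (\<Sum>v\<in>V. of_bool ({u, v} \<in> ?Y))" .
        qed
        also have "\<dots> \<le> (\<Sum>u\<in>V. \<Sum>v\<in>V. of_bool ({u, v} \<in> ?Y))"
          using fin_V by (intro sum_mono2) (auto simp: W_def intro: sum_nonneg)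
        also have "\<dots> = 2 * real (card ?Y)" by (rule ordered_count) auto
        also have "\<dots> \<le> 2 * D"
        proof -
          have "card ?Y \<le> card {e \<in> edge_set. (e \<in> cut \<pi>) \<noteq> (e \<in> cut \<rho>)}"
            using finite_edge_set by (intro card_mono) auto
          then show ?thesis using dist by simp
        qed
        also have "\<dots> = q * q" using q by simp
        finally have "real (card (W j)) \<le> q" using q(1) by (simp only: mult_le_cancel_right_pos)
        then show False using large by simp
      qed
      then obtain u where "u \<in> W j" "real (card {v \<in> W j. \<pi> v \<noteq> \<pi> u}) \<le> q" by blast
      then show ?thesis using \<pi>r(1)[of u] by (auto simp: W_def)
    qed
    define k0 where "k0 j = (SOME c. c < r \<and> real (card {v \<in> W j. \<pi> v \<noteq> c}) \<le> q)" for j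
    have k0: "k0 j < r \<and> real (card {v \<in> W j. \<pi> v \<noteq> k0 j}) \<le> q" if "j < r" for j
      unfolding k0_def using ex_c[OF that] by (rule someI_ex)
    define T where "T = (\<Union>j<r. {v \<in> W j. \<pi> v \<noteq> k0 j})"
    have fT: "finite T" unfolding T_def using fW by auto
    have TV: "T \<subseteq> V" unfolding T_def W_def by auto
    have "card T \<le> (\<Sum>j<r. card {v \<in> W j. \<pi> v \<noteq> k0 j})" unfolding T_def by (rule card_UN_le) simp
    then have "real (card T) \<le> (\<Sum>j<r. real (card {v \<in> W j. \<pi> v \<noteq> k0 j}))"
      unfolding of_nat_sum[symmetric] by (rule of_nat_mono)
    also have "\<dots> \<le> (\<Sum>j<r. q)" using k0 by (intro sum_mono) auto
    also have "\<dots> \<le> real Q" using Q by (simp add: q_def)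
    finally have cT: "card T \<le> Q" by simp
    obtain xs where xs: "set xs = T" "distinct xs" using finite_distinct_list[OF fT] by blast
    obtain v0 where v0: "v0 \<in> V" using V_ne by blast
    \<comment> \<open>Copies of v0 pad the list to length exactly Q; they only record the true
      colour of v0 again.\<close>
    define ys where "ys = xs @ replicate (Q - length xs) v0"
    have len: "length ys = Q" using cT xs distinct_card[of xs] by (simp add: ys_def)
    have ysV: "set ys \<subseteq> V" "T \<subseteq> set ys" using xs TV v0 by (auto simp: ys_def)
    define L where "L = map (\<lambda>v. (v, \<pi> v)) ys"
    have mo: "map_of L v = (if v \<in> set ys then Some (\<pi> v) else None)" for v
      unfolding L_def by (induction ys) auto
    have code: "(restrict k0 {..<r}, L) \<in> ?codes"
    proof -
      have "restrict k0 {..<r} \<in> {..<r} \<rightarrow>\<^sub>E {..<r}" using k0 by auto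
      moreover have "set L \<subseteq> V \<times> {..<r}" using ysV(1) \<pi>r(1) by (auto simp: L_def)
      moreover have "length L = Q" using len by (simp add: L_def)
      ultimately show ?thesis by simp
    qed
    have "dec (restrict k0 {..<r}, L) = \<pi>"
    proof
      fix v
      show "dec (restrict k0 {..<r}, L) v = \<pi> v"
      proof (cases "v \<in> V")
        case True
        have "k0 (\<rho> v) = \<pi> v" if "v \<notin> set ys"
        proof (rule ccontr)
          assume "k0 (\<rho> v) \<noteq> \<pi> v"
          then have "v \<in> {v \<in> W (\<rho> v). \<pi> v \<noteq> k0 (\<rho> v)}" using True by (simp add: W_def)
          then have "v \<in> T" unfolding T_def using \<pi>r(2)[OF True] by blast
          then show False using that ysV(2) by blast
        qed
        then show ?thesis using True \<pi>r(2)[OF True] unfolding dec_def snd_conv fst_conv mo by simp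
      next
        case False
        then show ?thesis using \<pi> unfolding dec_def colourings_def by (auto simp: PiE_def extensional_def)
      qed
    qed
    then show "\<pi> \<in> dec ` ?codes" using code by (rule image_eqI[OF sym])
  qed
  then have "card ?ball \<le> card (dec ` ?codes)" using fin by (intro card_mono) auto
  also have "\<dots> \<le> card ?codes" using fin by (rule card_image_le)
  also have "\<dots> = r ^ r * (card V * r) ^ Q"
  proof -
    have "card ({..<r} \<rightarrow>\<^sub>E {..<r}) = r ^ r" by (simp add: card_PiE)
    moreover have "card {L. set L \<subseteq> V \<times> {..<r} \<and> length L = Q} = (card V * r) ^ Q"
      using fin_V by (subst card_lists_length_eq) (simp_all add: card_cartesian_product)
    ultimately show ?thesis by (simp only: card_cartesian_product)
  qed
  finally show ?thesis .
qed

end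

section \<open>Atypical pairs of a fixed colouring, and the sum over colourings\<close>

lemma exp_minus_one_le: "exp (- 1 :: real) \<le> 1 / 2"
proof -
  have "2 \<le> exp (1 :: real)" using exp_ge_add_one_self[of 1] by simp
  then show ?thesis by (simp add: exp_minus field_simps)
qed

lemma bexp_pair:
  assumes E: "finite E" and p: "0 \<le> p" "p \<le> 1" and ab: "a \<in> E" "b \<in> E" "a \<noteq> b"
  shows "bexp p E (\<lambda>X. exp (- of_bool (a \<in> X \<and> b \<in> X))) \<le> exp (- (p ^ 2 / 2))"
proof -
  have 1: "bexp p (E - {a}) (\<lambda>X. exp (- of_bool (b \<in> X)) :: real) = p * exp (- 1) + (1 - p)"
  proof -
    have b: "b \<in> E - {a}" using ab by auto
    have "bexp p (E - {a}) (\<lambda>X. exp (- of_bool (b \<in> X)) :: real) =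
       p * bexp p (E - {a} - {b}) (\<lambda>X. exp (- 1)) + (1 - p) * bexp p (E - {a} - {b}) (\<lambda>X. 1)"
      unfolding bexp_remove[OF finite_Diff[OF E] b]
      by (intro arg_cong2[of _ _ _ _ "(+)"] arg_cong2[of _ _ _ _ "(*)"] refl bexp_cong) auto
    then show ?thesis using E by (simp add: bexp_const)
  qed
  have "bexp p E (\<lambda>X. exp (- of_bool (a \<in> X \<and> b \<in> X)) :: real) =
       p * bexp p (E - {a}) (\<lambda>X. exp (- of_bool (b \<in> X))) + (1 - p) * bexp p (E - {a}) (\<lambda>X. 1)"
    unfolding bexp_remove[OF E ab(1)] using ab
    by (intro arg_cong2[of _ _ _ _ "(+)"] arg_cong2[of _ _ _ _ "(*)"] refl bexp_cong) auto
  also have "\<dots> = 1 - p ^ 2 * (1 - exp (- 1))"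
    unfolding 1 using E by (simp add: bexp_const) (simp add: algebra_simps power2_eq_square)
  also have "\<dots> \<le> 1 - p ^ 2 * (1 / 2)"
    using exp_minus_one_le by (intro diff_left_mono mult_left_mono) auto
  also have "\<dots> \<le> exp (- (p ^ 2 / 2))" using exp_ge_add_one_self[of "- (p ^ 2 / 2)"] by simp
  finally show ?thesis .
qed

text \<open>The factors depend on disjoint sets of elements and are independent. The inequality that
  is required comes from \<open>harris\<close>, since every element leaves one of the two factors of
  each product unchanged.\<close>

lemma bexp_disjoint_pairs:
  assumes "finite T" and E: "finite E" and p: "0 \<le> p" "p \<le> 1"
    and "\<And>t. t \<in> T \<Longrightarrow> a t \<in> E \<and> b t \<in> E \<and> a t \<noteq> b t"
    and "\<And>t t'. t \<in> T \<Longrightarrow> t' \<in> T \<Longrightarrow> t \<noteq> t' \<Longrightarrow> {a t, b t} \<inter> {a t', b t'} = {}"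
  shows "bexp p E (\<lambda>X. \<Prod>t\<in>T. exp (- of_bool (a t \<in> X \<and> b t \<in> X))) \<le> exp (- (p ^ 2 / 2 * real (card T)))"
  using assms(1,5,6)
proof (induction T rule: finite_induct)
  case empty
  then show ?case using E by (simp add: bexp_const)
next
  case (insert t T)
  let ?f = "\<lambda>t X. exp (- of_bool (a t \<in> X \<and> b t \<in> X)) :: real"
  have "bexp p E (\<lambda>X. \<Prod>t\<in>insert t T. ?f t X) = bexp p E (\<lambda>X. (\<Prod>t\<in>T. ?f t X) * ?f t X)"
    using insert.hyps by (simp add: mult.commute)
  also have "\<dots> \<le> bexp p E (\<lambda>X. \<Prod>t\<in>T. ?f t X) * bexp p E (?f t)"
  proof (rule harris[OF E p])
    fix e assume "e \<in> E"
    show "(\<forall>X\<subseteq>E - {e}. (\<Prod>t\<in>T. ?f t X) \<le> (\<Prod>t\<in>T. ?f t (insert e X)) \<and> ?f t (insert e X) \<le> ?f t X) \<or>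
        (\<forall>X\<subseteq>E - {e}. ?f t (insert e X) = ?f t X) \<or> (\<forall>X\<subseteq>E - {e}. (\<Prod>t\<in>T. ?f t (insert e X)) = (\<Prod>t\<in>T. ?f t X))"
    proof (cases "e \<in> {a t, b t}")
      case True
      have "(\<Prod>t\<in>T. ?f t (insert e X)) = (\<Prod>t\<in>T. ?f t X)" for X
      proof (rule prod.cong[OF refl])
        fix t' assume t': "t' \<in> T"
        then have "{a t, b t} \<inter> {a t', b t'} = {}" using insert.hyps insert.prems(2)[of t t'] by auto
        then have "e \<noteq> a t'" "e \<noteq> b t'" using True by auto
        then show "?f t' (insert e X) = ?f t' X" by auto
      qed
      then show ?thesis by blast
    next
      case False
      then have "?f t (insert e X) = ?f t X" for X by auto
      then show ?thesis by blast
    qed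
  qed
  also have "\<dots> \<le> exp (- (p ^ 2 / 2 * real (card T))) * exp (- (p ^ 2 / 2))"
  proof (rule mult_mono)
    show "bexp p E (\<lambda>X. \<Prod>t\<in>T. ?f t X) \<le> exp (- (p ^ 2 / 2 * real (card T)))"
      using insert.IH insert.prems by blast
    show "bexp p E (?f t) \<le> exp (- (p ^ 2 / 2))" using insert.prems(1)[of t] by (intro bexp_pair E p) auto
  qed (auto intro!: bexp_nonneg p)
  also have "\<dots> = exp (- (p ^ 2 / 2 * real (card (insert t T))))"
    using insert.hyps by (simp add: algebra_simps flip: exp_add)
  finally show ?case .
qed

abbreviation pair_vertices :: "('a \<times> 'a \<times> nat) list \<Rightarrow> 'a list" where
  "pair_vertices D \<equiv> concat (map (\<lambda>(x, y, i). [x, y]) D)"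

lemma length_pair_vertices: "length (pair_vertices D) = 2 * length D"
  by (induction D) auto

lemma mem_pair_vertices: "(x, y, i) \<in> set D \<Longrightarrow> x \<in> set (pair_vertices D) \<and> y \<in> set (pair_vertices D)"
  by force

lemma distinct_pair_verticesD:
  assumes "distinct (pair_vertices D)"
  shows "distinct D" "(x, y, i) \<in> set D \<Longrightarrow> x \<noteq> y"
    "(x, y, i) \<in> set D \<Longrightarrow> (x', y', i') \<in> set D \<Longrightarrow> {x, y} \<inter> {x', y'} \<noteq> {} \<Longrightarrow> x = x' \<and> y = y' \<and> i = i'"
proof -
  have "distinct D \<and> (\<forall>x y i. (x, y, i) \<in> set D \<longrightarrow> x \<noteq> y) \<and> (\<forall>x y i x' y' i'. (x, y, i) \<in> set D \<longrightarrow>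
     (x', y', i') \<in> set D \<longrightarrow> {x, y} \<inter> {x', y'} \<noteq> {} \<longrightarrow> x = x' \<and> y = y' \<and> i = i')"
    using assms
  proof (induction D)
    case Nil
    then show ?case by simp
  next
    case (Cons d D)
    obtain a b c where d: "d = (a, b, c)" by (cases d) auto
    have "distinct (pair_vertices D)" using Cons.prems by (simp add: d)
    note ih = Cons.IH[OF this]
    note IH = ih[THEN conjunct1] ih[THEN conjunct2, THEN conjunct1, rule_format]
      ih[THEN conjunct2, THEN conjunct2, rule_format]
    have ab: "a \<noteq> b" "a \<notin> set (pair_vertices D)" "b \<notin> set (pair_vertices D)" using Cons.prems by (auto simp: d)
    have new: "{x, y} \<inter> {a, b} = {}" if "(x, y, i) \<in> set D" for x y i
      using mem_pair_vertices[OF that] ab by auto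
    show ?case
    proof (intro conjI allI impI)
      show "distinct (d # D)" using IH(1) new by (auto simp: d)
      fix x y i assume "(x, y, i) \<in> set (d # D)"
      then show "x \<noteq> y" using IH(2) ab by (auto simp: d)
    next
      fix x y i x' y' i'
      assume a: "(x, y, i) \<in> set (d # D)" "(x', y', i') \<in> set (d # D)" "{x, y} \<inter> {x', y'} \<noteq> {}"
      consider "(x, y, i) = d" "(x', y', i') = d" | "(x, y, i) = d" "(x', y', i') \<in> set D"
        | "(x, y, i) \<in> set D" "(x', y', i') = d" | "(x, y, i) \<in> set D" "(x', y', i') \<in> set D"
        using a by auto
      then have "(x, y, i) = (x', y', i')"
      proof cases
        case 2
        then show ?thesis using new[of x' y' i'] a(3) by (auto simp: d)
      next
        case 3
        then show ?thesis using new[of x y i] a(3) by (auto simp: d)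
      next
        case 4
        then show ?thesis using IH(3)[OF 4 a(3)] by simp
      qed simp
      then show "x = x'" "y = y'" "i = i'" by auto
    qed
  qed
  note conj = this
  show "distinct D" by (rule conj[THEN conjunct1])
  show "(x, y, i) \<in> set D \<Longrightarrow> x \<noteq> y" by (rule conj[THEN conjunct2, THEN conjunct1, rule_format])
  show "(x, y, i) \<in> set D \<Longrightarrow> (x', y', i') \<in> set D \<Longrightarrow> {x, y} \<inter> {x', y'} \<noteq> {} \<Longrightarrow> x = x' \<and> y = y' \<and> i = i'"
    by (rule conj[THEN conjunct2, THEN conjunct2, rule_format])
qed

context graph_colouring begin

definition codegree :: "'a set set \<Rightarrow> ('a \<Rightarrow> nat) \<Rightarrow> 'a \<Rightarrow> 'a \<Rightarrow> nat \<Rightarrow> nat" where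
  "codegree X \<pi> x y i = card {z \<in> V. \<pi> z = i \<and> {x, z} \<in> X \<and> {y, z} \<in> X}"

definition valid_pairs :: "('a \<Rightarrow> nat) \<Rightarrow> ('a \<times> 'a \<times> nat) list \<Rightarrow> bool" where
  "valid_pairs \<pi> D \<longleftrightarrow> distinct (pair_vertices D) \<and>
     (\<forall>(x, y, i)\<in>set D. x \<in> V \<and> y \<in> V \<and> \<pi> x = \<pi> y \<and> i < r \<and> i \<noteq> \<pi> x)"

definition atypical :: "real \<Rightarrow> 'a set set \<Rightarrow> ('a \<Rightarrow> nat) \<Rightarrow> ('a \<times> 'a \<times> nat) list \<Rightarrow> bool" where
  "atypical t X \<pi> D \<longleftrightarrow> (\<forall>(x, y, i)\<in>set D. real (codegree X \<pi> x y i) < t)"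

text \<open>On the event, each pair has at most t vertices z joined to both of its ends, so the
  number of such (pair, z) is at most m t for m pairs. The probability is therefore at most exp(m t)
  times the expectation of exp(-number), and at least m (s - 2 m) disjoint potential cherries each
  contribute a factor exp(-p^2 / 2).\<close>

lemma atypical_prob:
  assumes p: "0 \<le> p" "p \<le> 1" and val: "valid_pairs \<pi> D"
    and bal: "\<And>i. i < r \<Longrightarrow> s \<le> real (card {v \<in> V. \<pi> v = i})" and t: "0 \<le> t"
  shows "bexp p edge_set (\<lambda>X. of_bool (atypical t X \<pi> D)) \<le>
    exp (real (length D) * t - p ^ 2 / 2 * (real (length D) * (s - 2 * real (length D))))"
proof -
  define m where "m = length D"
  define U where "U = set (pair_vertices D)"
  have dist: "distinct (pair_vertices D)" using val by (simp add: valid_pairs_def)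
  note dd = distinct_pair_verticesD[OF dist]
  have cD: "card (set D) = m" using dd(1) distinct_card m_def by blast
  have cU: "card U \<le> 2 * m" unfolding U_def m_def using card_length length_pair_vertices by metis
  have vD: "x \<in> V \<and> y \<in> V \<and> \<pi> x = \<pi> y \<and> i < r \<and> i \<noteq> \<pi> x" if "(x, y, i) \<in> set D" for x y i
    using val that unfolding valid_pairs_def by blast
  have UD: "x \<in> U \<and> y \<in> U" if "(x, y, i) \<in> set D" for x y i
    using mem_pair_vertices[OF that] unfolding U_def .
  \<comment> \<open>Leaving out the vertices of all pairs puts exactly one vertex of U on each edge
    {x, z} or {y, z}. It determines the pair, so different elements of T use disjoint sets of
    edges.\<close>
  define Zs where "Zs d = {z \<in> V. \<pi> z = snd (snd d) \<and> z \<notin> U}" for d :: "'a \<times> 'a \<times> nat"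
  have fZ: "finite (Zs d)" for d using fin_V by (simp add: Zs_def)
  define T where "T = Sigma (set D) Zs"
  have fT: "finite T" unfolding T_def using fZ by auto
  define a b where "a = (\<lambda>t :: ('a \<times> 'a \<times> nat) \<times> 'a. {fst (fst t), snd t})"
    and "b = (\<lambda>t :: ('a \<times> 'a \<times> nat) \<times> 'a. {fst (snd (fst t)), snd t})"
  have cT: "real m * (s - 2 * real m) \<le> real (card T)"
  proof -
    have "s - 2 * real m \<le> real (card (Zs d))" if d: "d \<in> set D" for d
    proof -
      obtain x y i where xyi: "d = (x, y, i)" by (cases d) auto
      have "card {v \<in> V. \<pi> v = i} \<le> card (Zs d \<union> U)"
        using fZ by (intro card_mono) (auto simp: Zs_def xyi U_def)
      also have "\<dots> \<le> card (Zs d) + card U" by (rule card_Un_le)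
      finally have "real (card {v \<in> V. \<pi> v = i}) \<le> real (card (Zs d)) + 2 * real m" using cU by linarith
      moreover have "(x, y, i) \<in> set D" using d xyi by simp
      then have "s \<le> real (card {v \<in> V. \<pi> v = i})" using vD by (intro bal) blast
      ultimately show ?thesis by linarith
    qed
    then have "(\<Sum>d\<in>set D. s - 2 * real m) \<le> (\<Sum>d\<in>set D. real (card (Zs d)))" by (rule sum_mono)
    also have "\<dots> = real (card T)" unfolding T_def using fZ by (subst card_SigmaI) auto
    finally show ?thesis using cD by simp
  qed
  let ?P = "\<lambda>X. \<Prod>t\<in>T. exp (- of_bool (a t \<in> X \<and> b t \<in> X)) :: real"
  have "bexp p edge_set (\<lambda>X. of_bool (atypical t X \<pi> D)) \<le> bexp p edge_set (\<lambda>X. exp (real m * t) * ?P X)"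
  proof (rule bexp_mono[OF p])
    fix X
    show "of_bool (atypical t X \<pi> D) \<le> exp (real m * t) * ?P X"
    proof (cases "atypical t X \<pi> D")
      case True
      have "(\<Sum>t\<in>T. of_bool (a t \<in> X \<and> b t \<in> X)) = (\<Sum>d\<in>set D. \<Sum>z\<in>Zs d. of_bool (a (d, z) \<in> X \<and> b (d, z) \<in> X) :: real)"
        unfolding T_def using fZ by (subst sum.Sigma) auto
      also have "\<dots> \<le> (\<Sum>d\<in>set D. t)"
      proof (rule sum_mono)
        fix d assume d: "d \<in> set D"
        obtain x y i where xyi: "d = (x, y, i)" by (cases d) auto
        have "(\<Sum>z\<in>Zs d. of_bool (a (d, z) \<in> X \<and> b (d, z) \<in> X) :: real) = (\<Sum>z\<in>{z \<in> Zs d. {x, z} \<in> X \<and> {y, z} \<in> X}. 1)"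
          using fZ by (intro sum.mono_neutral_cong_right) (auto simp: a_def b_def xyi)
        also have "\<dots> = real (card {z \<in> Zs d. {x, z} \<in> X \<and> {y, z} \<in> X})" by simp
        also have "\<dots> \<le> real (codegree X \<pi> x y i)"
          unfolding codegree_def using fin_V by (intro of_nat_mono card_mono) (auto simp: Zs_def xyi)
        also have "\<dots> \<le> t"
        proof -
          have "(x, y, i) \<in> set D" using d xyi by simp
          then have "real (codegree X \<pi> x y i) < t" using True unfolding atypical_def by blast
          then show ?thesis by simp
        qed
        finally show "(\<Sum>z\<in>Zs d. of_bool (a (d, z) \<in> X \<and> b (d, z) \<in> X) :: real) \<le> t" .
      qed
      finally have "(\<Sum>t\<in>T. of_bool (a t \<in> X \<and> b t \<in> X) :: real) \<le> real m * t" using cD by simp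
      then have "exp 0 \<le> exp (real m * t - (\<Sum>t\<in>T. of_bool (a t \<in> X \<and> b t \<in> X)))" by (subst exp_le_cancel_iff) simp
      also have "\<dots> = exp (real m * t) * ?P X"
      proof -
        have "?P X = exp (- (\<Sum>t\<in>T. of_bool (a t \<in> X \<and> b t \<in> X)))"
          unfolding sum_negf[symmetric] by (rule exp_sum[OF fT, symmetric])
        then show ?thesis by (simp only: diff_conv_add_uminus exp_add)
      qed
      finally show ?thesis using True by simp
    next
      case False
      then show ?thesis by (simp add: prod_nonneg)
    qed
  qed
  also have "\<dots> = exp (real m * t) * bexp p edge_set ?P" by (rule bexp_cmult)
  also have "\<dots> \<le> exp (real m * t) * exp (- (p ^ 2 / 2 * real (card T)))"
  proof (intro mult_left_mono bexp_disjoint_pairs[OF fT finite_edge_set p])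
    fix t assume "t \<in> T"
    then obtain x y i z where t: "t = ((x, y, i), z)" "(x, y, i) \<in> set D" "z \<in> V" "\<pi> z = i" "z \<notin> U"
      unfolding T_def Zs_def by auto
    have "x \<noteq> y" "x \<noteq> z" "y \<noteq> z" using dd(2)[OF t(2)] UD[OF t(2)] t(5) by auto
    then show "a t \<in> edge_set \<and> b t \<in> edge_set \<and> a t \<noteq> b t"
      using vD[OF t(2)] t(1,3) by (auto simp: a_def b_def edge_in doubleton_eq_iff)
    fix t' assume "t' \<in> T" and ne: "t \<noteq> t'"
    then obtain x' y' i' z' where t': "t' = ((x', y', i'), z')" "(x', y', i') \<in> set D" "z' \<in> V" "\<pi> z' = i'" "z' \<notin> U"
      unfolding T_def Zs_def by auto
    show "{a t, b t} \<inter> {a t', b t'} = {}"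
    proof (rule ccontr)
      assume "\<not> ?thesis"
      then have "\<exists>u\<in>{x, y}. \<exists>u'\<in>{x', y'}. {u, z} = {u', z'}"
        unfolding a_def b_def t(1) t'(1) fst_conv snd_conv by blast
      then obtain u u' where u: "u \<in> {x, y}" "u' \<in> {x', y'}" "{u, z} = {u', z'}" by blast
      have "u \<in> U" "u' \<in> U" using u(1,2) UD[OF t(2)] UD[OF t'(2)] by blast+
      then have "u = u'" "z = z'" using u(3) t(5) t'(5) unfolding doubleton_eq_iff by blast+
      then have "{x, y} \<inter> {x', y'} \<noteq> {}" using u(1,2) by blast
      from dd(3)[OF t(2) t'(2) this] show False using ne \<open>z = z'\<close> t(1) t'(1) by simp
    qed
  qed simp
  also have "\<dots> \<le> exp (real m * t) * exp (- (p ^ 2 / 2 * (real m * (s - 2 * real m))))"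
    using cT by (intro mult_left_mono) (auto intro: mult_left_mono)
  also have "\<dots> = exp (real m * t - p ^ 2 / 2 * (real m * (s - 2 * real m)))" by (simp flip: exp_add)
  finally show ?thesis unfolding m_def .
qed

text \<open>The failure of \<open>typical\<close>, phrased with edge sets; y is the distance from
  the maximum cut that is tolerated for each pair.\<close>

definition near_max_atypical :: "nat \<Rightarrow> real \<Rightarrow> real \<Rightarrow> real \<Rightarrow> 'a set set \<Rightarrow> bool" where
  "near_max_atypical M s t y X \<longleftrightarrow> (\<exists>\<pi>\<in>colourings. \<exists>D. D \<noteq> [] \<and> length D \<le> M \<and> valid_pairs \<pi> D \<and>
      (\<forall>i<r. s \<le> real (card {v \<in> V. \<pi> v = i})) \<and> atypical t X \<pi> D \<and>
      (\<forall>\<pi>'\<in>colourings. real (card (X \<inter> cut \<pi>')) \<le> real (card (X \<inter> cut \<pi>)) + real (length D) * y))"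

text \<open>For K > 0 this says that some colouring has Gibbs measure at least 1 / K.\<close>

definition low_entropy :: "real \<Rightarrow> 'a set set \<Rightarrow> bool" where
  "low_entropy K X \<longleftrightarrow> (\<exists>\<pi>\<in>colourings. partition_function X \<le> K * 2 ^ card (X \<inter> cut \<pi>))"

text \<open>On the event, the near-maximum colouring has Gibbs measure at least 1 / (K 2^(m y)), so
  the indicator is at most K 2^(m y) times the total Gibbs measure of colourings having m atypical
  pairs, summed over the lists D of pairs. \<open>gibbs_harris\<close> separates measure and
  atypicality, the measures sum to 1, and only the number of lists D remains as a union
  bound.\<close>

lemma atypical_cut_prob:
  assumes p: "0 \<le> p" "p \<le> 1" and t: "0 \<le> t" and K: "0 < K" and y: "0 \<le> y"
  shows "bexp p edge_set (\<lambda>X. of_bool (near_max_atypical M s t y X \<and> low_entropy K X)) \<le>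
    (\<Sum>m=1..M. real (card V * (card V * r)) ^ m * (K * 2 powr (real m * y) *
       exp (real m * t - p ^ 2 / 2 * (real m * (s - 2 * real m)))))"
proof -
  define Ls where "Ls m = {D. set D \<subseteq> V \<times> V \<times> {..<r} \<and> length D = m}" for m
  have fLs: "finite (Ls m)" for m unfolding Ls_def using fin_V by (intro finite_lists_length_eq) auto
  have cLs: "card (Ls m) = (card V * (card V * r)) ^ m" for m
    unfolding Ls_def using fin_V by (subst card_lists_length_eq) (auto simp: card_cartesian_product)
  define ok where "ok \<pi> D \<longleftrightarrow> valid_pairs \<pi> D \<and> (\<forall>i<r. s \<le> real (card {v \<in> V. \<pi> v = i}))" for \<pi> D
  let ?w = "\<lambda>\<pi> D X. of_bool (atypical t X \<pi> D) :: real"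
  let ?c = "\<lambda>m. K * 2 powr (real m * y)"
  have nn: "0 \<le> of_bool (ok \<pi> D) * (?c m * (gibbs X \<pi> * ?w \<pi> D X))" for \<pi> D m X
    using K gibbs_pos[of X \<pi>] by simp
  have "bexp p edge_set (\<lambda>X. of_bool (near_max_atypical M s t y X \<and> low_entropy K X)) \<le>
     bexp p edge_set (\<lambda>X. \<Sum>m=1..M. \<Sum>D\<in>Ls m. \<Sum>\<pi>\<in>colourings. of_bool (ok \<pi> D) * (?c m * (gibbs X \<pi> * ?w \<pi> D X)))"
  proof (rule bexp_mono[OF p])
    fix X
    let ?R = "\<Sum>m=1..M. \<Sum>D\<in>Ls m. \<Sum>\<pi>\<in>colourings. of_bool (ok \<pi> D) * (?c m * (gibbs X \<pi> * ?w \<pi> D X))"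
    show "of_bool (near_max_atypical M s t y X \<and> low_entropy K X) \<le> ?R"
    proof (cases "near_max_atypical M s t y X \<and> low_entropy K X")
      case False
      have "0 \<le> ?R" by (intro sum_nonneg nn)
      moreover have "of_bool (near_max_atypical M s t y X \<and> low_entropy K X) = (0 :: real)"
        unfolding of_bool_def using False by (rule if_not_P)
      ultimately show ?thesis by (rule ord_eq_le_trans[rotated])
    next
      case True
      then obtain \<pi> D where \<pi>: "\<pi> \<in> colourings" and D: "D \<noteq> []" "length D \<le> M" "valid_pairs \<pi> D"
        "\<forall>i<r. s \<le> real (card {v \<in> V. \<pi> v = i})" "atypical t X \<pi> D"
        and opt: "\<And>\<pi>'. \<pi>' \<in> colourings \<Longrightarrow> real (card (X \<inter> cut \<pi>')) \<le> real (card (X \<inter> cut \<pi>)) + real (length D) * y"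
        unfolding near_max_atypical_def by blast
      obtain \<pi>' where \<pi>': "\<pi>' \<in> colourings" "partition_function X \<le> K * 2 ^ card (X \<inter> cut \<pi>')"
        using True unfolding low_entropy_def by blast
      define m where "m = length D"
      have m: "m \<in> {1..M}" using D(1,2) by (simp add: m_def Suc_leI)
      have DL: "D \<in> Ls m" using D(3) unfolding Ls_def valid_pairs_def m_def by auto
      have "partition_function X \<le> K * 2 powr real (card (X \<inter> cut \<pi>'))"
        using \<pi>'(2) by (simp add: powr_realpow)
      also have "\<dots> \<le> K * 2 powr (real (card (X \<inter> cut \<pi>)) + real m * y)"
        using K opt[OF \<pi>'(1)] by (intro mult_left_mono powr_mono) (auto simp: m_def)
      also have "\<dots> = ?c m * 2 ^ card (X \<inter> cut \<pi>)" by (simp add: powr_add powr_realpow)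
      \<comment> \<open>The cut of \<pi> is at most m y below that of the colouring provided by
        \<open>low_entropy\<close>, whose weight is at least a share 1 / K of the partition
        function.\<close>
      finally have "1 \<le> ?c m * gibbs X \<pi>"
        unfolding gibbs_def using partition_function_pos[of X] by (simp add: pos_le_divide_eq)
      also have "\<dots> = of_bool (ok \<pi> D) * (?c m * (gibbs X \<pi> * ?w \<pi> D X))"
        using D unfolding ok_def by simp
      also have "\<dots> \<le> (\<Sum>\<pi>\<in>colourings. of_bool (ok \<pi> D) * (?c m * (gibbs X \<pi> * ?w \<pi> D X)))"
        using \<pi> finite_colourings nn by (intro member_le_sum) auto
      also have "\<dots> \<le> (\<Sum>D\<in>Ls m. \<Sum>\<pi>\<in>colourings. of_bool (ok \<pi> D) * (?c m * (gibbs X \<pi> * ?w \<pi> D X)))"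
        using DL fLs nn by (intro member_le_sum[of D "Ls m"] sum_nonneg) auto
      also have "\<dots> \<le> ?R"
        using m nn by (intro member_le_sum[of m "{1..M}"] sum_nonneg) auto
      finally have "1 \<le> ?R" .
      moreover have "of_bool (near_max_atypical M s t y X \<and> low_entropy K X) = (1 :: real)"
        unfolding of_bool_def using True by (rule if_P)
      ultimately show ?thesis by (rule ord_eq_le_trans[rotated])
    qed
  qed
  also have "\<dots> = (\<Sum>m=1..M. \<Sum>D\<in>Ls m. \<Sum>\<pi>\<in>colourings. of_bool (ok \<pi> D) * (?c m * bexp p edge_set (\<lambda>X. gibbs X \<pi> * ?w \<pi> D X)))"
    by (simp only: bexp_sum bexp_cmult)
  also have "\<dots> \<le> (\<Sum>m=1..M. \<Sum>D\<in>Ls m. \<Sum>\<pi>\<in>colourings. bexp p edge_set (\<lambda>X. gibbs X \<pi>) *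
      (?c m * exp (real m * t - p ^ 2 / 2 * (real m * (s - 2 * real m)))))"
  proof (intro sum_mono)
    fix m D \<pi> assume D: "D \<in> Ls m" and \<pi>: "\<pi> \<in> colourings"
    have g0: "0 \<le> bexp p edge_set (\<lambda>X. gibbs X \<pi>)" using gibbs_pos by (intro bexp_nonneg p) (simp add: less_imp_le)
    show "of_bool (ok \<pi> D) * (?c m * bexp p edge_set (\<lambda>X. gibbs X \<pi> * ?w \<pi> D X)) \<le>
        bexp p edge_set (\<lambda>X. gibbs X \<pi>) * (?c m * exp (real m * t - p ^ 2 / 2 * (real m * (s - 2 * real m))))"
    proof (cases "ok \<pi> D")
      case False
      then show ?thesis using g0 K by simp
    next
      case True
      then have val: "valid_pairs \<pi> D" and bal: "\<And>i. i < r \<Longrightarrow> s \<le> real (card {v \<in> V. \<pi> v = i})"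
        unfolding ok_def by auto
      have mono: "codegree X \<pi> x y i \<le> codegree (insert e X) \<pi> x y i" for X e x y i
        unfolding codegree_def using fin_V by (intro card_mono) auto
      have "bexp p edge_set (\<lambda>X. gibbs X \<pi> * ?w \<pi> D X) \<le> bexp p edge_set (\<lambda>X. gibbs X \<pi>) * bexp p edge_set (?w \<pi> D)"
      proof (rule gibbs_harris[OF p])
        fix e X
        have "atypical t X \<pi> D" if at: "atypical t (insert e X) \<pi> D"
          unfolding atypical_def
        proof safe
          fix x y i assume "(x, y, i) \<in> set D"
          then have "real (codegree (insert e X) \<pi> x y i) < t" using at unfolding atypical_def by blast
          then show "real (codegree X \<pi> x y i) < t" using mono[of X x y i e] by linarith
        qed
        then show "?w \<pi> D (insert e X) \<le> ?w \<pi> D X" by (cases "atypical t (insert e X) \<pi> D") auto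
        assume e: "e \<in> edge_set" "e \<notin> cut \<pi>"
        \<comment> \<open>x and y lie in one class and z in another, so the codegree only sees edges
          cut by \<pi>.\<close>
        have "codegree (insert e X) \<pi> x y i = codegree X \<pi> x y i" if "(x, y, i) \<in> set D" for x y i
        proof -
          have xy: "x \<in> V" "y \<in> V" "\<pi> x = \<pi> y" "i \<noteq> \<pi> x" using val that unfolding valid_pairs_def by blast+
          have "{x, z} \<noteq> e" "{y, z} \<noteq> e" if "z \<in> V" "\<pi> z = i" for z
            using e(2) xy that cut_in[of x z \<pi>] cut_in[of y z \<pi>] by auto
          then have "{z \<in> V. \<pi> z = i \<and> {x, z} \<in> insert e X \<and> {y, z} \<in> insert e X} =
              {z \<in> V. \<pi> z = i \<and> {x, z} \<in> X \<and> {y, z} \<in> X}" by blast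
          then show ?thesis unfolding codegree_def by simp
        qed
        then have "atypical t (insert e X) \<pi> D = atypical t X \<pi> D" unfolding atypical_def by (intro ball_cong) auto
        then show "?w \<pi> D (insert e X) = ?w \<pi> D X" by simp
      qed
      also have "\<dots> \<le> bexp p edge_set (\<lambda>X. gibbs X \<pi>) * exp (real m * t - p ^ 2 / 2 * (real m * (s - 2 * real m)))"
        using atypical_prob[OF p val bal t] g0 D by (intro mult_left_mono) (auto simp: Ls_def)
      finally have "?c m * bexp p edge_set (\<lambda>X. gibbs X \<pi> * ?w \<pi> D X) \<le>
          ?c m * (bexp p edge_set (\<lambda>X. gibbs X \<pi>) * exp (real m * t - p ^ 2 / 2 * (real m * (s - 2 * real m))))"
        using K by (intro mult_left_mono) auto
      then show ?thesis using True by (simp add: mult_ac)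
    qed
  qed
  also have "\<dots> = (\<Sum>m=1..M. real (card (Ls m)) * (?c m * exp (real m * t - p ^ 2 / 2 * (real m * (s - 2 * real m)))))"
    unfolding sum_distrib_right[symmetric] sum_bexp_gibbs by simp
  finally show ?thesis unfolding cLs by simp
qed

end

section \<open>Discrepancy of the random graph and the final probability estimate\<close>

context graph_colouring begin

definition adj :: "'a set set \<Rightarrow> 'a \<Rightarrow> 'a \<Rightarrow> real" where
  "adj X u v = of_bool ({u, v} \<in> X)"

definition touching :: "'a set \<Rightarrow> 'a set \<Rightarrow> 'a set set" where
  "touching A B = {e \<in> edge_set. \<exists>u\<in>A. \<exists>v\<in>B. e = {u, v}}"

text \<open>A sum over ordered pairs in A \<times> B counts an edge inside A \<inter> B twice;
  \<open>touching\<close> counts it once, and this set supplies the second count.\<close>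

definition joint :: "'a set \<Rightarrow> 'a set \<Rightarrow> 'a set set" where
  "joint A B = {e \<in> edge_set. e \<subseteq> A \<inter> B}"

definition test_sets :: "'a set set set" where
  "test_sets = case_prod touching ` (Pow V \<times> Pow V) \<union> case_prod joint ` (Pow V \<times> Pow V) \<union> cut ` colourings"

definition even_spread :: "real \<Rightarrow> real \<Rightarrow> 'a set set \<Rightarrow> bool" where
  "even_spread p d X \<longleftrightarrow> \<not> (\<exists>F\<in>test_sets. \<bar>real (card (X \<inter> F)) - p * real (card F)\<bar> > d)"

lemma finite_test_sets: "finite test_sets"
  unfolding test_sets_def using fin_V finite_colourings by auto

lemma test_sets_subset: "F \<in> test_sets \<Longrightarrow> F \<subseteq> edge_set"
  unfolding test_sets_def by (auto simp: touching_def joint_def cut_def)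

lemma card_test_sets: "card test_sets \<le> 2 * 4 ^ card V + r ^ card V"
proof -
  have P: "card (Pow V \<times> Pow V) = 4 ^ card V"
    using fin_V by (simp add: card_cartesian_product card_Pow flip: power_mult_distrib)
  have fP: "finite (Pow V \<times> Pow V)" using fin_V by simp
  have "card test_sets \<le> card (case_prod touching ` (Pow V \<times> Pow V)) + card (case_prod joint ` (Pow V \<times> Pow V)) + card (cut ` colourings)"
    unfolding test_sets_def by (intro order_trans[OF card_Un_le] add_right_mono card_Un_le)
  also have "\<dots> \<le> 4 ^ card V + 4 ^ card V + card colourings"
    using card_image_le[OF fP, of "case_prod touching"] card_image_le[OF fP, of "case_prod joint"]
      card_image_le[OF finite_colourings, of cut] unfolding P by linarith
  also have "card colourings = r ^ card V" unfolding colourings_def using fin_V by (simp add: card_PiE)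
  finally show ?thesis by simp
qed

lemma card_edge_set: "real (card edge_set) \<le> real (card V) ^ 2"
proof -
  have "2 * real (card edge_set) = (\<Sum>u\<in>V. \<Sum>v\<in>V. of_bool ({u, v} \<in> edge_set))"
    by (rule ordered_count[symmetric]) simp
  also have "\<dots> \<le> (\<Sum>u\<in>V. \<Sum>v\<in>V. 1)" by (intro sum_mono) auto
  also have "\<dots> = real (card V) ^ 2" by (simp add: power2_eq_square)
  finally show ?thesis using of_nat_0_le_iff[of "card edge_set"] by linarith
qed

text \<open>The sum over ordered pairs is the count for \<open>touching\<close> plus the count for
  \<open>joint\<close>, each within d of its mean. The additional n accounts for the diagonal, where
  u = v contributes weight -p.\<close>

lemma adj_discrepancy:
  assumes X: "X \<subseteq> edge_set" and ev: "even_spread p d X" and p: "0 \<le> p" "p \<le> 1"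
    and f: "\<And>x. f1 x \<in> {0, 1 :: real}" "\<And>x. f2 x \<in> {0, 1 :: real}"
  shows "\<bar>\<Sum>u\<in>V. \<Sum>v\<in>V. f1 u * f2 v * (adj X u v - p)\<bar> \<le> 2 * d + real (card V)"
proof -
  define A B where "A = {u \<in> V. f1 u = 1}" and "B = {u \<in> V. f2 u = 1}"
  have f1: "f1 u = of_bool (u \<in> A)" "f2 u = of_bool (u \<in> B)" if "u \<in> V" for u
    using f(1)[of u] f(2)[of u] that by (auto simp: A_def B_def)
  have key: "(\<Sum>u\<in>V. \<Sum>v\<in>V. f1 u * f2 v * of_bool ({u, v} \<in> Y)) = real (card (Y \<inter> touching A B)) + real (card (Y \<inter> joint A B))"
    if Y: "Y \<subseteq> edge_set" for Y
  proof -
    let ?s = "\<Sum>u\<in>V. \<Sum>v\<in>V. f1 u * f2 v * of_bool ({u, v} \<in> Y)"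
    have "(\<Sum>u\<in>V. \<Sum>v\<in>V. f1 v * f2 u * of_bool ({v, u} \<in> Y)) = ?s" by (rule sum.swap)
    then have "2 * ?s = (\<Sum>u\<in>V. \<Sum>v\<in>V. f1 u * f2 v * of_bool ({u, v} \<in> Y) + f1 v * f2 u * of_bool ({v, u} \<in> Y))"
      by (simp add: sum.distrib)
    also have "\<dots> = (\<Sum>u\<in>V. \<Sum>v\<in>V. of_bool ({u, v} \<in> Y \<inter> touching A B) + of_bool ({u, v} \<in> Y \<inter> joint A B))"
    proof (intro sum.cong refl)
      fix u v assume uv: "u \<in> V" "v \<in> V"
      show "f1 u * f2 v * of_bool ({u, v} \<in> Y) + f1 v * f2 u * of_bool ({v, u} \<in> Y) =
          of_bool ({u, v} \<in> Y \<inter> touching A B) + of_bool ({u, v} \<in> Y \<inter> joint A B)"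
      proof (cases "{u, v} \<in> Y")
        case False
        then show ?thesis by (simp add: insert_commute[of v u])
      next
        case True
        then have e: "{u, v} \<in> edge_set" using Y by auto
        have "{u, v} \<in> touching A B \<longleftrightarrow> (u \<in> A \<and> v \<in> B) \<or> (v \<in> A \<and> u \<in> B)"
          unfolding touching_def using e by (auto simp: doubleton_eq_iff)
        moreover have "{u, v} \<in> joint A B \<longleftrightarrow> u \<in> A \<and> v \<in> A \<and> u \<in> B \<and> v \<in> B"
          unfolding joint_def using e by auto
        ultimately show ?thesis
          using True f1[OF uv(1)] f1[OF uv(2)] by (auto simp: insert_commute[of v u])
      qed
    qed
    also have "\<dots> = 2 * real (card (Y \<inter> touching A B)) + 2 * real (card (Y \<inter> joint A B))"
      unfolding sum.distrib using Y by (intro arg_cong2[of _ _ _ _ "(+)"] ordered_count) auto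
    finally show ?thesis by simp
  qed
  have AB: "A \<in> Pow V" "B \<in> Pow V" by (auto simp: A_def B_def)
  have "touching A B \<in> test_sets" "joint A B \<in> test_sets" using AB unfolding test_sets_def by force+
  then have dev: "\<bar>real (card (X \<inter> touching A B)) - p * real (card (touching A B))\<bar> \<le> d"
    "\<bar>real (card (X \<inter> joint A B)) - p * real (card (joint A B))\<bar> \<le> d"
    using ev unfolding even_spread_def by (simp_all add: not_less)
  have inE: "edge_set \<inter> touching A B = touching A B" "edge_set \<inter> joint A B = joint A B"
    unfolding touching_def joint_def by auto
  have all: "(\<Sum>u\<in>V. \<Sum>v\<in>V. f1 u * f2 v) = real (card (touching A B)) + real (card (joint A B)) + (\<Sum>u\<in>V. f1 u * f2 u)"
  proof -
    have "(\<Sum>u\<in>V. \<Sum>v\<in>V. f1 u * f2 v) = (\<Sum>u\<in>V. \<Sum>v\<in>V. f1 u * f2 v * of_bool ({u, v} \<in> edge_set) + (if u = v then f1 u * f2 u else 0))"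
      by (intro sum.cong refl) (auto simp: edge_in)
    also have "\<dots> = (\<Sum>u\<in>V. \<Sum>v\<in>V. f1 u * f2 v * of_bool ({u, v} \<in> edge_set)) + (\<Sum>u\<in>V. f1 u * f2 u)"
      unfolding sum.distrib using fin_V by simp
    finally show ?thesis using key[of edge_set] inE by simp
  qed
  have dg: "0 \<le> (\<Sum>u\<in>V. f1 u * f2 u)" "(\<Sum>u\<in>V. f1 u * f2 u) \<le> real (card V)"
  proof -
    have "0 \<le> f1 u * f2 u \<and> f1 u * f2 u \<le> 1" for u using f(1)[of u] f(2)[of u] by auto
    then show "0 \<le> (\<Sum>u\<in>V. f1 u * f2 u)" "(\<Sum>u\<in>V. f1 u * f2 u) \<le> real (card V)"
      using sum_nonneg[of V "\<lambda>u. f1 u * f2 u"] sum_mono[of V "\<lambda>u. f1 u * f2 u" "\<lambda>_. 1"] by auto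
  qed
  have "(\<Sum>u\<in>V. \<Sum>v\<in>V. f1 u * f2 v * (adj X u v - p)) = (\<Sum>u\<in>V. \<Sum>v\<in>V. f1 u * f2 v * of_bool ({u, v} \<in> X)) - p * (\<Sum>u\<in>V. \<Sum>v\<in>V. f1 u * f2 v)"
    unfolding adj_def sum_distrib_left sum_subtractf[symmetric] by (intro sum.cong refl) (simp add: algebra_simps)
  also have "\<dots> = (real (card (X \<inter> touching A B)) - p * real (card (touching A B))) +
      (real (card (X \<inter> joint A B)) - p * real (card (joint A B))) - p * (\<Sum>u\<in>V. f1 u * f2 u)"
    unfolding all key[OF X] by (simp add: algebra_simps)
  finally have eq: "(\<Sum>u\<in>V. \<Sum>v\<in>V. f1 u * f2 v * (adj X u v - p)) = \<dots>" .
  have "0 \<le> p * (\<Sum>u\<in>V. f1 u * f2 u)" "p * (\<Sum>u\<in>V. f1 u * f2 u) \<le> 1 * real (card V)"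
    using dg p mult_right_mono[OF p(2) dg(1)] by auto
  then show ?thesis unfolding eq using dev by linarith
qed

lemma quasi_random_adj:
  assumes X: "X \<subseteq> edge_set" and ev: "even_spread p d X"
    and par: "0 < \<theta>" "\<theta> \<le> 1 / 10" "\<theta> \<le> p" "p \<le> 1" "0 \<le> \<delta>"
    and d: "2 * d + real (card V) \<le> \<delta> * real (card V) ^ 2"
  shows "quasi_random V (adj X) p \<delta> \<theta>"
proof
  show "adj X x y = 0" if "x \<notin> V" for x y
    using X that edge_in[of x y] unfolding adj_def by auto
  show "adj X x x = 0" for x using X edge_in[of x x] unfolding adj_def by auto
  show "\<bar>\<Sum>u\<in>V. \<Sum>v\<in>V. f1 u * f2 v * (adj X u v - p)\<bar> \<le> \<delta> * real (card V) ^ 2"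
    if "\<And>x. f1 x \<in> {0, 1}" "\<And>x. f2 x \<in> {0, 1}" for f1 f2
  proof -
    have "0 \<le> p" using par by linarith
    then have "\<bar>\<Sum>u\<in>V. \<Sum>v\<in>V. f1 u * f2 v * (adj X u v - p)\<bar> \<le> 2 * d + real (card V)"
      by (rule adj_discrepancy[OF X ev _ par(4)]) (use that in auto)
    then show ?thesis using d by linarith
  qed
qed (use par fin_V V_ne in \<open>auto simp: adj_def insert_commute\<close>)

text \<open>By Markov's inequality and \<open>total_variance\<close>, four times the sum of the
  variances is at most D except with the stated probability. Half of the Gibbs measure then lies in
  a ball of radius D, and K is twice the bound of \<open>ball_card\<close> on its size.\<close>

lemma low_entropy_prob:
  assumes p: "0 < p" "p < 1" and d: "0 \<le> d" and D: "0 < D" and Q: "real r * sqrt (2 * D) \<le> real Q"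
    and dev: "bexp p edge_set (\<lambda>X. of_bool (\<not> even_spread p d X)) \<le> \<epsilon>" and e0: "0 \<le> \<epsilon>"
    and K: "K = 2 * real (r ^ r * (card V * r) ^ Q)"
  shows "bexp p edge_set (\<lambda>X. of_bool (\<not> low_entropy K X)) \<le> 8 * (d + real (card V) ^ 2 * \<epsilon>) / (p * (1 - p) * D)"
proof -
  have p': "0 \<le> p" "p \<le> 1" using p by auto
  let ?v = "\<lambda>X. \<Sum>e\<in>edge_set. marginal X e * (1 - marginal X e)"
  have v0: "0 \<le> ?v X" for X using marginal_bounds by (intro sum_nonneg mult_nonneg_nonneg) auto
  have low: "low_entropy K X" if X: "X \<subseteq> edge_set" and v: "4 * ?v X \<le> D" for X
  proof -
    let ?c = "\<lambda>\<pi>. card (X \<inter> cut \<pi>)"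
    have "Max (?c ` colourings) \<in> ?c ` colourings" using finite_colourings S_nonempty by (intro Max_in) auto
    then obtain \<pi> where \<pi>: "\<pi> \<in> colourings" "?c \<pi> = Max (?c ` colourings)" by auto
    have mx: "?c \<rho> \<le> ?c \<pi>" if "\<rho> \<in> colourings" for \<rho>
      unfolding \<pi>(2) using finite_colourings that by (intro Max_ge) auto
    obtain \<rho> where \<rho>: "\<rho> \<in> colourings" "partition_function X \<le> 2 * real (card {\<pi> \<in> colourings. real (card {e \<in> edge_set. (e \<in> cut \<pi>) \<noteq> (e \<in> cut \<rho>)}) \<le> D}) * 2 ^ ?c \<pi>"
      using partition_function_le[OF X v D mx] by blast
    note \<rho>(2)
    also have "2 * real (card {\<pi> \<in> colourings. real (card {e \<in> edge_set. (e \<in> cut \<pi>) \<noteq> (e \<in> cut \<rho>)}) \<le> D}) * 2 ^ ?c \<pi> \<le> K * 2 ^ ?c \<pi>"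
      unfolding K using of_nat_mono[OF ball_card[OF \<rho>(1) Q D]] by (intro mult_right_mono mult_left_mono) auto
    finally show ?thesis unfolding low_entropy_def using \<pi>(1) by blast
  qed
  have "bexp p edge_set (\<lambda>X. of_bool (\<not> low_entropy K X)) \<le> bexp p edge_set (\<lambda>X. 4 / D * ?v X)"
  proof (rule bexp_mono[OF p'])
    fix X assume X: "X \<subseteq> edge_set"
    show "of_bool (\<not> low_entropy K X) \<le> 4 / D * ?v X"
    proof (cases "low_entropy K X")
      case True
      then show ?thesis using v0[of X] D by simp
    next
      case False
      then have "D < 4 * ?v X" using low[OF X] not_le by blast
      then show ?thesis using False D by (simp add: field_simps)
    qed
  qed
  also have "\<dots> = 4 / D * bexp p edge_set ?v" by (rule bexp_cmult)
  also have "\<dots> \<le> 4 / D * (2 * (d + real (card V) ^ 2 * \<epsilon>) / (p * (1 - p)))"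
  proof (rule mult_left_mono)
    have "bexp p edge_set (\<lambda>X. of_bool (\<exists>\<pi>\<in>colourings. \<bar>real (card (X \<inter> cut \<pi>)) - p * real (card (cut \<pi>))\<bar> > d)) \<le>
        bexp p edge_set (\<lambda>X. of_bool (\<not> even_spread p d X))"
      by (intro bexp_mono p') (auto simp: even_spread_def test_sets_def of_bool_def)
    then have "p * (1 - p) / 2 * bexp p edge_set ?v \<le> d + real (card edge_set) * \<epsilon>"
      using dev by (intro total_variance p' d) linarith
    also have "\<dots> \<le> d + real (card V) ^ 2 * \<epsilon>"
      using card_edge_set e0 by (intro add_left_mono mult_right_mono)
    finally show "bexp p edge_set ?v \<le> 2 * (d + real (card V) ^ 2 * \<epsilon>) / (p * (1 - p))"
      using p by (simp add: field_simps)
  qed (use D in auto)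
  also have "\<dots> = 8 * (d + real (card V) ^ 2 * \<epsilon>) / (p * (1 - p) * D)" by (simp add: field_simps)
  finally show ?thesis .
qed

definition star :: "'a \<Rightarrow> 'a set set" where
  "star x = {e \<in> edge_set. x \<in> e}"

lemma star_eq: "x \<in> V \<Longrightarrow> star x = (\<lambda>z. {x, z}) ` (V - {x})"
  unfolding star_def by (auto simp: edge_in elim!: edgeE)

lemma card_star_Int:
  assumes "x \<in> V" "X \<subseteq> edge_set"
  shows "card (X \<inter> star x) = card {z \<in> V. {x, z} \<in> X}"
proof -
  have "X \<inter> star x = (\<lambda>z. {x, z}) ` {z \<in> V. {x, z} \<in> X}"
    using assms star_eq[OF assms(1)] edge_in[of x x] by auto
  moreover have "inj_on (\<lambda>z. {x, z}) A" for A by (auto simp: inj_on_def doubleton_eq_iff)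
  ultimately show ?thesis by (simp add: card_image)
qed

text \<open>Meant for p near 1: the two ends of a pair miss at most w vertices each, so a class of
  size at least t + 2 w contains at least t common neighbours of theirs.\<close>

lemma no_atypical_if_large_degrees:
  assumes X: "X \<subseteq> edge_set" and deg: "\<And>x. x \<in> V \<Longrightarrow> real (card V) - w \<le> real (card {z \<in> V. {x, z} \<in> X})"
    and s: "t + 2 * w \<le> s"
  shows "\<not> near_max_atypical M s t y X"
proof
  assume "near_max_atypical M s t y X"
  then obtain \<pi> D where D: "D \<noteq> []" "valid_pairs \<pi> D" "\<And>i. i < r \<Longrightarrow> s \<le> real (card {v \<in> V. \<pi> v = i})" "atypical t X \<pi> D"
    unfolding near_max_atypical_def by blast
  obtain x y' i where d: "(x, y', i) \<in> set D" using D(1) by (metis list.set_intros(1) neq_Nil_conv prod_cases3)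
  have xy: "x \<in> V" "y' \<in> V" "i < r" using D(2) d unfolding valid_pairs_def by blast+
  let ?A = "{z \<in> V. \<pi> z = i \<and> {x, z} \<in> X \<and> {y', z} \<in> X}"
  have "{v \<in> V. \<pi> v = i} \<subseteq> ?A \<union> (V - {z \<in> V. {x, z} \<in> X}) \<union> (V - {z \<in> V. {y', z} \<in> X})" by auto
  then have "card {v \<in> V. \<pi> v = i} \<le> card (?A \<union> (V - {z \<in> V. {x, z} \<in> X}) \<union> (V - {z \<in> V. {y', z} \<in> X}))"
    using fin_V by (intro card_mono) auto
  also have "\<dots> \<le> card ?A + card (V - {z \<in> V. {x, z} \<in> X}) + card (V - {z \<in> V. {y', z} \<in> X})"
    by (intro order_trans[OF card_Un_le] add_right_mono card_Un_le)
  finally have "s \<le> real (card ?A) + real (card (V - {z \<in> V. {x, z} \<in> X})) + real (card (V - {z \<in> V. {y', z} \<in> X}))"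
    using D(3)[OF xy(3)] by linarith
  moreover have w: "real (card (V - {z \<in> V. {x, z} \<in> X})) \<le> w" if "x \<in> V" for x
  proof -
    have "card (V - {z \<in> V. {x, z} \<in> X}) = card V - card {z \<in> V. {x, z} \<in> X}" using fin_V by (intro card_Diff_subset) auto
    moreover have "card {z \<in> V. {x, z} \<in> X} \<le> card V" using fin_V by (intro card_mono) auto
    ultimately show ?thesis using deg[OF that] by simp
  qed
  moreover have "real (card ?A) < t" using D(4) d unfolding atypical_def codegree_def by blast
  ultimately show False using w[OF xy(1)] w[OF xy(2)] s by linarith
qed

lemma typical_if_not_near_max_atypical:
  assumes X: "X \<subseteq> edge_set" and q: "quasi_random V (adj X) p \<delta> \<theta>" and M: "real (card V) / (16 * real r) < real M + 1"
    and na: "\<not> near_max_atypical M (real (card V) / (2 * real r)) (\<theta> ^ 3 * real (card V)) (\<theta> ^ 6 * real (card V)) X"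
  shows "quasi_random.typical V (adj X) \<theta> r"
proof -
  interpret q: quasi_random V "adj X" p \<delta> \<theta> by (rule q)
  have cr: "q.cross (adj X) \<pi> = 2 * real (card (X \<inter> cut \<pi>))" for \<pi>
  proof -
    have "q.cross (adj X) \<pi> = (\<Sum>u\<in>V. \<Sum>v\<in>V. of_bool ({u, v} \<in> X \<inter> cut \<pi>))"
      unfolding q.cross_def adj_def by (intro sum.cong refl) (auto simp: cut_in)
    also have "\<dots> = 2 * real (card (X \<inter> cut \<pi>))" using X by (intro ordered_count) auto
    finally show ?thesis .
  qed
  have cd: "(\<Sum>z\<in>V. of_bool (\<pi> z = i) * (adj X x z * adj X y z)) = real (codegree X \<pi> x y i)" for \<pi> x y and i :: nat
  proof -
    have "(\<Sum>z\<in>V. of_bool (\<pi> z = i) * (adj X x z * adj X y z)) = (\<Sum>z\<in>{z \<in> V. \<pi> z = i \<and> {x, z} \<in> X \<and> {y, z} \<in> X}. 1)"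
      unfolding adj_def using fin_V by (intro sum.mono_neutral_cong_right) auto
    then show ?thesis unfolding codegree_def by simp
  qed
  show ?thesis
    unfolding q.typical_def
  proof (intro ballI allI impI, elim conjE)
    fix \<pi> D
    assume \<pi>: "\<pi> \<in> V \<rightarrow>\<^sub>E {..<r}" and bal: "\<forall>i<r. real (card V) / (2 * real r) \<le> real (card {v \<in> V. \<pi> v = i})"
      and D: "D \<noteq> []" "16 * real r * real (length D) \<le> real (card V)" "distinct (pair_vertices D)"
      and D4: "\<forall>(x, y, i)\<in>set D. x \<in> V \<and> y \<in> V \<and> \<pi> x = \<pi> y \<and> i < r \<and> i \<noteq> \<pi> x \<and>
        (\<Sum>z\<in>V. of_bool (\<pi> z = i) * (adj X x z * adj X y z)) < \<theta> ^ 3 * real (card V)"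
    have \<pi>': "\<pi> \<in> colourings" using \<pi> by (simp add: colourings_def)
    have val: "valid_pairs \<pi> D" using D(3) D4 unfolding valid_pairs_def by blast
    have at: "atypical (\<theta> ^ 3 * real (card V)) X \<pi> D" using D4 unfolding atypical_def cd by blast
    have "real (length D) \<le> real (card V) / (16 * real r)" using D(2) r_pos by (simp add: field_simps)
    then have "length D \<le> M" using M by linarith
    then have "\<not> (\<forall>\<rho>\<in>colourings. real (card (X \<inter> cut \<rho>)) \<le> real (card (X \<inter> cut \<pi>)) + real (length D) * (\<theta> ^ 6 * real (card V)))"
      using na \<pi>' D(1) val bal at unfolding near_max_atypical_def by blast
    then obtain \<rho> where "\<rho> \<in> colourings" "real (card (X \<inter> cut \<rho>)) > real (card (X \<inter> cut \<pi>)) + real (length D) * (\<theta> ^ 6 * real (card V))"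
      by (auto simp: not_le)
    then show "\<exists>\<rho>\<in>V \<rightarrow>\<^sub>E {..<r}. q.cross (adj X) \<pi> + 2 * real (length D) * \<theta> ^ 6 * real (card V) < q.cross (adj X) \<rho>"
      unfolding cr colourings_def by (intro bexI[of _ \<rho>]) auto
  qed
qed

lemma structure_probability:
  fixes p \<delta> \<theta> :: real
  defines "N \<equiv> real (card V)"
  assumes r2: "r \<ge> 2" and th: "0 < \<theta>" "64 * real r * \<theta> \<le> 1" and p: "\<theta> \<le> p" "p \<le> 1"
    and del: "0 < \<delta>" "\<delta> \<le> \<theta> ^ 40" "3 * N \<le> \<delta> * N ^ 2"
    and e1: "2 * (2 * 4 ^ card V + real r ^ card V) * exp (- (\<delta> ^ 2 * N ^ 2 / 36)) \<le> \<theta> ^ 40"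
    and Q: "real r * sqrt (2 * (\<theta> ^ 16 * N ^ 2)) \<le> real Q"
    and e2: "2 * (real r ^ r * (N * real r) ^ Q) \<le> exp (\<theta> ^ 5 * N)"
    and e3: "N * (N * real r) \<le> exp (\<theta> ^ 3 * N)"
    and e4: "N * exp (- (\<theta> ^ 3 * N)) \<le> \<theta>"
    and e5: "2 * N * exp (- (N / (6400 * real r ^ 2))) \<le> \<theta>"
  shows "bexp p edge_set (\<lambda>X. of_bool (\<not> (quasi_random V (adj X) p \<delta> \<theta> \<and> quasi_random.typical V (adj X) \<theta> r))) \<le> 4 * \<theta>"
proof -
  have p': "0 \<le> p" "0 < p" using th p by auto
  have th1: "\<theta> \<le> 1 / 10" "\<theta> \<le> 1"
  proof -
    have "64 * 2 * \<theta> \<le> 64 * real r * \<theta>" using r2 th by (intro mult_right_mono) auto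
    then show "\<theta> \<le> 1 / 10" "\<theta> \<le> 1" using th by linarith+
  qed
  have pow: "\<theta> ^ b \<le> \<theta> ^ a" if "a \<le> b" for a b using that th th1 by (intro power_decreasing) auto
  have N1: "1 \<le> N" unfolding N_def using fin_V V_ne by (simp add: Suc_leI card_gt_0_iff)
  \<comment> \<open>With s = \<delta> / 6 and M = N^2 the exponent s^2 M - s d equals -\<delta>^2
    N^2 / 36. Also 2 d + N \<le> \<delta> N^2 because 3 N \<le> \<delta> N^2, as
    \<open>quasi_random_adj\<close> requires.\<close>
  define d where "d = \<delta> * N ^ 2 / 3"
  define \<epsilon> where "\<epsilon> = \<theta> ^ 40"
  have d0: "0 \<le> d" using del by (simp add: d_def)
  have ev: "bexp p edge_set (\<lambda>X. of_bool (\<not> even_spread p d X)) \<le> \<epsilon>"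
  proof -
    have "bexp p edge_set (\<lambda>X. of_bool (\<exists>F\<in>test_sets. \<bar>real (card (X \<inter> F)) - p * real (card F)\<bar> > d)) \<le>
      2 * real (card test_sets) * exp ((\<delta> / 6) ^ 2 * N ^ 2 - \<delta> / 6 * d)"
    proof (rule deviation_probability[OF finite_edge_set p'(1) p(2) _ _ finite_test_sets])
      have "\<delta> \<le> 1" using del(2) pow[of 0 40] by simp
      then show "0 \<le> \<delta> / 6" "\<delta> / 6 \<le> 1" using del by auto
      fix F assume "F \<in> test_sets"
      then have F: "F \<subseteq> edge_set" by (rule test_sets_subset)
      then have "real (card F) \<le> real (card edge_set)" using finite_edge_set by (intro of_nat_mono card_mono)
      then show "F \<subseteq> edge_set \<and> real (card F) \<le> N ^ 2" using F card_edge_set unfolding N_def by linarith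
    qed
    also have "(\<delta> / 6) ^ 2 * N ^ 2 - \<delta> / 6 * d = - (\<delta> ^ 2 * N ^ 2 / 36)"
      by (simp add: d_def power2_eq_square)
    also have "2 * real (card test_sets) * exp (- (\<delta> ^ 2 * N ^ 2 / 36)) \<le>
        2 * (2 * 4 ^ card V + real r ^ card V) * exp (- (\<delta> ^ 2 * N ^ 2 / 36))"
      using of_nat_mono[OF card_test_sets, where ?'a = real] by (intro mult_right_mono mult_left_mono) auto
    also note e1
    finally show ?thesis unfolding even_spread_def \<epsilon>_def by simp
  qed
  define M where "M = nat \<lfloor>N / (16 * real r)\<rfloor>"
  have N16: "0 \<le> N / (16 * real r)" using N1 by simp
  then have M: "real M \<le> N / (16 * real r)" "N / (16 * real r) < real M + 1" unfolding M_def by linarith+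
  define s t y where "s = N / (2 * real r)" and "t = \<theta> ^ 3 * N" and "y = \<theta> ^ 6 * N"
  have split: "bexp p edge_set (\<lambda>X. of_bool (\<not> (quasi_random V (adj X) p \<delta> \<theta> \<and> quasi_random.typical V (adj X) \<theta> r))) \<le>
     \<epsilon> + bexp p edge_set (\<lambda>X. of_bool (near_max_atypical M s t y X))"
  proof -
    have "bexp p edge_set (\<lambda>X. of_bool (\<not> (quasi_random V (adj X) p \<delta> \<theta> \<and> quasi_random.typical V (adj X) \<theta> r))) \<le>
      bexp p edge_set (\<lambda>X. of_bool (\<not> even_spread p d X) + of_bool (near_max_atypical M s t y X))"
    proof (rule bexp_mono[OF p'(1) p(2)])
      fix X assume X: "X \<subseteq> edge_set"
      have "quasi_random V (adj X) p \<delta> \<theta>" if "even_spread p d X"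
        using del th th1 p by (intro quasi_random_adj[OF X that]) (auto simp: d_def N_def)
      moreover have "quasi_random.typical V (adj X) \<theta> r"
        if "quasi_random V (adj X) p \<delta> \<theta>" "\<not> near_max_atypical M s t y X"
        using typical_if_not_near_max_atypical[OF X that(1), of M] M(2) that(2) unfolding s_def t_def y_def N_def by simp
      ultimately show "of_bool (\<not> (quasi_random V (adj X) p \<delta> \<theta> \<and> quasi_random.typical V (adj X) \<theta> r)) \<le>
        (of_bool (\<not> even_spread p d X) + of_bool (near_max_atypical M s t y X) :: real)"
        by (cases "even_spread p d X"; cases "near_max_atypical M s t y X") auto
    qed
    also have "\<dots> = bexp p edge_set (\<lambda>X. of_bool (\<not> even_spread p d X)) + bexp p edge_set (\<lambda>X. of_bool (near_max_atypical M s t y X))"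
      by (rule bexp_add)
    finally show ?thesis using ev by linarith
  qed
  have eps: "\<epsilon> \<le> \<theta>" unfolding \<epsilon>_def using pow[of 1 40] by simp
  have rpos: "real r > 0" using r2 by simp
  show ?thesis
  \<comment> \<open>\<open>low_entropy_prob\<close> divides by 1 - p, so the Gibbs argument needs p
    bounded away from 1; above the threshold all degrees are almost N.\<close>
  proof (cases "p \<le> 1 - 1 / (20 * real r)")
    case True
    define K where "K = 2 * real (r ^ r * (card V * r) ^ Q)"
    have K: "0 < K" "K \<le> exp (\<theta> ^ 5 * N)"
      using e2 r2 fin_V V_ne unfolding K_def N_def by (auto simp: card_gt_0_iff)
    have "bexp p edge_set (\<lambda>X. of_bool (near_max_atypical M s t y X)) \<le>
        bexp p edge_set (\<lambda>X. of_bool (near_max_atypical M s t y X \<and> low_entropy K X) + of_bool (\<not> low_entropy K X))"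
      by (intro bexp_mono p'(1) p(2)) (auto simp: of_bool_def)
    also have "\<dots> = bexp p edge_set (\<lambda>X. of_bool (near_max_atypical M s t y X \<and> low_entropy K X)) +
        bexp p edge_set (\<lambda>X. of_bool (\<not> low_entropy K X))"
      by (rule bexp_add)
    also have "bexp p edge_set (\<lambda>X. of_bool (\<not> low_entropy K X)) \<le> \<theta>"
    proof -
      \<comment> \<open>A ball of this radius in edges amounts to about \<theta>^8 N vertices, which
        is what \<open>e2\<close> turns into K \<le> exp(\<theta>^5 N). The deviation bounds with
        \<theta>^40 leave a wide margin after division by \<theta> * \<theta>^16.\<close>
      let ?D = "\<theta> ^ 16 * N ^ 2"
      have k: "1 / (20 * real r) \<le> 1 - p" using True by linarith
      have p1: "p < 1" using k rpos by (smt (verit) divide_pos_pos)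
      have D0: "0 < ?D" using th N1 by simp
      have "bexp p edge_set (\<lambda>X. of_bool (\<not> low_entropy K X)) \<le> 8 * (d + real (card V) ^ 2 * \<epsilon>) / (p * (1 - p) * ?D)"
        using th by (intro low_entropy_prob[OF p'(2) p1 d0 D0 Q ev _ K_def]) (simp add: \<epsilon>_def)
      also have "\<dots> \<le> 8 * (2 * (\<epsilon> * N ^ 2)) / (\<theta> * (1 / (20 * real r)) * ?D)"
      proof (rule frac_le)
        have "\<delta> * N ^ 2 \<le> \<epsilon> * N ^ 2" using del unfolding \<epsilon>_def by (intro mult_right_mono) auto
        moreover have "0 \<le> \<delta> * N ^ 2" using del by simp
        ultimately show "8 * (d + real (card V) ^ 2 * \<epsilon>) \<le> 8 * (2 * (\<epsilon> * N ^ 2))"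
          unfolding d_def N_def[symmetric] by (simp add: mult.commute)
        show "0 < \<theta> * (1 / (20 * real r)) * ?D" using th rpos D0 by simp
        show "\<theta> * (1 / (20 * real r)) * ?D \<le> p * (1 - p) * ?D"
          using k p th D0 rpos by (intro mult_right_mono mult_mono) auto
      qed (use th in \<open>simp add: \<epsilon>_def\<close>)
      also have "\<dots> = 5 * (64 * real r * \<theta>) * \<theta> ^ 22"
      proof -
        have "\<epsilon> = \<theta> ^ 22 * (\<theta> * (\<theta> * \<theta> ^ 16))" unfolding \<epsilon>_def by (simp flip: power_Suc power_add)
        then show ?thesis using th N1 rpos by (simp add: field_simps)
      qed
      also have "\<dots> \<le> 5 * 1 * \<theta> ^ 22" using th by (intro mult_right_mono mult_left_mono) auto
      also have "\<dots> \<le> 5 * \<theta> ^ 2" using pow[of 2 22] by simp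
      also have "\<dots> = (5 * \<theta>) * \<theta>" by (simp add: power2_eq_square)
      also have "\<dots> \<le> 1 * \<theta>" using th th1 by (intro mult_right_mono) auto
      finally show ?thesis by simp
    qed
    also have "bexp p edge_set (\<lambda>X. of_bool (near_max_atypical M s t y X \<and> low_entropy K X)) \<le> \<theta>"
    proof -
      have ty: "0 \<le> t" "0 \<le> y" unfolding t_def y_def using th N1 by auto
      have "bexp p edge_set (\<lambda>X. of_bool (near_max_atypical M s t y X \<and> low_entropy K X)) \<le>
        (\<Sum>m=1..M. real (card V * (card V * r)) ^ m * (K * 2 powr (real m * y) *
          exp (real m * t - p ^ 2 / 2 * (real m * (s - 2 * real m)))))"
        by (rule atypical_cut_prob[OF p'(1) p(2) ty(1) K(1) ty(2)])
      also have "\<dots> \<le> (\<Sum>m=1..M. exp (- t))"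
      proof (rule sum_mono)
        fix m assume m: "m \<in> {1..M}"
        have m1: "1 \<le> real m" "real m \<le> real M" using m by auto
        have mt: "t \<le> real m * t" using m1 ty mult_right_mono[of 1 "real m" t] by simp
        have A: "real (card V * (card V * r)) ^ m \<le> exp (real m * t)"
        proof -
          have "real (card V * (card V * r)) ^ m \<le> exp t ^ m"
            using e3 unfolding N_def t_def by (intro power_mono) auto
          then show ?thesis by (simp add: exp_of_nat_mult)
        qed
        have B: "K \<le> exp (real m * t)"
        proof -
          have "\<theta> ^ 5 * N \<le> t" unfolding t_def using pow[of 3 5] N1 by (intro mult_right_mono) auto
          then have "exp (\<theta> ^ 5 * N) \<le> exp (real m * t)" using mt by simp
          then show ?thesis using K(2) by linarith
        qed
        have C: "2 powr (real m * y) \<le> exp (real m * t)"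
        proof -
          have "2 powr (real m * y) = exp (real m * y * ln 2)" by (simp add: powr_def)
          moreover have "real m * y * ln 2 \<le> real m * y * 1" using ty ln_le_minus_one[of 2] by (intro mult_left_mono) auto
          moreover have "y \<le> t" unfolding t_def y_def using pow[of 3 6] N1 by (intro mult_right_mono) auto
          then have "real m * y \<le> real m * t" by (intro mult_left_mono) auto
          ultimately show ?thesis by simp
        qed
        have D: "exp (real m * t - p ^ 2 / 2 * (real m * (s - 2 * real m))) \<le> exp (real m * t - 12 * (real m * t))"
        proof -
          have r1: "3 * N / (8 * real r) \<le> s - 2 * real m"
          proof -
            have "s - 2 * (N / (16 * real r)) = 3 * N / (8 * real r)" unfolding s_def using rpos by (simp add: field_simps)
            then show ?thesis using m1 M(1) by linarith
          qed
          \<comment> \<open>With t = \<theta>^3 N this is exactly the condition 64 r \<theta> \<le>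
            1.\<close>
          have "12 * t \<le> \<theta> ^ 2 / 2 * (3 * N / (8 * real r))"
          proof -
            have "(64 * real r * \<theta>) * (\<theta> ^ 2 * N) \<le> 1 * (\<theta> ^ 2 * N)" using th N1 by (intro mult_right_mono) auto
            then show ?thesis unfolding t_def using rpos by (simp add: field_simps power2_eq_square power3_eq_cube)
          qed
          also have "\<dots> \<le> p ^ 2 / 2 * (s - 2 * real m)"
            using r1 p th N1 rpos by (intro mult_mono divide_right_mono power_mono) auto
          finally have "real m * (12 * t) \<le> real m * (p ^ 2 / 2 * (s - 2 * real m))" by (intro mult_left_mono) auto
          then show ?thesis by (simp add: mult_ac)
        qed
        \<comment> \<open>The choice of the pairs, K, the slack of the cut and the exponential
          moment cost at most exp(m t) each, against a gain of exp(-12 m t).\<close>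
        have "real (card V * (card V * r)) ^ m * (K * 2 powr (real m * y) * exp (real m * t - p ^ 2 / 2 * (real m * (s - 2 * real m)))) \<le>
          exp (real m * t) * (exp (real m * t) * exp (real m * t) * exp (real m * t - 12 * (real m * t)))"
          using K(1) by (intro mult_mono A B C D) auto
        also have "\<dots> = exp (- (8 * (real m * t)))" by (simp flip: exp_add)
        also have "\<dots> \<le> exp (- t)" using mt ty by simp
        finally show "real (card V * (card V * r)) ^ m * (K * 2 powr (real m * y) * exp (real m * t - p ^ 2 / 2 * (real m * (s - 2 * real m)))) \<le> exp (- t)" .
      qed
      also have "\<dots> = real M * exp (- t)" by simp
      also have "\<dots> \<le> N * exp (- t)"
      proof (rule mult_right_mono)
        have "N / (16 * real r) \<le> N / 1" using N1 r2 by (intro divide_left_mono) auto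
        then show "real M \<le> N" using M(1) by simp
      qed simp
      also have "\<dots> \<le> \<theta>" unfolding t_def by (rule e4)
      finally show ?thesis .
    qed
    finally show ?thesis using split eps th by linarith
  next
    case False
    \<comment> \<open>w = N / (20 r) + 2 N / (40 r): the edges absent on average, the deviation of a
      degree, and the missing loop that leaves N - 1 possible neighbours.\<close>
    define w where "w = N / (10 * real r)"
    have "bexp p edge_set (\<lambda>X. of_bool (near_max_atypical M s t y X)) \<le>
       bexp p edge_set (\<lambda>X. of_bool (\<exists>F\<in>star ` V. \<bar>real (card (X \<inter> F)) - p * real (card F)\<bar> > N / (40 * real r)))"
    proof (rule bexp_mono[OF p'(1) p(2)])
      fix X assume X: "X \<subseteq> edge_set"
      have "\<not> near_max_atypical M s t y X" if no: "\<not> (\<exists>F\<in>star ` V. \<bar>real (card (X \<inter> F)) - p * real (card F)\<bar> > N / (40 * real r))"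
      proof (rule no_atypical_if_large_degrees[OF X])
        show "t + 2 * w \<le> s"
        proof -
          have "\<theta> ^ 3 \<le> \<theta> ^ 1" by (rule pow) simp
          then have "\<theta> ^ 3 * N \<le> \<theta> * N" using N1 by (intro mult_right_mono) auto
          moreover have "(64 * real r * \<theta>) * N \<le> 1 * N" using th N1 by (intro mult_right_mono) auto
          then have "\<theta> * N \<le> N / (64 * real r)" using rpos by (simp add: field_simps)
          moreover have "N / (64 * real r) + 2 * w \<le> s" unfolding w_def s_def using rpos N1 by (simp add: field_simps)
          ultimately show ?thesis unfolding t_def by linarith
        qed
        fix x assume x: "x \<in> V"
        have "star x \<subseteq> edge_set" by (auto simp: star_def)
        then have "card (star x) = card {z \<in> V. {x, z} \<in> star x}" using card_star_Int[OF x, of "star x"] by simp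
        also have "{z \<in> V. {x, z} \<in> star x} = V - {x}" using x by (auto simp: star_def edge_in)
        finally have "card (star x) = card V - 1" using x fin_V by simp
        moreover have "1 \<le> card V" using x fin_V by (metis One_nat_def Suc_leI card_gt_0_iff empty_iff)
        ultimately have cs: "real (card (star x)) = N - 1" unfolding N_def by (simp only: of_nat_diff of_nat_1)
        have "p * (N - 1) - N / (40 * real r) \<le> real (card {z \<in> V. {x, z} \<in> X})"
          using no x card_star_Int[OF x X] cs by (force simp: not_less abs_le_iff)
        moreover have "N - 1 - N / (20 * real r) \<le> p * (N - 1)"
        proof -
          have "(N - 1) / (20 * real r) \<le> N / (20 * real r)" using rpos by (intro divide_right_mono) auto
          then have "N - 1 - N / (20 * real r) \<le> N - 1 - (N - 1) / (20 * real r)" by (rule diff_left_mono)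
          also have "\<dots> = (1 - 1 / (20 * real r)) * (N - 1)" by (simp add: left_diff_distrib)
          also have "\<dots> \<le> p * (N - 1)" using False N1 by (intro mult_right_mono) auto
          finally show ?thesis .
        qed
        moreover have "1 \<le> N / (40 * real r)"
        proof -
          have "3 * N \<le> (\<delta> * N) * N" using del(3) by (simp add: power2_eq_square)
          then have "3 \<le> \<delta> * N" using N1 by (simp only: mult_le_cancel_right)
          also have "\<dots> \<le> \<theta> * N" using del(2) pow[of 1 40] N1 by (intro mult_right_mono) auto
          finally have "64 * real r * 3 \<le> 64 * real r * (\<theta> * N)" using rpos by (intro mult_left_mono) auto
          also have "\<dots> = (64 * real r * \<theta>) * N" by simp
          also have "\<dots> \<le> 1 * N" using th N1 by (intro mult_right_mono) auto
          finally show ?thesis using rpos by (simp add: field_simps)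
        qed
        moreover have "w = N / (20 * real r) + N / (40 * real r) + N / (40 * real r)" unfolding w_def using rpos by (simp add: field_simps)
        moreover have "P - b \<le> c \<Longrightarrow> N - 1 - a \<le> P \<Longrightarrow> 1 \<le> b \<Longrightarrow> w = a + b + b \<Longrightarrow> N - w \<le> c" for P a b c :: real
          by linarith
        ultimately show "real (card V) - w \<le> real (card {z \<in> V. {x, z} \<in> X})" unfolding N_def[symmetric] by blast
      qed
      then show "of_bool (near_max_atypical M s t y X) \<le> (of_bool (\<exists>F\<in>star ` V. \<bar>real (card (X \<inter> F)) - p * real (card F)\<bar> > N / (40 * real r)) :: real)"
        by (auto simp: of_bool_def)
    qed
    also have "\<dots> \<le> 2 * real (card (star ` V)) * exp ((1 / (80 * real r)) ^ 2 * N - 1 / (80 * real r) * (N / (40 * real r)))"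
    proof (rule deviation_probability[OF finite_edge_set p'(1) p(2)])
      fix F assume "F \<in> star ` V"
      then obtain x where x: "x \<in> V" "F = star x" by blast
      have "star x \<subseteq> edge_set" by (auto simp: star_def)
      moreover have "card (star x) \<le> card V"
      proof -
        have "card (star x) \<le> card (V - {x})" unfolding star_eq[OF x(1)] using fin_V by (intro card_image_le) auto
        also have "\<dots> \<le> card V" using fin_V by (intro card_mono) auto
        finally show ?thesis .
      qed
      ultimately show "F \<subseteq> edge_set \<and> real (card F) \<le> N" using x unfolding N_def by simp
    qed (use r2 fin_V in auto)
    also have "(1 / (80 * real r)) ^ 2 * N - 1 / (80 * real r) * (N / (40 * real r)) = - (N / (6400 * real r ^ 2))"
      using rpos by (simp add: field_simps power2_eq_square)
    also have "2 * real (card (star ` V)) * exp (- (N / (6400 * real r ^ 2))) \<le> 2 * N * exp (- (N / (6400 * real r ^ 2)))"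
      unfolding N_def using card_image_le[OF fin_V, of star] by (intro mult_right_mono mult_left_mono) auto
    also note e5
    finally show ?thesis using split eps th by linarith
  qed
qed

end

section \<open>Maximum clique-free subgraphs\<close>

lemma contains_copy_complete:
  assumes S: "card S = l" "l \<ge> 2" and H: "simple_graph H"
    and cl: "\<And>u v. u \<in> S \<Longrightarrow> v \<in> S \<Longrightarrow> u \<noteq> v \<Longrightarrow> {u, v} \<in> edges H"
  shows "contains_copy (complete_graph l) H"
proof -
  have fS: "finite S" using S by (metis card.infinite not_numeral_le_zero)
  have SV: "S \<subseteq> vertices H"
  proof
    fix u assume u: "u \<in> S"
    have "card (S - {u}) \<noteq> 0" using S fS u by simp
    then obtain v where "v \<in> S" "v \<noteq> u" by (metis Diff_iff card.empty ex_in_conv insertCI)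
    then have "{u, v} \<in> nsets (vertices H) 2" using cl u H unfolding simple_graph_def by blast
    then show "u \<in> vertices H" by simp
  qed
  have SE: "nsets S 2 \<subseteq> edges H" using cl by (auto simp: nsets_2_eq)
  obtain f where f: "bij_betw f {1..l} S"
    using fS S by (metis card_atLeastAtMost diff_Suc_1 finite_atLeastAtMost finite_same_card_bij)
  have "subgraph (S, nsets S 2) H"
    using SV SE by (simp add: subgraph_def simple_graph_def vertices_def edges_def)
  moreover have "graph_iso (complete_graph l) (S, nsets S 2)"
    unfolding graph_iso_def
  proof (intro exI conjI)
    show "bij_betw f (vertices (complete_graph l)) (vertices (S, nsets S 2))"
      using f by (simp add: vertices_def complete_graph_def)
    show "edges (S, nsets S 2) = (\<lambda>e. f ` e) ` edges (complete_graph l)"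
      using bij_betw_nsets[OF f, of 2] by (simp add: edges_def complete_graph_def bij_betw_def)
  qed
  ultimately show ?thesis unfolding contains_copy_def by blast
qed

text \<open>Pigeonhole. Colours are bounded by r only at ends of edges, and 2 \<le> l makes every
  vertex of the clique such an end.\<close>

lemma clique_free_if_coloured:
  assumes "r < l" "2 \<le> l" and col: "\<And>u v. {u, v} \<in> edges H \<Longrightarrow> u \<noteq> v \<Longrightarrow> \<pi> u \<noteq> \<pi> v \<and> \<pi> u < (r :: nat)"
  shows "clique_free l H"
  unfolding clique_free_def contains_copy_def
proof
  assume "\<exists>K. subgraph K H \<and> graph_iso (complete_graph l) K"
  then obtain K f where K: "subgraph K H" and f': "bij_betw f (vertices (complete_graph l)) (vertices K)"
    and e': "edges K = (\<lambda>e. f ` e) ` edges (complete_graph l)"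
    unfolding graph_iso_def by blast
  have f: "bij_betw f {1..l} (vertices K)" using f' by (simp add: vertices_def complete_graph_def)
  have e: "edges K = (\<lambda>e. f ` e) ` nsets {1..l} 2" using e' by (simp add: edges_def complete_graph_def)
  have inj: "inj_on f {1..l}" using f by (simp add: bij_betw_def)
  have edge: "\<pi> (f i) \<noteq> \<pi> (f j) \<and> \<pi> (f i) < r" if "i \<in> {1..l}" "j \<in> {1..l}" "i \<noteq> j" for i j
  proof -
    have "{i, j} \<in> nsets {1..l} 2" using that by simp
    then have "f ` {i, j} \<in> edges K" unfolding e by (rule imageI)
    then have "{f i, f j} \<in> edges K" by simp
    then have "{f i, f j} \<in> edges H" using K unfolding subgraph_def by blast
    moreover have "f i \<noteq> f j" using inj_onD[OF inj] that by blast
    ultimately show ?thesis by (rule col)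
  qed
  have "\<pi> (f i) < r" if i: "i \<in> {1..l}" for i
  proof -
    have "\<exists>j\<in>{1..l}. i \<noteq> j"
    proof (cases "i = 1")
      case True
      then show ?thesis using assms(2) by (intro bexI[of _ 2]) auto
    next
      case False
      then show ?thesis using assms(2) by (intro bexI[of _ 1]) auto
    qed
    then show ?thesis using edge[OF i] by blast
  qed
  then have "(\<lambda>i. \<pi> (f i)) ` {1..l} \<subseteq> {..<r}" by auto
  moreover have "inj_on (\<lambda>i. \<pi> (f i)) {1..l}" using edge by (intro inj_onI) blast
  ultimately have "card {1..l} \<le> card {..<r}" by (intro card_inj_on_le) auto
  then show False using assms(1) by simp
qed

text \<open>The edges of X cut by any colouring form a clique-free subgraph, so maximality of H
  supplies the hypothesis of \<open>exact_structure\<close> that \<open>h\<close> has at least as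
  many edges as every cut of \<open>g\<close>. The classes of the resulting colouring are
  intersected with the vertices of H, which may be fewer than V.\<close>

lemma max_subgraph_partite:
  fixes V :: "'a set" and \<theta> :: real and X :: "'a set set"
  assumes r: "r \<ge> 2" "32 * real r * \<theta> \<le> 1" "32 * real r \<le> real (card V)"
    and J: "J = 3 ^ r * (4 * r + 31) + 1" and \<delta>: "\<delta> \<le> \<theta> ^ (2 ^ (r + 1) * (J + 3))"
    and q: "quasi_random V (graph_colouring.adj X) p \<delta> \<theta>"
    and ty: "quasi_random.typical V (graph_colouring.adj X) \<theta> r"
    and X: "X \<subseteq> nsets V 2" and H: "max_clique_free_subgraph (Suc r) (V, X) H"
  shows "partite r H"
proof -
  interpret q: quasi_random V "graph_colouring.adj X" p \<delta> \<theta> by (rule q)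
  interpret c: graph_colouring V r using q.finite_V q.V_nonempty r(1) by unfold_locales auto
  have sub: "subgraph H (V, X)" and free: "clique_free (Suc r) H"
    and max: "\<And>H'. subgraph H' (V, X) \<Longrightarrow> clique_free (Suc r) H' \<Longrightarrow> card (edges H') \<le> card (edges H)"
    using H unfolding max_clique_free_subgraph_def by auto
  have simple: "simple_graph H" and VH: "vertices H \<subseteq> V" and EH: "edges H \<subseteq> X"
    using sub unfolding subgraph_def by (auto simp: vertices_def edges_def)
  have EHe: "edges H \<subseteq> c.edge_set" using EH X unfolding c.edge_set_def by auto
  define h where "h u v = (of_bool ({u, v} \<in> edges H) :: real)" for u v
  have hs: "q.sub h"
    unfolding q.sub_def h_def c.adj_def using EH by (auto simp: insert_commute of_bool_def)
  have hdeg: "(\<Sum>x\<in>V. q.deg h x) = 2 * real (card (edges H))"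
    unfolding q.deg_def h_def by (rule c.ordered_count[OF EHe])
  have hfree: "q.kfree (Suc r) h"
    unfolding q.kfree_def
  proof safe
    fix S assume S: "S \<subseteq> V" "card S = Suc r" "\<forall>u\<in>S. \<forall>v\<in>S. u \<noteq> v \<longrightarrow> h u v = 1"
    have "contains_copy (complete_graph (Suc r)) H"
    proof (rule contains_copy_complete[OF S(2) _ simple])
      show "{u, v} \<in> edges H" if "u \<in> S" "v \<in> S" "u \<noteq> v" for u v
      proof -
        have "h u v = 1" using S(3) that by blast
        then show ?thesis by (simp add: h_def of_bool_def split: if_splits)
      qed
    qed (use r in auto)
    then show False using free unfolding clique_free_def by blast
  qed
  have "\<exists>\<pi>\<in>V \<rightarrow>\<^sub>E {..<r}. q.inside h \<pi> = 0"
  proof (rule q.exact_structure[OF r refl _ \<delta> ty hs hfree])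
    show "J = 3 ^ r * (4 * r + 18 + 13) + 1" using J by simp
    fix \<pi> assume \<pi>: "\<pi> \<in> V \<rightarrow>\<^sub>E {..<r}"
    let ?H = "(V, X \<inter> c.cut \<pi>)"
    have "subgraph ?H (V, X)"
      using X unfolding subgraph_def simple_graph_def by (auto simp: vertices_def edges_def)
    moreover have "clique_free (Suc r) ?H"
      by (rule clique_free_if_coloured[of r _ _ \<pi>]) (use \<pi> r in \<open>auto simp: edges_def c.cut_in\<close>)
    ultimately have "card (edges ?H) \<le> card (edges H)" by (rule max)
    moreover have "edges ?H = X \<inter> c.cut \<pi>" by (simp add: edges_def)
    ultimately have "card (X \<inter> c.cut \<pi>) \<le> card (edges H)" by simp
    moreover have "q.cross (graph_colouring.adj X) \<pi> = 2 * real (card (X \<inter> c.cut \<pi>))"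
    proof -
      have "q.cross (graph_colouring.adj X) \<pi> = (\<Sum>u\<in>V. \<Sum>v\<in>V. of_bool ({u, v} \<in> X \<inter> c.cut \<pi>))"
        unfolding q.cross_def c.adj_def by (intro sum.cong refl) (auto simp: c.cut_in)
      also have "\<dots> = 2 * real (card (X \<inter> c.cut \<pi>))"
        using X by (intro c.ordered_count) (auto simp: c.edge_set_def)
      finally show ?thesis .
    qed
    ultimately show "q.cross (graph_colouring.adj X) \<pi> \<le> (\<Sum>x\<in>V. q.deg h x)" unfolding hdeg by simp
  qed
  then obtain \<pi> where \<pi>: "\<pi> \<in> V \<rightarrow>\<^sub>E {..<r}" and zero: "q.inside h \<pi> = 0" by blast
  have proper: "\<pi> u \<noteq> \<pi> v" if e: "{u, v} \<in> edges H" "u \<in> V" "v \<in> V" for u v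
  proof
    assume eq: "\<pi> u = \<pi> v"
    have "(1 :: real) = of_bool (\<pi> u = \<pi> v) * h u v" using e eq by (simp add: h_def)
    also have "\<dots> \<le> (\<Sum>v\<in>V. of_bool (\<pi> u = \<pi> v) * h u v)"
      using e q.finite_V by (intro member_le_sum) (auto simp: h_def)
    also have "\<dots> \<le> q.inside h \<pi>"
      unfolding q.inside_def using e q.finite_V
      by (intro member_le_sum[of u V "\<lambda>u. \<Sum>v\<in>V. of_bool (\<pi> u = \<pi> v) * h u v"] sum_nonneg) (auto simp: h_def)
    finally show False using zero by simp
  qed
  define P where "P i = {v \<in> vertices H. \<pi> v = i}" for i
  show ?thesis
    unfolding partite_def
  proof (intro exI[of _ P] conjI ballI allI impI)
    show "disjoint_family_on P {..<r}" by (auto simp: P_def disjoint_family_on_def)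
    show "(\<Union>i<r. P i) = vertices H" using \<pi> VH by (auto simp: P_def)
    fix e i assume e: "e \<in> edges H"
    then obtain u v where uv: "e = {u, v}" "u \<in> V" "v \<in> V" using EHe c.edgeE by (metis subsetD)
    then show "\<not> e \<subseteq> P i" using proper[of u v] e by (auto simp: P_def)
  qed
qed

text \<open>By the choice of the exponent, \<theta>^K = n^(-1/10), so every \<theta>^k with k \<le>
  K is at least n^(-1/10). This reduces most conditions to fixed powers of n; for instance
  (\<theta>^K)^2 n^2 = n^(9/5) beats the exponentially many test sets.\<close>

lemma eventually_parameters:
  fixes r K :: nat
  assumes r: "r \<ge> 2" and K: "K \<ge> 40"
  defines "\<theta> \<equiv> \<lambda>n :: nat. real n powr (- (1 / (10 * real K)))"
  shows "\<forall>\<^sub>F n in sequentially. n \<ge> 1 \<and> 64 * real r * \<theta> n \<le> 1 \<and> 32 * real r \<le> real n \<and>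
    \<theta> n ^ K \<le> \<theta> n ^ 40 \<and> 3 * real n \<le> \<theta> n ^ K * real n ^ 2 \<and>
    2 * (2 * 4 ^ n + real r ^ n) * exp (- ((\<theta> n ^ K) ^ 2 * real n ^ 2 / 36)) \<le> \<theta> n ^ 40 \<and>
    (\<exists>Q. real r * sqrt (2 * (\<theta> n ^ 16 * real n ^ 2)) \<le> real Q \<and>
       2 * (real r ^ r * (real n * real r) ^ Q) \<le> exp (\<theta> n ^ 5 * real n)) \<and>
    real n * (real n * real r) \<le> exp (\<theta> n ^ 3 * real n) \<and>
    real n * exp (- (\<theta> n ^ 3 * real n)) \<le> \<theta> n \<and>
    2 * real n * exp (- (real n / (6400 * real r ^ 2))) \<le> \<theta> n"
proof -
  define c where "c = 1 / (10 * real K)"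
  define a where "a = real r"
  have c: "c > 0" and a: "a \<ge> 2" "a > 0" using K r by (auto simp: c_def a_def)
  have "\<forall>\<^sub>F n :: nat in sequentially. real n powr (- c) \<le> 1 / (64 * a)"
    using c a by real_asymp
  moreover have "\<forall>\<^sub>F n :: nat in sequentially. 32 * a \<le> real n" by real_asymp
  moreover have "\<forall>\<^sub>F n :: nat in sequentially. 3 * real n \<le> real n powr (- 1 / 10) * real n ^ 2" by real_asymp
  moreover have "\<forall>\<^sub>F n :: nat in sequentially. 36 * (ln (4 + a) + 1) \<le> real n powr (4 / 5)" by real_asymp
  moreover have "\<forall>\<^sub>F n :: nat in sequentially. 6 * exp (- real n) \<le> real n powr (- 1 / 10)" by real_asymp
  \<comment> \<open>The lists that describe a ball have entropy of order \<theta>^8 n ln(n r); one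
    factor \<theta> has to absorb the logarithm.\<close>
  moreover have "\<forall>\<^sub>F n :: nat in sequentially. real n powr (- c) * ln (real n * a) \<le> 1 / (4 * a)"
    using c a by real_asymp
  moreover have "\<forall>\<^sub>F n :: nat in sequentially. ln 2 + a * ln a + ln (real n * a) \<le> 1 / 2 * real n powr (9 / 10)"
    using a by real_asymp
  moreover have "\<forall>\<^sub>F n :: nat in sequentially. real n * (real n * a) \<le> exp (real n powr (9 / 10))"
    using a by real_asymp
  moreover have "\<forall>\<^sub>F n :: nat in sequentially. real n * exp (- (real n powr (9 / 10))) \<le> real n powr (- 1 / 10)" by real_asymp
  moreover have "\<forall>\<^sub>F n :: nat in sequentially. 2 * real n * exp (- (real n / (6400 * a ^ 2))) \<le> real n powr (- 1 / 10)"
    using a by real_asymp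
  moreover have "\<forall>\<^sub>F n :: nat in sequentially. n \<ge> 1" by (rule eventually_ge_at_top)
  ultimately show ?thesis
  proof eventually_elim
    case (elim n)
    let ?N = "real n" and ?t = "\<theta> n"
    have N: "?N \<ge> 1" "?N > 0" using elim by auto
    have t: "?t = ?N powr (- c)" by (simp add: \<theta>_def c_def)
    have t0: "0 < ?t" "?t \<le> 1" unfolding t using N c powr_mono[of "- c" 0 ?N] by auto
    have tk: "?t ^ k = ?N powr (- c * real k)" for k
      unfolding t using N by (simp add: powr_powr flip: powr_realpow)
    have tK: "?t ^ K = ?N powr (- 1 / 10)" unfolding tk c_def using K by (simp add: field_simps)
    have tge: "?N powr (- 1 / 10) \<le> ?t ^ k" if "k \<le> K" for k
      unfolding tK[symmetric] using that t0 by (intro power_decreasing) auto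
    have tN: "?N powr (9 / 10) \<le> ?t ^ k * ?N" if "k \<le> K" for k
    proof -
      have "?N powr (9 / 10) = ?N powr (- 1 / 10) * ?N powr 1" by (simp only: powr_add[symmetric]) simp
      then have "?N powr (9 / 10) = ?N powr (- 1 / 10) * ?N" using N by simp
      then show ?thesis using tge[OF that] N by (simp add: mult_right_mono)
    qed
    have g1: "64 * real r * ?t \<le> 1" using elim(1) a unfolding t a_def by (simp add: field_simps)
    have g2: "?t ^ K \<le> ?t ^ 40" using K t0 by (intro power_decreasing) auto
    have g3: "2 * (2 * 4 ^ n + real r ^ n) * exp (- ((?t ^ K) ^ 2 * ?N ^ 2 / 36)) \<le> ?t ^ 40"
    proof -
      have "(?t ^ K) ^ 2 * ?N ^ 2 = ?N powr (4 / 5) * ?N"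
      proof -
        have "(?t ^ K) ^ 2 * ?N ^ 2 = ?N powr (- 1 / 10) * ?N powr (- 1 / 10) * (?N powr 1 * ?N powr 1)"
          unfolding tK using N by (simp add: power2_eq_square)
        also have "\<dots> = ?N powr (4 / 5) * ?N powr 1" by (simp only: powr_add[symmetric]) simp
        finally show ?thesis using N by simp
      qed
      moreover have "36 * (ln (4 + a) + 1) * ?N \<le> ?N powr (4 / 5) * ?N" using elim(4) N by (intro mult_right_mono) auto
      moreover have "36 * u * v \<le> w \<Longrightarrow> x = w \<Longrightarrow> - (x / 36) \<le> - (u * v)" for u v w x :: real by simp
      ultimately have "- ((?t ^ K) ^ 2 * ?N ^ 2 / 36) \<le> - ((ln (4 + a) + 1) * ?N)" by blast
      then have "exp (- ((?t ^ K) ^ 2 * ?N ^ 2 / 36)) \<le> exp (- ((ln (4 + a) + 1) * ?N))"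
        by (simp only: exp_le_cancel_iff)
      also have "\<dots> = exp (- ?N) / (4 + a) ^ n"
      proof -
        have "exp (?N * ln (4 + a)) = (4 + a) ^ n" using a by (simp add: exp_of_nat_mult)
        moreover have "- ((ln (4 + a) + 1) * ?N) = - ?N - ?N * ln (4 + a)" by (simp add: algebra_simps)
        ultimately show ?thesis by (simp add: exp_diff)
      qed
      finally have "2 * (2 * 4 ^ n + real r ^ n) * exp (- ((?t ^ K) ^ 2 * ?N ^ 2 / 36)) \<le>
          2 * (2 * (4 + a) ^ n + (4 + a) ^ n) * (exp (- ?N) / (4 + a) ^ n)"
        using a unfolding a_def by (intro mult_mono add_mono power_mono) auto
      also have "\<dots> = 6 * exp (- ?N)" using a by (simp add: field_simps)
      also have "\<dots> \<le> ?t ^ 40" using elim(5) tge[of 40] K by linarith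
      finally show ?thesis .
    qed
    have g4: "\<exists>Q. real r * sqrt (2 * (?t ^ 16 * ?N ^ 2)) \<le> real Q \<and> 2 * (real r ^ r * (?N * real r) ^ Q) \<le> exp (?t ^ 5 * ?N)"
    proof (intro exI conjI)
      let ?q = "real r * sqrt (2 * (?t ^ 16 * ?N ^ 2))"
      define Q where "Q = nat \<lceil>?q\<rceil>"
      have q0: "0 \<le> ?q" by simp
      show "?q \<le> real Q" unfolding Q_def by linarith
      have Q1: "real Q \<le> ?q + 1" unfolding Q_def using q0 by linarith
      have "2 * (?t ^ 16 * ?N ^ 2) \<le> (2 * (?t ^ 8 * ?N)) ^ 2" by (simp add: power_mult_distrib flip: power_mult)
      then have "sqrt (2 * (?t ^ 16 * ?N ^ 2)) \<le> 2 * (?t ^ 8 * ?N)" using t0 N by (intro real_le_lsqrt) auto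
      then have "?q \<le> a * (2 * (?t ^ 8 * ?N))" unfolding a_def by (intro mult_left_mono) auto
      with Q1 have Q2: "real Q \<le> a * (2 * (?t ^ 8 * ?N)) + 1" by linarith
      have Na: "?N * a \<ge> 1" using N a mult_mono[of 1 ?N 1 a] by simp
      have l0: "0 \<le> ln (?N * a)" using Na by simp
      have "real Q * ln (?N * a) \<le> (a * (2 * (?t ^ 8 * ?N)) + 1) * ln (?N * a)" using Q2 l0 by (rule mult_right_mono)
      also have "\<dots> = a * (2 * (?t ^ 7 * ?N)) * (?t * ln (?N * a)) + ln (?N * a)"
        by (simp add: algebra_simps eval_nat_numeral)
      also have "\<dots> \<le> a * (2 * (?t ^ 7 * ?N)) * (1 / (4 * a)) + ln (?N * a)"
        using elim(6) t0 a N unfolding t[symmetric] by (intro add_right_mono mult_left_mono) auto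
      also have "\<dots> = 1 / 2 * (?t ^ 7 * ?N) + ln (?N * a)" using a by simp
      also have "\<dots> \<le> 1 / 2 * (?t ^ 5 * ?N) + ln (?N * a)"
        using t0 N by (intro add_right_mono mult_left_mono mult_right_mono power_decreasing) auto
      finally have "ln 2 + a * ln a + real Q * ln (?N * a) \<le> 1 / 2 * (?t ^ 5 * ?N) + 1 / 2 * ?N powr (9 / 10)"
        using elim(7) by linarith
      also have "\<dots> \<le> ?t ^ 5 * ?N" using tN[of 5] K by simp
      finally have "exp (ln 2 + a * ln a + real Q * ln (?N * a)) \<le> exp (?t ^ 5 * ?N)" by simp
      moreover have "exp (ln 2 + a * ln a + real Q * ln (?N * a)) = 2 * (real r ^ r * (?N * real r) ^ Q)"
      proof -
        have "exp (a * ln a) = real r ^ r" unfolding a_def using r by (simp add: exp_of_nat_mult)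
        moreover have "exp (real Q * ln (?N * a)) = (?N * real r) ^ Q" using Na unfolding a_def by (simp add: exp_of_nat_mult)
        ultimately show ?thesis by (simp add: exp_add)
      qed
      ultimately show "2 * (real r ^ r * (?N * real r) ^ Q) \<le> exp (?t ^ 5 * ?N)" by simp
    qed
    have t3: "exp (?N powr (9 / 10)) \<le> exp (?t ^ 3 * ?N)" using tN[of 3] K by simp
    then have g5: "?N * (?N * real r) \<le> exp (?t ^ 3 * ?N)" using elim(8) unfolding a_def by linarith
    have "?N * exp (- (?t ^ 3 * ?N)) \<le> ?N * exp (- (?N powr (9 / 10)))"
      using tN[of 3] K N by (intro mult_left_mono) auto
    then have g6: "?N * exp (- (?t ^ 3 * ?N)) \<le> ?t" using elim(9) tge[of 1] K by simp
    have g7: "2 * ?N * exp (- (?N / (6400 * real r ^ 2))) \<le> ?t" using elim(10) tge[of 1] K unfolding a_def by simp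
    show ?case using elim(11) g1 elim(2)[unfolded a_def] g2 elim(3)[folded tK] g3 g4 g5 g6 g7 by blast
  qed
qed

theorem theorem1p5:
  fixes l :: nat
  assumes "l \<ge> 3"
  shows "\<exists>c::real. c > 0 \<and>
    (\<forall>p :: nat \<Rightarrow> real.
      (\<forall>n\<ge>1. real n powr (- c) \<le> p n \<and> p n \<le> 1) \<longrightarrow>
      (\<lambda>n. measure_pmf.prob (Gnp n (p n))
             {G. \<forall>H. max_clique_free_subgraph l G H \<longrightarrow> partite (l - 1) H})
        \<longlonglongrightarrow> 1)"
proof -
  define r where "r = l - 1"
  have r: "r \<ge> 2" and l: "l = Suc r" using assms by (auto simp: r_def)
  \<comment> \<open>\<open>exact_structure\<close> has j = 4 r + 18, hence j + 13 = 4 r + 31. K is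
    the exponent its discrepancy hypothesis asks for, and c is chosen to make \<theta>^K =
    n^(-1/10).\<close>
  define J where "J = 3 ^ r * (4 * r + 31) + 1"
  define K where "K = 2 ^ (r + 1) * (J + 3)"
  define c where "c = 1 / (10 * real K)"
  define \<theta> where "\<theta> n = real n powr (- c)" for n :: nat
  have "39 \<le> 1 * (4 * r + 31)" using r by simp
  also have "\<dots> \<le> 3 ^ r * (4 * r + 31)" by (intro mult_right_mono) auto
  finally have "40 \<le> J" by (simp add: J_def)
  then have "40 \<le> 1 * (J + 3)" by simp
  also have "\<dots> \<le> K" unfolding K_def by (intro mult_right_mono) auto
  finally have K: "40 \<le> K" .
  have c: "c > 0" using K by (simp add: c_def)
  let ?S = "{G. \<forall>H. max_clique_free_subgraph l G H \<longrightarrow> partite (l - 1) H} :: nat graph set"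
  have "(\<lambda>n. measure_pmf.prob (Gnp n (p n)) ?S) \<longlonglongrightarrow> 1"
    if p: "\<forall>n\<ge>1. real n powr (- c) \<le> p n \<and> p n \<le> 1" for p
  proof (rule tendsto_sandwich)
    show "\<forall>\<^sub>F n in sequentially. measure_pmf.prob (Gnp n (p n)) ?S \<le> 1" by simp
    show "(\<lambda>n. 1 - 4 * \<theta> n) \<longlonglongrightarrow> 1" unfolding \<theta>_def using c by real_asymp
    show "\<forall>\<^sub>F n in sequentially. 1 - 4 * \<theta> n \<le> measure_pmf.prob (Gnp n (p n)) ?S"
      using eventually_parameters[OF r K]
    proof eventually_elim
      case (elim n)
      have \<theta>: "real n powr (- (1 / (10 * real K))) = \<theta> n" by (simp add: \<theta>_def c_def)
      note E = elim[unfolded \<theta>]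
      let ?V = "{1..n}"
      have n1: "n \<ge> 1" using E by blast
      have cV: "card ?V = n" by simp
      interpret c: graph_colouring ?V r using n1 r by unfold_locales auto
      have th0: "0 < \<theta> n" using n1 by (simp add: \<theta>_def)
      have pn: "\<theta> n \<le> p n" "p n \<le> 1" using p n1 by (auto simp: \<theta>_def)
      have p0: "0 \<le> p n" using pn th0 by linarith
      let ?ok = "\<lambda>X. quasi_random ?V (graph_colouring.adj X) (p n) (\<theta> n ^ K) (\<theta> n) \<and>
          quasi_random.typical ?V (graph_colouring.adj X) (\<theta> n) r"
      obtain Q where Q: "real r * sqrt (2 * (\<theta> n ^ 16 * real n ^ 2)) \<le> real Q"
        "2 * (real r ^ r * (real n * real r) ^ Q) \<le> exp (\<theta> n ^ 5 * real n)" using E by blast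
      have "bexp (p n) c.edge_set (\<lambda>X. of_bool (\<not> ?ok X)) \<le> 4 * \<theta> n"
        by (rule c.structure_probability[where Q = Q, unfolded cV]) (use r E pn th0 Q in auto)
      then have "1 - 4 * \<theta> n \<le> 1 - bexp (p n) c.edge_set (\<lambda>X. of_bool (\<not> ?ok X))" by simp
      also have "\<dots> = bexp (p n) c.edge_set (\<lambda>X. 1 - of_bool (\<not> ?ok X))"
        by (simp only: bexp_diff bexp_const[OF c.finite_edge_set])
      also have "\<dots> \<le> bexp (p n) c.edge_set (\<lambda>X. of_bool ((?V, X) \<in> ?S))"
      proof (rule bexp_mono[OF p0 pn(2)])
        fix X assume X: "X \<subseteq> c.edge_set"
        have "(?V, X) \<in> ?S" if ok: "?ok X"
        proof -
          have "partite r H" if H: "max_clique_free_subgraph (Suc r) (?V, X) H" for H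
          proof (rule max_subgraph_partite[OF r _ _ J_def _ conjunct1[OF ok] conjunct2[OF ok] _ H])
            have "0 \<le> real r * \<theta> n" using th0 by simp
            then show "32 * real r * \<theta> n \<le> 1" using E by linarith
            show "32 * real r \<le> real (card ?V)" using E by simp
            show "\<theta> n ^ K \<le> \<theta> n ^ (2 ^ (r + 1) * (J + 3))" by (simp add: K_def)
            show "X \<subseteq> nsets ?V 2" using X unfolding c.edge_set_def .
          qed
          then show ?thesis unfolding l by simp
        qed
        then show "1 - of_bool (\<not> ?ok X) \<le> (of_bool ((?V, X) \<in> ?S) :: real)" by (cases "?ok X") auto
      qed
      also have "\<dots> = measure_pmf.prob (Gnp n (p n)) ?S"
        unfolding c.edge_set_def by (rule Gnp_prob[OF p0 pn(2), symmetric])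
      finally show ?case .
    qed
  qed simp
  then show ?thesis using c by blast
qed

end
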